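(* Let $(\mathcal S,\mathcal D,E,B)$ satisfy assumptions (i)–(iv) of the context, let $\Lambda=E(\mathcal S)$, and let $\mathrm W_\Lambda$ be the geodesic restriction of $\mathrm W$ to $\Lambda$. For $i=1,2$ let $\gamma_i:[0,\varepsilon)\to\mathcal S$, for some $\varepsilon>0$, be differentiable curves with $\gamma_i(0)=\theta\in\mathcal S$ and $\dot\gamma_i(0)=\eta_i\in\mathcal D_\theta$ such that $d_{\mathcal S}(\gamma_i(t),\exp_\theta(t\eta_i))=o(t)$ as $t\to0$. Let $T_t^i$ be the optimal transport map from $\lambda_\theta$ to $\lambda_{\exp_\theta(t\eta_i)}$. Then, as $t\to0$, $$\Big|\mathrm W_\Lambda(\lambda_{\gamma_1(t)},\lambda_{\gamma_2(t)})-t\,\|B_\theta(\eta_1-\eta_2)\|_{L^2(\lambda_\theta)}\Big|=o(t),$$ $$\Big|\mathrm W(\lambda_{\gamma_1(t)},\lambda_{\gamma_2(t)})-\|T_t^1-T_t^2\|_{L^2(\lambda_\theta)}\Big|=o(t),$$ and $$\frac{d}{dt}\mathrm W_\Lambda(\lambda_{\gamma_1(t)},\lambda_{\gamma_2(t)})\Big|_{t=0}=\frac{d}{dt}\mathrm W(\lambda_{\gamma_1(t)},\lambda_{\gamma_2(t)})\Big|_{t=0}=\|B_\theta(\eta_1-\eta_2)\|_{L^2(\lambda_\theta)}.$$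
   Context: $\Omega\subset\mathbb R^d$ is compact and convex, $\mathcal P(\Omega)$ is the set of probability measures on $\Omega$, $\mathrm W$ is the Wasserstein-2 distance, $\mathrm W(\mu,\nu)^2=\inf_{\pi}\int|x-y|^2\,d\pi$ over couplings $\pi$ of $\mu,\nu$. For absolutely continuous $\mu$, the optimal transport map from $\mu$ to $\nu$ is the ($\mu$-a.e. unique) map $T$ such that $(\mathrm{id},T)_\#\mu$ is the optimal coupling (Brenier). $L^2(\mu)$ means $L^2(\mu;\mathbb R^d)$. $\|\cdot\|_{C^1(\mathbb R^d)}$ is the supremum norm of the function and its first derivatives. $\#$ denotes push-forward. Derivatives at $t=0$ are right derivatives. Assumptions. (i) $\mathcal S$ is a compact, connected, finite-dimensional smooth Riemannian manifold with tangent norms $\|\eta\|_\theta$ ($\eta\in T_\theta\mathcal S$) and induced distance $d_{\mathcal S}$. $\mathcal D\subset T\mathcal S$ is a subset on which the Riemannian exponential map is well defined, such that $(\theta,\eta)\in\mathcal D$ implies $(\theta,t\eta)\in\mathcal D$ for $t\in[0,1]$; for every $(\theta,\eta)\in\mathcal D$ the curve $\gamma(t)=\exp_\theta(t\eta)$, $t\in[0,1]$, is a constant speed geodesic from $\theta$ to $\exp_\theta(\eta)$ with $\|\dot\gamma(t)\|_{\gamma(t)}=\|\eta\|_\theta=d_{\mathcal S}(\theta,\exp_\theta(\eta))$ for $t\in[0,1]$; and, with $\mathcal D_\theta=\{\eta:(\theta,\eta)\in\mathcal D\}$, for any $\theta_0,\theta_1\in\mathcal S$ there is $\eta\in\mathcal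 D_{\theta_0}$ with $\theta_1=\exp_{\theta_0}(\eta)$. ($\mathcal S$ may have a boundary as long as it is a geodesically convex subset of a larger, not necessarily compact, such manifold and the construction of geodesics via $\mathcal D$ remains valid.) (ii) $E:\mathcal S\to\mathcal P(\Omega)$ is a bi-Lipschitz bijection from $(\mathcal S,d_{\mathcal S})$ onto $\Lambda:=E(\mathcal S)$ with metric $\mathrm W$; write $\lambda_\theta=E(\theta)$. All $\lambda\in\Lambda$ are absolutely continuous with respect to Lebesgue measure. (iii) For each $\theta\in\mathcal S$, $B_\theta:T_\theta\mathcal S\to C^1(\mathbb R^d;\mathbb R^d)$ is linear with values in gradient vector fields, and there is $C_0\in(0,\infty)$ such that for all $(\theta,\eta)\in\mathcal D$, $x\in\mathbb R^d$, $t\in[0,1]$, with $\gamma(t)=\exp_\theta(t\eta)$: $C_0^{-1}\|\eta\|_\theta\le\|B_\theta\eta\|_{L^2(\lambda_\theta)}\le C_0\|\eta\|_\theta$; $\|B_\theta\eta\|_{C^1(\mathbb R^d)}\le C_0\|\eta\|_\theta$; $|\partial_t[B_{\gamma(t)}\dot\gamma(t)](x)|\le C_0\|\eta\|_\theta^2$. (iv) For every Lipschitz curve $\gamma:[0,1]\to\mathcal S$, let $v(t,\cdot)=B_{\gamma(t)}\dot\gamma(t)$ (defined for a.e. $t$) and let $\varphi:[0,1]\times\Omega\to\mathbb R^d$ be the solution of $\varphi(0,\cdot)=\mathrm{id}$, $\partial_t\varphi(t,\cdot)=v(t,\varphi(t,\cdot))$ for a.e. $t$; then $\lambda_{\gamma(t)}=\varphi(t,\cdot)_\#\lambda_{\gamma(0)}$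 for all $t\in[0,1]$. Energy and geodesic restriction. For a Lipschitz curve $\rho:[0,1]\to(\mathcal P(\Omega),\mathrm W)$, $\mathrm{CE}(\rho)$ is the set of measurable $v$ with $v(t)\in L^2(\rho(t))$ such that for all $\phi\in C^1([0,1]\times\Omega)$: $\int_0^1\int_\Omega\partial_t\phi(t,\cdot)\,d\rho(t)\,dt+\int_0^1\int_\Omega\langle\nabla\phi(t,\cdot),v(t)\rangle\,d\rho(t)\,dt=\int_\Omega\phi(1,\cdot)\,d\rho(1)-\int_\Omega\phi(0,\cdot)\,d\rho(0)$. Set $\mathrm{energy}(\rho)=\inf\{\int_0^1\|v(t)\|_{L^2(\rho(t))}^2dt: v\in\mathrm{CE}(\rho)\}$. For $\mu,\nu\in\Lambda$, $\mathrm W_\Lambda(\mu,\nu)=\inf\{\mathrm{energy}(\rho)^{1/2}:\rho\in\mathrm{Lip}([0,1];(\Lambda,\mathrm W)),\rho(0)=\mu,\rho(1)=\nu\}$. *)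

theory Defs
  imports "HOL-Probability.Probability" "HOL-Library.Landau_Symbols"
begin

section \<open>Wasserstein distance and optimal maps\<close>

text \<open>Measures on \<open>\<Omega>\<close> are represented by Borel measures on the ambient Euclidean space that are
  concentrated on \<open>\<Omega>\<close>.\<close>

definition prob_measures_on :: "'a::euclidean_space set \<Rightarrow> 'a measure set"
  where "prob_measures_on \<Omega> = {\<mu>. prob_space \<mu> \<and> sets \<mu> = sets borel \<and> emeasure \<mu> (- \<Omega>) = 0}"

definition couplings :: "'a::euclidean_space measure \<Rightarrow> 'a measure \<Rightarrow> ('a \<times> 'a) measure set"
  where "couplings \<mu> \<nu> = {\<pi>. sets \<pi> = sets borel \<and> distr \<pi> borel fst = \<mu> \<and> distr \<pi> borel snd = \<nu>}"

definition transport_cost :: "('a::euclidean_space \<times> 'a) measure \<Rightarrow> ennreal"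
  where "transport_cost \<pi> = (\<integral>\<^sup>+ z. ennreal ((norm (fst z - snd z))\<^sup>2) \<partial>\<pi>)"

text \<open>The infimum is finite for probability measures with bounded support, so the conversion to
  \<^typ>\<open>real\<close> loses nothing there.\<close>

definition W :: "'a::euclidean_space measure \<Rightarrow> 'a measure \<Rightarrow> real"
  where "W \<mu> \<nu> = sqrt (enn2real (INF \<pi>\<in>couplings \<mu> \<nu>. transport_cost \<pi>))"

definition optimal_coupling ::
    "'a::euclidean_space measure \<Rightarrow> 'a measure \<Rightarrow> ('a \<times> 'a) measure \<Rightarrow> bool"
  where "optimal_coupling \<mu> \<nu> \<pi> \<longleftrightarrow>
    \<pi> \<in> couplings \<mu> \<nu> \<and> (\<forall>\<pi>'\<in>couplings \<mu> \<nu>. transport_cost \<pi> \<le> transport_cost \<pi>')"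

definition optimal_transport_map ::
    "'a::euclidean_space measure \<Rightarrow> 'a measure \<Rightarrow> ('a \<Rightarrow> 'a) \<Rightarrow> bool"
  where "optimal_transport_map \<mu> \<nu> T \<longleftrightarrow>
    T \<in> borel_measurable borel \<and> optimal_coupling \<mu> \<nu> (distr \<mu> borel (\<lambda>x. (x, T x)))"

definition L2_norm :: "'a measure \<Rightarrow> ('a \<Rightarrow> 'b::euclidean_space) \<Rightarrow> real"
  where "L2_norm \<mu> f = sqrt (LINT x|\<mu>. (norm (f x))\<^sup>2)"


section \<open>Energy and geodesic restriction\<close>

text \<open>\<open>\<phi> \<in> C\<^sup>1([0,1] \<times> \<Omega>)\<close> with time derivative \<open>\<phi>t\<close> and spatial gradient \<open>G\<close>.\<close>

definition C1_test_function ::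
    "'a::euclidean_space set \<Rightarrow> (real \<times> 'a \<Rightarrow> real) \<Rightarrow> (real \<times> 'a \<Rightarrow> real) \<Rightarrow> (real \<times> 'a \<Rightarrow> 'a) \<Rightarrow> bool"
  where "C1_test_function \<Omega> \<phi> \<phi>t G \<longleftrightarrow>
    continuous_on ({0..1} \<times> \<Omega>) \<phi>t \<and> continuous_on ({0..1} \<times> \<Omega>) G \<and>
    (\<forall>z\<in>{0..1} \<times> \<Omega>.
       (\<phi> has_derivative (\<lambda>h. fst h * \<phi>t z + G z \<bullet> snd h)) (at z within {0..1} \<times> \<Omega>))"

text \<open>The integrability condition says that the second integral of the continuity equation
  exists; it is automatic when \<open>v\<close> has finite energy.\<close>

definition CE ::
    "'a::euclidean_space set \<Rightarrow> (real \<Rightarrow> 'a measure) \<Rightarrow> (real \<Rightarrow> 'a \<Rightarrow> 'a) set"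
  where "CE \<Omega> \<rho> = {v.
    (\<lambda>(t, x). v t x) \<in> borel_measurable borel \<and>
    (\<forall>t\<in>{0..1}. integrable (\<rho> t) (\<lambda>x. (norm (v t x))\<^sup>2)) \<and>
    (\<forall>\<phi> \<phi>t G. C1_test_function \<Omega> \<phi> \<phi>t G \<longrightarrow>
       set_integrable lborel {0..1} (\<lambda>t. LINT x:\<Omega>|\<rho> t. G (t, x) \<bullet> v t x) \<and>
       (LINT t:{0..1}|lborel. (LINT x:\<Omega>|\<rho> t. \<phi>t (t, x)))
         + (LINT t:{0..1}|lborel. (LINT x:\<Omega>|\<rho> t. G (t, x) \<bullet> v t x))
       = (LINT x:\<Omega>|\<rho> 1. \<phi> (1, x)) - (LINT x:\<Omega>|\<rho> 0. \<phi> (0, x)))}"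

definition energy :: "'a::euclidean_space set \<Rightarrow> (real \<Rightarrow> 'a measure) \<Rightarrow> ennreal"
  where "energy \<Omega> \<rho> =
    (INF v\<in>CE \<Omega> \<rho>. \<integral>\<^sup>+ t\<in>{0..1}. (\<integral>\<^sup>+ x. ennreal ((norm (v t x))\<^sup>2) \<partial>\<rho> t) \<partial>lborel)"

definition W_Lipschitz_curves :: "'a::euclidean_space measure set \<Rightarrow> (real \<Rightarrow> 'a measure) set"
  where "W_Lipschitz_curves \<Lambda> =
    {\<rho>. (\<forall>t\<in>{0..1}. \<rho> t \<in> \<Lambda>) \<and>
        (\<exists>L. \<forall>s\<in>{0..1}. \<forall>t\<in>{0..1}. W (\<rho> s) (\<rho> t) \<le> L * \<bar>s - t\<bar>)}"

text \<open>Curves of infinite energy are left out of the infimum: they do not change its value,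
  but \<^const>\<open>enn2real\<close> would send their energy to \<open>0\<close>.\<close>

definition W_restr ::
    "'a::euclidean_space set \<Rightarrow> 'a measure set \<Rightarrow> 'a measure \<Rightarrow> 'a measure \<Rightarrow> real"
  where "W_restr \<Omega> \<Lambda> \<mu> \<nu> =
    Inf {sqrt (enn2real (energy \<Omega> \<rho>)) | \<rho>.
      \<rho> \<in> W_Lipschitz_curves \<Lambda> \<and> \<rho> 0 = \<mu> \<and> \<rho> 1 = \<nu> \<and> energy \<Omega> \<rho> < \<infinity>}"


section \<open>Smooth Riemannian manifolds\<close>

text \<open>The boundaryless manifold \<open>M\<close> is the whole type \<open>'m\<close>, with an atlas modelled on a
  finite-dimensional normed space \<open>'e\<close>.  A chart is a domain together with a coordinate map,
  whose values outside the domain are irrelevant.\<close>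

type_synonym ('m, 'e) chart = "'m set \<times> ('m \<Rightarrow> 'e)"

primrec C_k_on :: "nat \<Rightarrow> 'a::real_normed_vector set \<Rightarrow> ('a \<Rightarrow> 'b::real_normed_vector) \<Rightarrow> bool"
  where
    "C_k_on 0 X f \<longleftrightarrow> continuous_on X f"
  | "C_k_on (Suc k) X f \<longleftrightarrow>
       (\<forall>x\<in>X. f differentiable (at x)) \<and> (\<forall>h. C_k_on k X (\<lambda>x. frechet_derivative f (at x) h))"

text \<open>Meant for open \<open>X\<close> and finite-dimensional domains, where continuity of all iterated
  directional derivatives of differentiable maps amounts to being \<open>C\<^sup>\<infinity>\<close>.\<close>

definition smooth_on :: "'a::real_normed_vector set \<Rightarrow> ('a \<Rightarrow> 'b::real_normed_vector) \<Rightarrow> bool"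
  where "smooth_on X f \<longleftrightarrow> (\<forall>k. C_k_on k X f)"

definition chart_inv :: "('m, 'e) chart \<Rightarrow> 'e \<Rightarrow> 'm"
  where "chart_inv c = inv_into (fst c) (snd c)"

definition is_chart :: "('m::topological_space, 'e::real_normed_vector) chart \<Rightarrow> bool"
  where "is_chart c \<longleftrightarrow> open (fst c) \<and> open (snd c ` fst c) \<and>
    homeomorphism (fst c) (snd c ` fst c) (snd c) (chart_inv c)"

definition smooth_atlas :: "('m::topological_space, 'e::real_normed_vector) chart set \<Rightarrow> bool"
  where "smooth_atlas A \<longleftrightarrow>
    (\<exists>b::'e set. finite b \<and> span b = UNIV) \<and>
    (\<forall>c\<in>A. is_chart c) \<and> (\<Union>c\<in>A. fst c) = UNIV \<and>
    (\<forall>c\<in>A. \<forall>c'\<in>A. smooth_on (snd c ` (fst c \<inter> fst c')) (snd c' \<circ> chart_inv c))"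

text \<open>A tangent vector at \<open>p\<close> is represented by its coordinates in one reference chart around
  \<open>p\<close>, chosen once and for all.  So \<open>'e\<close> is the tangent space at every point, with its linear
  structure.  The reference chart jumps with the base point, so statements on how tangent vectors
  depend on the base point (smoothness of the metric, the geodesic equation) are made in a fixed
  chart.\<close>

definition ref_chart :: "('m, 'e) chart set \<Rightarrow> 'm \<Rightarrow> 'm \<Rightarrow> 'e"
  where "ref_chart A p = snd (SOME c. c \<in> A \<and> p \<in> fst c)"

definition has_velocity ::
    "('m::topological_space, 'e::real_normed_vector) chart set \<Rightarrow> (real \<Rightarrow> 'm) \<Rightarrow> 'e
      \<Rightarrow> real \<Rightarrow> real set \<Rightarrow> bool"
  where "has_velocity A \<gamma> v t I \<longleftrightarrow>
    continuous (at t within I) \<gamma> \<and>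
    ((ref_chart A (\<gamma> t) \<circ> \<gamma>) has_vector_derivative v) (at t within I)"

definition velocity ::
    "('m::topological_space, 'e::real_normed_vector) chart set \<Rightarrow> (real \<Rightarrow> 'm) \<Rightarrow> real set
      \<Rightarrow> real \<Rightarrow> 'e"
  where "velocity A \<gamma> I t = vector_derivative (ref_chart A (\<gamma> t) \<circ> \<gamma>) (at t within I)"

text \<open>\<open>chart_metric A g c x\<close> is the metric at the point with coordinates \<open>x\<close> in the chart \<open>c\<close>,
  evaluated on vectors given by their \<open>c\<close>-coordinates.\<close>

definition chart_metric ::
    "('m, 'e::real_normed_vector) chart set \<Rightarrow> ('m \<Rightarrow> 'e \<Rightarrow> 'e \<Rightarrow> real) \<Rightarrow> ('m, 'e) chart
      \<Rightarrow> 'e \<Rightarrow> 'e \<Rightarrow> 'e \<Rightarrow> real"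
  where "chart_metric A g c x u w =
    (let p = chart_inv c x; J = frechet_derivative (ref_chart A p \<circ> chart_inv c) (at x)
     in g p (J u) (J w))"

definition riemannian_metric ::
    "('m, 'e::real_normed_vector) chart set \<Rightarrow> ('m \<Rightarrow> 'e \<Rightarrow> 'e \<Rightarrow> real) \<Rightarrow> bool"
  where "riemannian_metric A g \<longleftrightarrow>
    (\<forall>p u. linear (g p u)) \<and> (\<forall>p u w. g p u w = g p w u) \<and> (\<forall>p u. u \<noteq> 0 \<longrightarrow> 0 < g p u u) \<and>
    (\<forall>c\<in>A. \<forall>u w. smooth_on (snd c ` fst c) (\<lambda>x. chart_metric A g c x u w))"

definition tangent_norm :: "('m \<Rightarrow> 'e \<Rightarrow> 'e \<Rightarrow> real) \<Rightarrow> 'm \<Rightarrow> 'e \<Rightarrow> real"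
  where "tangent_norm g p v = sqrt (g p v v)"

text \<open>Levi-Civita connection in the chart \<open>c\<close>, as the bilinear map
  \<open>(u, v) \<mapsto> (\<Gamma>\<^sup>k\<^sub>i\<^sub>j u\<^sup>i v\<^sup>j)\<^sub>k\<close> characterised by the Koszul formula for constant fields.\<close>

definition christoffel ::
    "('m, 'e::real_normed_vector) chart set \<Rightarrow> ('m \<Rightarrow> 'e \<Rightarrow> 'e \<Rightarrow> real) \<Rightarrow> ('m, 'e) chart
      \<Rightarrow> 'e \<Rightarrow> 'e \<Rightarrow> 'e \<Rightarrow> 'e"
  where "christoffel A g c x u v =
    (THE z. \<forall>w. chart_metric A g c x z w =
       (frechet_derivative (\<lambda>y. chart_metric A g c y v w) (at x) u
        + frechet_derivative (\<lambda>y. chart_metric A g c y u w) (at x) v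
        - frechet_derivative (\<lambda>y. chart_metric A g c y u v) (at x) w) / 2)"

definition geodesic ::
    "('m::topological_space, 'e::real_normed_vector) chart set \<Rightarrow> ('m \<Rightarrow> 'e \<Rightarrow> 'e \<Rightarrow> real)
      \<Rightarrow> (real \<Rightarrow> 'm) \<Rightarrow> bool"
  where "geodesic A g \<gamma> \<longleftrightarrow>
    continuous_on {0..1} \<gamma> \<and>
    (\<forall>c\<in>A. let I = {t\<in>{0..1}. \<gamma> t \<in> fst c}; x = snd c \<circ> \<gamma> in
       \<exists>x'. \<forall>t\<in>I. (x has_vector_derivative x' t) (at t within I) \<and>
         (x' has_vector_derivative - christoffel A g c (x t) (x' t) (x' t)) (at t within I))"

definition geodesic_from ::
    "('m::topological_space, 'e::real_normed_vector) chart set \<Rightarrow> ('m \<Rightarrow> 'e \<Rightarrow> 'e \<Rightarrow> real)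
      \<Rightarrow> 'm \<Rightarrow> 'e \<Rightarrow> (real \<Rightarrow> 'm) \<Rightarrow> bool"
  where "geodesic_from A g \<theta> \<eta> \<gamma> \<longleftrightarrow>
    geodesic A g \<gamma> \<and> \<gamma> 0 = \<theta> \<and> has_velocity A \<gamma> \<eta> 0 {0..1}"

definition exp_defined ::
    "('m::topological_space, 'e::real_normed_vector) chart set \<Rightarrow> ('m \<Rightarrow> 'e \<Rightarrow> 'e \<Rightarrow> real)
      \<Rightarrow> 'm \<Rightarrow> 'e \<Rightarrow> bool"
  where "exp_defined A g \<theta> \<eta> \<longleftrightarrow> (\<exists>!p. \<exists>\<gamma>. geodesic_from A g \<theta> \<eta> \<gamma> \<and> \<gamma> 1 = p)"

definition riem_exp ::
    "('m::topological_space, 'e::real_normed_vector) chart set \<Rightarrow> ('m \<Rightarrow> 'e \<Rightarrow> 'e \<Rightarrow> real)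
      \<Rightarrow> 'm \<Rightarrow> 'e \<Rightarrow> 'm"
  where "riem_exp A g \<theta> \<eta> = (THE p. \<exists>\<gamma>. geodesic_from A g \<theta> \<eta> \<gamma> \<and> \<gamma> 1 = p)"

definition piecewise_C1_curve ::
    "('m::topological_space, 'e::real_normed_vector) chart set \<Rightarrow> (real \<Rightarrow> 'm) \<Rightarrow> bool"
  where "piecewise_C1_curve A \<gamma> \<longleftrightarrow>
    continuous_on {0..1} \<gamma> \<and>
    (\<forall>c\<in>A. \<forall>a b. 0 \<le> a \<and> a \<le> b \<and> b \<le> 1 \<and> \<gamma> ` {a..b} \<subseteq> fst c \<longrightarrow>
       (snd c \<circ> \<gamma>) piecewise_C1_differentiable_on {a..b})"

definition curve_length ::
    "('m::topological_space, 'e::real_normed_vector) chart set \<Rightarrow> ('m \<Rightarrow> 'e \<Rightarrow> 'e \<Rightarrow> real)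
      \<Rightarrow> (real \<Rightarrow> 'm) \<Rightarrow> ennreal"
  where "curve_length A g \<gamma> =
    (\<integral>\<^sup>+ t\<in>{0..1}. ennreal (tangent_norm g (\<gamma> t) (velocity A \<gamma> {0..1} t)) \<partial>lborel)"

text \<open>Distance induced on a subset \<open>S\<close> of the manifold by the lengths of curves inside \<open>S\<close>.\<close>

definition riem_dist ::
    "('m::topological_space, 'e::real_normed_vector) chart set \<Rightarrow> ('m \<Rightarrow> 'e \<Rightarrow> 'e \<Rightarrow> real)
      \<Rightarrow> 'm set \<Rightarrow> 'm \<Rightarrow> 'm \<Rightarrow> real"
  where "riem_dist A g S p q =
    enn2real (INF \<gamma>\<in>{\<gamma>. piecewise_C1_curve A \<gamma> \<and> \<gamma> ` {0..1} \<subseteq> S \<and> \<gamma> 0 = p \<and> \<gamma> 1 = q}.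
      curve_length A g \<gamma>)"

definition geodesically_convex ::
    "('m::topological_space, 'e::real_normed_vector) chart set \<Rightarrow> ('m \<Rightarrow> 'e \<Rightarrow> 'e \<Rightarrow> real)
      \<Rightarrow> 'm set \<Rightarrow> bool"
  where "geodesically_convex A g S \<longleftrightarrow>
    (\<forall>p\<in>S. \<forall>q\<in>S. \<exists>\<gamma>. geodesic A g \<gamma> \<and> \<gamma> ` {0..1} \<subseteq> S \<and> \<gamma> 0 = p \<and> \<gamma> 1 = q \<and>
       curve_length A g \<gamma> = ennreal (riem_dist A g UNIV p q))"


section \<open>Parametrized submanifolds of Wasserstein space\<close>

text \<open>\<open>S\<close> is the parameter manifold.  The case without boundary is \<open>S = UNIV\<close>, for which
  compactness and connectedness of \<open>S\<close> are those of the manifold, and geodesic convexity follows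
  from the conditions on \<open>\<D>\<close>.  Otherwise \<open>S\<close> is a full-dimensional geodesically convex subset of
  the larger manifold \<open>UNIV\<close>, which need not be compact, and its tangent spaces are the full
  ones also at boundary points.\<close>

definition parameter_manifold ::
    "('m::{t2_space,second_countable_topology}, 'e::real_normed_vector) chart set
      \<Rightarrow> ('m \<Rightarrow> 'e \<Rightarrow> 'e \<Rightarrow> real) \<Rightarrow> 'm set \<Rightarrow> bool"
  where "parameter_manifold A g S \<longleftrightarrow>
    smooth_atlas A \<and> riemannian_metric A g \<and> connected (UNIV :: 'm set) \<and>
    compact S \<and> connected S \<and> S \<subseteq> closure (interior S) \<and> geodesically_convex A g S"

text \<open>\<^const>\<open>geodesic\<close> refers to the ambient manifold; the curves \<open>t \<mapsto> exp\<^sub>\<theta>(t\<eta>)\<close> have to stay in \<open>S\<close>.\<close>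

definition exp_domain ::
    "('m::{t2_space,second_countable_topology}, 'e::real_normed_vector) chart set
      \<Rightarrow> ('m \<Rightarrow> 'e \<Rightarrow> 'e \<Rightarrow> real) \<Rightarrow> 'm set \<Rightarrow> ('m \<times> 'e) set \<Rightarrow> bool"
  where "exp_domain A g S \<D> \<longleftrightarrow>
    (\<forall>(\<theta>, \<eta>)\<in>\<D>.
       \<theta> \<in> S \<and> exp_defined A g \<theta> \<eta> \<and> (\<forall>t\<in>{0..1}. (\<theta>, t *\<^sub>R \<eta>) \<in> \<D>) \<and>
       (let \<gamma> = (\<lambda>t. riem_exp A g \<theta> (t *\<^sub>R \<eta>)) in
          geodesic A g \<gamma> \<and> \<gamma> 0 = \<theta> \<and> \<gamma> ` {0..1} \<subseteq> S \<and>
          (\<forall>t\<in>{0..1}. tangent_norm g (\<gamma> t) (velocity A \<gamma> {0..1} t) = tangent_norm g \<theta> \<eta>)) \<and>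
       tangent_norm g \<theta> \<eta> = riem_dist A g S \<theta> (riem_exp A g \<theta> \<eta>)) \<and>
    (\<forall>\<theta>\<^sub>0\<in>S. \<forall>\<theta>\<^sub>1\<in>S. \<exists>\<eta>. (\<theta>\<^sub>0, \<eta>) \<in> \<D> \<and> \<theta>\<^sub>1 = riem_exp A g \<theta>\<^sub>0 \<eta>)"

definition bi_Lipschitz_embedding ::
    "('m::{t2_space,second_countable_topology}, 'e::real_normed_vector) chart set
      \<Rightarrow> ('m \<Rightarrow> 'e \<Rightarrow> 'e \<Rightarrow> real) \<Rightarrow> 'm set \<Rightarrow> 'a::euclidean_space set \<Rightarrow> ('m \<Rightarrow> 'a measure) \<Rightarrow> bool"
  where "bi_Lipschitz_embedding A g S \<Omega> E \<longleftrightarrow>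
    (\<forall>\<theta>\<in>S. E \<theta> \<in> prob_measures_on \<Omega> \<and> absolutely_continuous lborel (E \<theta>)) \<and>
    inj_on E S \<and>
    (\<exists>k>0. \<exists>K. \<forall>\<theta>\<in>S. \<forall>\<theta>'\<in>S.
       k * riem_dist A g S \<theta> \<theta>' \<le> W (E \<theta>) (E \<theta>') \<and> W (E \<theta>) (E \<theta>') \<le> K * riem_dist A g S \<theta> \<theta>')"

definition C1_field :: "('a::euclidean_space \<Rightarrow> 'a) \<Rightarrow> bool"
  where "C1_field f \<longleftrightarrow>
    (\<exists>f' :: 'a \<Rightarrow> 'a \<Rightarrow>\<^sub>L 'a. continuous_on UNIV f' \<and>
       (\<forall>x. (f has_derivative blinfun_apply (f' x)) (at x)))"

definition C1_norm :: "('a::euclidean_space \<Rightarrow> 'a) \<Rightarrow> ennreal"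
  where "C1_norm f =
    max (SUP x. ennreal (norm (f x))) (SUP x. ennreal (onorm (frechet_derivative f (at x))))"

definition gradient_field :: "('a::euclidean_space \<Rightarrow> 'a) \<Rightarrow> bool"
  where "gradient_field f \<longleftrightarrow> (\<exists>\<psi>. \<forall>x. GDERIV \<psi> x :> f x)"

definition velocity_fields ::
    "('m::{t2_space,second_countable_topology}, 'e::real_normed_vector) chart set
      \<Rightarrow> ('m \<Rightarrow> 'e \<Rightarrow> 'e \<Rightarrow> real) \<Rightarrow> 'm set \<Rightarrow> ('m \<times> 'e) set \<Rightarrow> ('m \<Rightarrow> 'a::euclidean_space measure)
      \<Rightarrow> ('m \<Rightarrow> 'e \<Rightarrow> 'a \<Rightarrow> 'a) \<Rightarrow> bool"
  where "velocity_fields A g S \<D> E B \<longleftrightarrow>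
    (\<forall>\<theta>\<in>S. (\<forall>x. linear (\<lambda>\<eta>. B \<theta> \<eta> x)) \<and> (\<forall>\<eta>. C1_field (B \<theta> \<eta>) \<and> gradient_field (B \<theta> \<eta>))) \<and>
    (\<exists>C\<^sub>0>0. \<forall>(\<theta>, \<eta>)\<in>\<D>.
       tangent_norm g \<theta> \<eta> / C\<^sub>0 \<le> L2_norm (E \<theta>) (B \<theta> \<eta>) \<and>
       L2_norm (E \<theta>) (B \<theta> \<eta>) \<le> C\<^sub>0 * tangent_norm g \<theta> \<eta> \<and>
       C1_norm (B \<theta> \<eta>) \<le> ennreal (C\<^sub>0 * tangent_norm g \<theta> \<eta>) \<and>
       (let \<gamma> = (\<lambda>t. riem_exp A g \<theta> (t *\<^sub>R \<eta>)) in
          \<forall>x. \<forall>t\<in>{0..1}. \<exists>w.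
            ((\<lambda>s. B (\<gamma> s) (velocity A \<gamma> {0..1} s) x) has_vector_derivative w) (at t within {0..1}) \<and>
            norm w \<le> C\<^sub>0 * (tangent_norm g \<theta> \<eta>)\<^sup>2))"

text \<open>An equation that holds for a.e. \<open>t\<close> determines \<open>\<phi>\<close> only among absolutely continuous
  functions of \<open>t\<close>; since the fields considered are bounded, these solutions are Lipschitz.\<close>

definition flow_solution ::
    "'a::euclidean_space set \<Rightarrow> (real \<Rightarrow> 'a \<Rightarrow> 'a) \<Rightarrow> (real \<Rightarrow> 'a \<Rightarrow> 'a) \<Rightarrow> bool"
  where "flow_solution \<Omega> v \<phi> \<longleftrightarrow>
    (\<forall>x\<in>\<Omega>. \<phi> 0 x = x \<and> (\<exists>L. L-lipschitz_on {0..1} (\<lambda>t. \<phi> t x)) \<and>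
       (AE t in lborel. t \<in> {0..1} \<longrightarrow>
          ((\<lambda>s. \<phi> s x) has_vector_derivative v t (\<phi> t x)) (at t within {0..1})))"

text \<open>At the null set of times where \<open>\<gamma>\<close> is not differentiable, \<^const>\<open>velocity\<close> is
  arbitrary.  The flow is only given on \<open>\<Omega>\<close>, hence the restriction before the push-forward.\<close>

definition transports_along_curves ::
    "('m::{t2_space,second_countable_topology}, 'e::real_normed_vector) chart set
      \<Rightarrow> ('m \<Rightarrow> 'e \<Rightarrow> 'e \<Rightarrow> real) \<Rightarrow> 'm set \<Rightarrow> 'a::euclidean_space set \<Rightarrow> ('m \<Rightarrow> 'a measure)
      \<Rightarrow> ('m \<Rightarrow> 'e \<Rightarrow> 'a \<Rightarrow> 'a) \<Rightarrow> bool"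
  where "transports_along_curves A g S \<Omega> E B \<longleftrightarrow>
    (\<forall>\<gamma>. \<gamma> ` {0..1} \<subseteq> S \<and>
         (\<exists>L. \<forall>s\<in>{0..1}. \<forall>t\<in>{0..1}. riem_dist A g S (\<gamma> s) (\<gamma> t) \<le> L * \<bar>s - t\<bar>) \<longrightarrow>
       (\<exists>\<phi>. flow_solution \<Omega> (\<lambda>t. B (\<gamma> t) (velocity A \<gamma> {0..1} t)) \<phi> \<and>
            (\<forall>t\<in>{0..1}. E (\<gamma> t) = distr (restrict_space (E (\<gamma> 0)) \<Omega>) borel (\<phi> t))))"

text \<open>Curves \<open>\<gamma> : [0,\<epsilon>) \<rightarrow> S\<close> that are differentiable with initial point \<open>\<theta>\<close> and velocity \<open>\<eta>\<close>.\<close>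

definition differentiable_curve_from ::
    "('m::topological_space, 'e::real_normed_vector) chart set \<Rightarrow> 'm set \<Rightarrow> real \<Rightarrow> 'm \<Rightarrow> 'e
      \<Rightarrow> (real \<Rightarrow> 'm) \<Rightarrow> bool"
  where "differentiable_curve_from A S \<epsilon> \<theta> \<eta> \<gamma> \<longleftrightarrow>
    \<gamma> ` {0..<\<epsilon>} \<subseteq> S \<and> (\<forall>t\<in>{0..<\<epsilon>}. \<exists>v. has_velocity A \<gamma> v t {0..<\<epsilon>}) \<and>
    \<gamma> 0 = \<theta> \<and> has_velocity A \<gamma> \<eta> 0 {0..<\<epsilon>}"

end

theory Submission
  imports Defs
begin

text \<open>
  Along a geodesic from \<open>p\<close> with initial velocity \<open>\<eta>\<close> of norm \<open>d\<close>, the transporting field differs from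
  the fixed gradient field \<open>b = B p \<eta>\<close> by \<open>O(d^2)\<close>, so its flow is \<open>x + t b(x) + O(d^2 t^2)\<close>.  This
  gives couplings, and an admissible curve, hence upper bounds for both distances.  Lower bounds come
  from testing with a potential \<open>f\<close> of a gradient field \<open>u\<close>: if \<open>\<mu>\<close> and \<open>\<nu>\<close> are the images of \<open>\<lambda>\<close> under
  \<open>id + t b\<^sub>1\<close> and \<open>id + t b\<^sub>2\<close> up to \<open>o(t)\<close>, and \<open>u = b\<^sub>2 - b\<^sub>1\<close>, then
  \<open>\<integral> f d\<nu> - \<integral> f d\<mu> = t \<parallel>u\<parallel>^2 + o(t)\<close>, whereas a coupling, respectively a solution of the continuity
  equation, of cost \<open>c^2\<close> changes \<open>\<integral> f\<close> by at most \<open>c \<parallel>u\<parallel>\<close> to leading order.  The same test with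
  \<open>u = b\<close> compares the two distances with each other: between points of \<open>S\<close> at distance \<open>d\<close> the squares of
  both are \<open>\<parallel>b\<parallel>^2 + O(d^3)\<close>.  An optimal map \<open>T\<close> has the same expansion \<open>T = id + t b + O(t^(3/2))\<close> in
  \<open>L^2\<close>, because \<open>\<parallel>T - id\<parallel>^2\<close> is at most, and \<open>\<integral> \<langle>b, T - id\<rangle> d\<lambda>\<close> at least, what the flow gives.
\<close>

section \<open>Geodesics in charts\<close>

text \<open>The natural competitor for \<open>W_restr\<close> between \<gamma>1(t) and \<gamma>2(t)
  is the connecting geodesic, but comparing its initial velocity with t(\<eta>2 - \<eta>1) would
  require control of the inverse exponential map at a moving base point. The geometry of S then
  enters mainly through three facts: a ray starts with velocity \<eta>, its speed controls distances
  along it, and any two points are joined by a ray. The bounds on \<open>B\<close> hold only on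
  \<D>, to which \<eta>2 - \<eta>1 need not belong; the difference field is therefore estimated
  through linearity of \<open>B \<theta>\<close>. The Young parameter in all lower bounds is t
  itself, since the displacement to be detected is t u.\<close>

text \<open>\<^const>\<open>christoffel\<close> is a definite description, so its homogeneity requires that the described vector exists.\<close>

lemma bilinear_form_represents:
  fixes G :: "'e::real_vector \<Rightarrow> 'e \<Rightarrow> real"
  assumes lin: "\<And>u. linear (G u)" and sym: "\<And>u w. G u w = G w u"
    and pos: "\<And>u. u \<noteq> 0 \<Longrightarrow> 0 < G u u" and "finite b" and "linear F"
  shows "\<exists>z\<in>span b. \<forall>w\<in>span b. G z w = F w"
  using assms(4,5)
proof (induction b arbitrary: F rule: finite_induct)
  case empty
  then show ?case using lin by (auto simp: linear_0)
next
  case (insert a b)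
  have linl: "linear (\<lambda>z. G z w)" for w
  proof -
    have "(\<lambda>z. G z w) = G w" using sym by blast
    then show ?thesis using lin[of w] by metis
  qed
  obtain z0 where z0: "z0 \<in> span b" "\<And>w. w \<in> span b \<Longrightarrow> G z0 w = F w" using insert by blast
  obtain z1 where z1: "z1 \<in> span b" "\<And>w. w \<in> span b \<Longrightarrow> G z1 w = G a w"
    using insert.IH[OF lin[of a]] by blast
  show ?case
  proof (cases "a \<in> span b")
    case True
    then have "span (insert a b) = span b" by (rule span_redundant)
    then show ?thesis using z0 by blast
  next
    case False
    \<comment> \<open>One Gram-Schmidt step: \<open>z1\<close> represents \<open>G a\<close> on the
      smaller span, so it is the projection of \<open>a\<close>, and \<open>e\<close> is the
      component of \<open>a\<close> orthogonal to that span.\<close>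
    define e where "e = a - z1"
    have "e \<noteq> 0" using False z1(1) by (auto simp: e_def)
    have orth: "G e w = 0" if "w \<in> span b" for w
      using z1(2)[OF that] by (simp add: e_def linear_diff[OF linl])
    have ea: "G e a = G e e"
      using orth[OF z1(1)] by (simp add: e_def linear_diff[OF lin])
    define \<alpha> where "\<alpha> = (F a - G z0 a) / G e e"
    define z where "z = z0 + \<alpha> *\<^sub>R e"
    have Gz: "G z w = G z0 w + \<alpha> * G e w" for w
      by (simp add: z_def linear_add[OF linl] linear_scale[OF linl])
    have za: "G z a = F a"
      using pos[OF \<open>e \<noteq> 0\<close>] by (simp add: Gz ea \<alpha>_def)
    have zb: "G z w = F w" if "w \<in> span b" for w
      using orth[OF that] z0(2)[OF that] by (simp add: Gz)
    have "z \<in> span (insert a b)"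
      unfolding z_def e_def using z0(1) z1(1)
      by (meson insertI1 span_add span_base span_diff span_mono span_scale subset_insertI subsetD)
    moreover have "G z w = F w" if "w \<in> span (insert a b)" for w
    proof -
      obtain k where k: "w - k *\<^sub>R a \<in> span b" using \<open>w \<in> span (insert a b)\<close> by (auto simp: span_insert)
      have "G z w = G z (w - k *\<^sub>R a) + k * G z a"
        by (simp add: linear_diff[OF lin] linear_scale[OF lin])
      also have "\<dots> = F w"
        by (simp add: zb[OF k] za linear_diff[OF insert.prems] linear_scale[OF insert.prems])
      finally show ?thesis .
    qed
    ultimately show ?thesis by blast
  qed
qed

section \<open>Charts, the metric in coordinates and Christoffel symbols\<close>

lemma ref_chart_obtain:
  assumes "smooth_atlas A"
  obtains c where "c \<in> A" "p \<in> fst c" "ref_chart A p = snd c"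
proof -
  have "\<exists>c. c \<in> A \<and> p \<in> fst c" using assms unfolding smooth_atlas_def by blast
  from someI_ex[OF this] show ?thesis by (intro that) (auto simp: ref_chart_def)
qed

lemma chart_inv_left: "is_chart c \<Longrightarrow> p \<in> fst c \<Longrightarrow> chart_inv c (snd c p) = p"
  by (auto simp: is_chart_def homeomorphism_def)

lemma open_chart_image:
  assumes "is_chart c" "open U"
  shows "open (snd c ` (fst c \<inter> U))"
proof -
  have h: "homeomorphism (fst c) (snd c ` fst c) (snd c) (chart_inv c)" and o: "open (snd c ` fst c)"
    using assms(1) by (auto simp: is_chart_def)
  have "openin (top_of_set (fst c)) (fst c \<inter> U)" using assms(2) by (auto simp: openin_open)
  from homeomorphism_imp_open_map[OF h this] o show ?thesis
    by (simp add: openin_open_eq)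
qed

lemma transition_differentiable:
  assumes A: "smooth_atlas A" and c: "c \<in> A" and c': "c' \<in> A" and p: "p \<in> fst c" "p \<in> fst c'"
  shows "(snd c' \<circ> chart_inv c) differentiable (at (snd c p))"
proof -
  have "smooth_on (snd c ` (fst c \<inter> fst c')) (snd c' \<circ> chart_inv c)"
    using A c c' by (auto simp: smooth_atlas_def)
  then have "C_k_on (Suc 0) (snd c ` (fst c \<inter> fst c')) (snd c' \<circ> chart_inv c)"
    unfolding smooth_on_def by blast
  then show ?thesis using p by auto
qed

text \<open>Composing the two transition maps gives the identity near the point, so the chain rule
  inverts the derivative. The resulting injectivity carries positive definiteness of
  \<open>g\<close> over to \<open>chart_metric\<close>.\<close>

lemma transition_derivative_inverse:
  assumes A: "smooth_atlas A" and c: "c \<in> A" and c': "c' \<in> A" and p: "p \<in> fst c" "p \<in> fst c'"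
  shows "frechet_derivative (snd c \<circ> chart_inv c') (at (snd c' p))
    (frechet_derivative (snd c' \<circ> chart_inv c) (at (snd c p)) u) = u"
proof -
  have ic: "is_chart c" "is_chart c'" using A c c' by (auto simp: smooth_atlas_def)
  let ?f = "snd c' \<circ> chart_inv c" and ?g = "snd c \<circ> chart_inv c'"
  have f: "(?f has_derivative frechet_derivative ?f (at (snd c p))) (at (snd c p))"
    using transition_differentiable[OF A c c' p] by (rule frechet_derivative_works[THEN iffD1])
  have "(?g has_derivative frechet_derivative ?g (at (snd c' p))) (at (snd c' p))"
    using transition_differentiable[OF A c' c p(2,1)] by (rule frechet_derivative_works[THEN iffD1])
  then have g: "(?g has_derivative frechet_derivative ?g (at (snd c' p))) (at (?f (snd c p)))"
    using chart_inv_left[OF ic(1) p(1)] by simp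
  have "((?g \<circ> ?f) has_derivative (frechet_derivative ?g (at (snd c' p)) \<circ>
      frechet_derivative ?f (at (snd c p)))) (at (snd c p))"
    by (rule diff_chain_at[OF f g])
  moreover have "((?g \<circ> ?f) has_derivative (\<lambda>x. x)) (at (snd c p))"
  proof (rule has_derivative_transform_within_open[OF has_derivative_ident])
    show "open (snd c ` (fst c \<inter> fst c'))"
      using ic by (intro open_chart_image) (auto simp: is_chart_def)
    show "snd c p \<in> snd c ` (fst c \<inter> fst c')" using p by auto
  next
    fix y assume "y \<in> snd c ` (fst c \<inter> fst c')"
    then show "y = (?g \<circ> ?f) y"
      using chart_inv_left[OF ic(1)] chart_inv_left[OF ic(2)] by auto
  qed
  ultimately have "frechet_derivative ?g (at (snd c' p)) \<circ> frechet_derivative ?f (at (snd c p)) = (\<lambda>x. x)"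
    by (rule has_derivative_unique)
  then show ?thesis by (metis comp_apply)
qed

lemma chart_metric_form:
  assumes A: "smooth_atlas A" and g: "riemannian_metric A g" and c: "c \<in> A" and x: "x \<in> snd c ` fst c"
  shows "linear (chart_metric A g c x u)" "chart_metric A g c x u w = chart_metric A g c x w u"
    "u \<noteq> 0 \<Longrightarrow> 0 < chart_metric A g c x u u"
proof -
  obtain p where p: "p \<in> fst c" "x = snd c p" using x by blast
  have "is_chart c" using A c by (auto simp: smooth_atlas_def)
  with p have px: "chart_inv c x = p" by (simp add: chart_inv_left)
  obtain c' where c': "c' \<in> A" "p \<in> fst c'" "ref_chart A p = snd c'" using A by (rule ref_chart_obtain)
  define J where "J = frechet_derivative (ref_chart A p \<circ> chart_inv c) (at x)"
  have m: "chart_metric A g c x u w = g p (J u) (J w)" for u w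
    by (simp add: chart_metric_def Let_def px J_def)
  have J: "linear J"
    using transition_differentiable[OF A c c'(1) p(1) c'(2)] unfolding J_def c'(3) p(2)
    by (rule linear_frechet_derivative)
  have inj: "J u \<noteq> 0" if "u \<noteq> 0" for u
  proof
    assume "J u = 0"
    then have "frechet_derivative (snd c \<circ> chart_inv c') (at (snd c' p)) 0 = u"
      using transition_derivative_inverse[OF A c c'(1) p(1) c'(2), of u] by (simp add: J_def p(2) c'(3))
    moreover have "linear (frechet_derivative (snd c \<circ> chart_inv c') (at (snd c' p)))"
      by (rule linear_frechet_derivative[OF transition_differentiable[OF A c'(1) c c'(2) p(1)]])
    ultimately show False using that by (simp add: linear_0)
  qed
  have gl: "linear (g p u)" for u using g by (auto simp: riemannian_metric_def)
  show "linear (chart_metric A g c x u)"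
    using linear_compose[OF J gl[of "J u"]] unfolding m[abs_def] by (simp add: comp_def)
  show "chart_metric A g c x u w = chart_metric A g c x w u"
    using g by (auto simp: riemannian_metric_def m)
  show "u \<noteq> 0 \<Longrightarrow> 0 < chart_metric A g c x u u"
    using g inj by (auto simp: riemannian_metric_def m)
qed

lemma chart_metric_linear_left:
  assumes "smooth_atlas A" "riemannian_metric A g" "c \<in> A" "x \<in> snd c ` fst c"
  shows "linear (\<lambda>u. chart_metric A g c x u w)"
proof -
  have "(\<lambda>u. chart_metric A g c x u w) = chart_metric A g c x w"
    using chart_metric_form(2)[OF assms] by blast
  then show ?thesis using chart_metric_form(1)[OF assms, of w] by metis
qed

lemma frechet_derivative_eq_on_open:
  assumes "open U" "x \<in> U" "\<And>y. y \<in> U \<Longrightarrow> f y = h y" "(h has_derivative h') (at x)"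
  shows "frechet_derivative f (at x) = h'"
  using assms has_derivative_transform_within_open[of h h' x UNIV U f]
  by (metis frechet_derivative_at)

text \<open>This homogeneity makes geodesics stable under linear rescaling of time. The Koszul
  expression \<open>F u u\<close> is quadratic in \<open>u\<close>, and a definite metric determines
  the vector that represents it, so multiplying this vector by \<open>s^2\<close> solves the scaled
  problem.\<close>

lemma christoffel_quadratic:
  fixes A :: "('m::{t2_space,second_countable_topology}, 'e::real_normed_vector) chart set"
  assumes A: "smooth_atlas A" and g: "riemannian_metric A g" and c: "c \<in> A" and x: "x \<in> snd c ` fst c"
  shows "christoffel A g c x (s *\<^sub>R u) (s *\<^sub>R u) = s^2 *\<^sub>R christoffel A g c x u u"
proof -
  let ?U = "snd c ` fst c"
  let ?m = "chart_metric A g c"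
  define D where "D v w = frechet_derivative (\<lambda>y. ?m y v w) (at x)" for v w
  have oU: "open ?U" using A c by (auto simp: smooth_atlas_def is_chart_def)
  have dif: "((\<lambda>y. ?m y v w) has_derivative D v w) (at x)" for v w
  proof -
    have "C_k_on (Suc 0) ?U (\<lambda>y. ?m y v w)"
      using g c unfolding riemannian_metric_def smooth_on_def by blast
    then show ?thesis using x unfolding D_def by (auto simp flip: frechet_derivative_works)
  qed
  have Dlin: "linear (D v w)" for v w using dif by (rule has_derivative_linear)
  have Dadd: "D v (w + w') = (\<lambda>h. D v w h + D v w' h)" for v w w'
    unfolding D_def[of v "w + w'"]
    by (rule frechet_derivative_eq_on_open[OF oU x _ has_derivative_add[OF dif dif]])
      (simp add: linear_add[OF chart_metric_form(1)[OF A g c]])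
  have Dscale: "D v (r *\<^sub>R w) = (\<lambda>h. r *\<^sub>R D v w h)" for v w r
    unfolding D_def[of v "r *\<^sub>R w"]
    by (rule frechet_derivative_eq_on_open[OF oU x _ has_derivative_scaleR_right[OF dif]])
      (simp add: linear_scale[OF chart_metric_form(1)[OF A g c]])
  have Dsym: "D v w = D w v" for v w
    unfolding D_def[of v w]
    by (rule frechet_derivative_eq_on_open[OF oU x _ dif])
      (rule chart_metric_form(2)[OF A g c])
  define F where "F u v w = (D v w u + D u w v - D u v w) / 2" for u v w
  have Flin: "linear (F u u)" for u
    unfolding F_def
    by (rule linearI) (auto simp: Dadd Dscale linear_add[OF Dlin] linear_scale[OF Dlin] field_simps)
  have chr: "christoffel A g c x u v = (THE z. \<forall>w. ?m x z w = F u v w)" for u v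
    unfolding christoffel_def F_def D_def ..
  obtain b :: "'e set" where b: "finite b" "span b = UNIV" using A by (auto simp: smooth_atlas_def)
  note form = chart_metric_form[OF A g c x]
  have linl: "linear (\<lambda>u. ?m x u w)" for w by (rule chart_metric_linear_left[OF A g c x])
  have uniq: "z = z'" if "\<forall>w. ?m x z w = F u v w" "\<forall>w. ?m x z' w = F u v w" for z z' u v
  proof -
    have "?m x (z - z') (z - z') = 0" using that by (simp add: linear_diff[OF linl])
    then show ?thesis using form(3)[of "z - z'"] by fastforce
  qed
  obtain z where z: "\<forall>w. ?m x z w = F u u w"
    using bilinear_form_represents[OF form b(1) Flin[of u]] b(2) by auto
  have 1: "christoffel A g c x u u = z"
    unfolding chr by (rule the_equality, rule z, erule uniq[OF _ z])
  have "F (s *\<^sub>R u) (s *\<^sub>R u) w = s^2 * F u u w" for w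
    unfolding F_def
    by (simp add: Dscale Dsym[of "s *\<^sub>R u"] Dsym[of w u] linear_scale[OF Dlin] power2_eq_square field_simps)
  then have z': "\<forall>w. ?m x (s^2 *\<^sub>R z) w = F (s *\<^sub>R u) (s *\<^sub>R u) w"
    using z by (simp add: linear_scale[OF linl])
  have "christoffel A g c x (s *\<^sub>R u) (s *\<^sub>R u) = s^2 *\<^sub>R z"
    unfolding chr by (rule the_equality, rule z', erule uniq[OF _ z'])
  with 1 show ?thesis by simp
qed


section \<open>Velocities, rescaling and lengths of geodesics\<close>

text \<open>\<open>geodesic\<close> differentiates within the set of times spent in a chart,
  \<open>velocity\<close> within \<open>{0..1}\<close>. That set of times is relatively open, so the
  two filters agree.\<close>

lemma at_within_preimage_open:
  fixes \<gamma> :: "real \<Rightarrow> 'm::topological_space"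
  assumes "continuous_on X \<gamma>" "t \<in> X" "open U" "\<gamma> t \<in> U"
  shows "at t within {t\<in>X. \<gamma> t \<in> U} = at t within X"
proof -
  obtain V where V: "open V" "V \<inter> X = \<gamma> -` U \<inter> X"
    using assms(1,3) unfolding continuous_on_open_invariant by blast
  have "{t\<in>X. \<gamma> t \<in> U} \<inter> V - {t} = X \<inter> V - {t}" using V(2) by blast
  moreover have "t \<in> V" using V(2) assms(2,4) by blast
  ultimately show ?thesis using V(1) at_within_nhd by metis
qed

lemma geodesic_continuous: "geodesic A g \<gamma> \<Longrightarrow> continuous_on {0..1} \<gamma>"
  unfolding geodesic_def by blast

text \<open>\<open>velocity\<close> is a choice among derivatives and means nothing unless one
  exists; the geodesic equation, read in the reference chart, provides it.\<close>

lemma geodesic_has_velocity: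
  assumes A: "smooth_atlas A" and \<gamma>: "geodesic A g \<gamma>" and t: "t \<in> {0..1}"
  shows "((ref_chart A (\<gamma> t) \<circ> \<gamma>) has_vector_derivative velocity A \<gamma> {0..1} t) (at t within {0..1})"
proof -
  obtain c where c: "c \<in> A" "\<gamma> t \<in> fst c" "ref_chart A (\<gamma> t) = snd c" using A by (rule ref_chart_obtain)
  have "open (fst c)" using A c(1) by (auto simp: smooth_atlas_def is_chart_def)
  then have eq: "at t within {t\<in>{0..1}. \<gamma> t \<in> fst c} = at t within {0..1}"
    using geodesic_continuous[OF \<gamma>] t c(2) by (intro at_within_preimage_open)
  obtain x' where "\<forall>t\<in>{t\<in>{0..1}. \<gamma> t \<in> fst c}.
      ((snd c \<circ> \<gamma>) has_vector_derivative x' t) (at t within {t\<in>{0..1}. \<gamma> t \<in> fst c})"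
    using \<gamma> c(1) unfolding geodesic_def Let_def by blast
  with c t eq have "((ref_chart A (\<gamma> t) \<circ> \<gamma>) has_vector_derivative x' t) (at t within {0..1})" by auto
  then show ?thesis unfolding velocity_def
    by (meson differentiableI_vector vector_derivative_works)
qed

lemma has_vector_derivative_affine_reparam:
  fixes f :: "real \<Rightarrow> 'e::real_normed_vector"
  assumes f: "(f has_vector_derivative v) (at (a + m * r) within I)" and J: "(\<lambda>r. a + m * r) ` J \<subseteq> I"
  shows "((\<lambda>r. f (a + m * r)) has_vector_derivative m *\<^sub>R v) (at r within J)"
proof -
  have "((\<lambda>r. a + m * r) has_vector_derivative m) (at r within J)"
    by (auto intro!: derivative_eq_intros)
  moreover have "(f has_vector_derivative v) (at (a + m * r) within (\<lambda>r. a + m * r) ` J)"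
    using f J by (rule has_vector_derivative_within_subset)
  ultimately show ?thesis
    using vector_diff_chain_within[of "\<lambda>r. a + m * r" m r J f v] by (simp add: comp_def)
qed

text \<open>The chart velocity becomes \<open>s *\<^sub>R x' (s * r)\<close>, and differentiating
  once more yields the factor \<open>s^2\<close>; \<open>christoffel_quadratic\<close> supplies the
  same factor on the other side of the equation.\<close>

lemma geodesic_from_scale:
  fixes A :: "('m::{t2_space,second_countable_topology}, 'e::real_normed_vector) chart set"
  assumes A: "smooth_atlas A" and g: "riemannian_metric A g"
    and \<sigma>: "geodesic_from A g p \<eta> \<sigma>" and s: "s \<in> {0..1}"
  shows "geodesic_from A g p (s *\<^sub>R \<eta>) (\<lambda>r. \<sigma> (s * r))"
proof -
  have geo: "geodesic A g \<sigma>" and \<sigma>0: "\<sigma> 0 = p" and vel: "has_velocity A \<sigma> \<eta> 0 {0..1}"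
    using \<sigma> by (auto simp: geodesic_from_def)
  have img: "(*) s ` {0..1} \<subseteq> {0..1}" using s by (auto intro: mult_le_one)
  have cont: "continuous_on {0..1} (\<lambda>r. \<sigma> (s * r))"
    by (rule continuous_on_compose2[OF geodesic_continuous[OF geo] _ img]) (intro continuous_intros)
  have "geodesic A g (\<lambda>r. \<sigma> (s * r))"
    unfolding geodesic_def Let_def
  proof (intro conjI ballI cont)
    fix c assume c: "c \<in> A"
    let ?I = "{t\<in>{0..1}. \<sigma> t \<in> fst c}" and ?J = "{r\<in>{0..1}. \<sigma> (s * r) \<in> fst c}"
    obtain x' where x': "\<And>t. t \<in> ?I \<Longrightarrow> ((snd c \<circ> \<sigma>) has_vector_derivative x' t) (at t within ?I)"
      "\<And>t. t \<in> ?I \<Longrightarrow> (x' has_vector_derivative - christoffel A g c ((snd c \<circ> \<sigma>) t) (x' t) (x' t)) (at t within ?I)"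
      using geo c unfolding geodesic_def Let_def by blast
    have sub: "(\<lambda>r. 0 + s * r) ` ?J \<subseteq> ?I" using s by (auto intro: mult_le_one)
    show "\<exists>y'. \<forall>r\<in>?J. ((snd c \<circ> (\<lambda>r. \<sigma> (s * r))) has_vector_derivative y' r) (at r within ?J) \<and>
      (y' has_vector_derivative - christoffel A g c ((snd c \<circ> (\<lambda>r. \<sigma> (s * r))) r) (y' r) (y' r)) (at r within ?J)"
    proof (intro exI[of _ "\<lambda>r. s *\<^sub>R x' (s * r)"] ballI conjI)
      fix r assume r: "r \<in> ?J"
      then have sr: "s * r \<in> ?I" using subsetD[OF sub imageI[OF r]] by simp
      show "((snd c \<circ> (\<lambda>r. \<sigma> (s * r))) has_vector_derivative s *\<^sub>R x' (s * r)) (at r within ?J)"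
        using has_vector_derivative_affine_reparam[OF _ sub, of "snd c \<circ> \<sigma>" "x' (s * r)" r] x'(1)[OF sr]
        by (simp add: comp_def)
      have "((\<lambda>r. x' (s * r)) has_vector_derivative
          s *\<^sub>R (- christoffel A g c ((snd c \<circ> \<sigma>) (s * r)) (x' (s * r)) (x' (s * r)))) (at r within ?J)"
        by (rule has_vector_derivative_affine_reparam[OF _ sub, of x', simplified add_0]) (rule x'(2)[OF sr])
      then have "((\<lambda>r. s *\<^sub>R x' (s * r)) has_vector_derivative
          s *\<^sub>R s *\<^sub>R (- christoffel A g c ((snd c \<circ> \<sigma>) (s * r)) (x' (s * r)) (x' (s * r)))) (at r within ?J)"
        by (auto intro!: derivative_eq_intros)
      moreover have "snd c (\<sigma> (s * r)) \<in> snd c ` fst c" using r by auto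
      ultimately show "((\<lambda>r. s *\<^sub>R x' (s * r)) has_vector_derivative
          - christoffel A g c ((snd c \<circ> (\<lambda>r. \<sigma> (s * r))) r) (s *\<^sub>R x' (s * r)) (s *\<^sub>R x' (s * r))) (at r within ?J)"
        by (simp add: christoffel_quadratic[OF A g c] power2_eq_square)
    qed
  qed
  moreover have "has_velocity A (\<lambda>r. \<sigma> (s * r)) (s *\<^sub>R \<eta>) 0 {0..1}"
    unfolding has_velocity_def
  proof
    show "continuous (at 0 within {0..1}) (\<lambda>r. \<sigma> (s * r))"
      using cont by (simp add: continuous_on_eq_continuous_within)
    show "((ref_chart A (\<sigma> (s * 0)) \<circ> (\<lambda>r. \<sigma> (s * r))) has_vector_derivative s *\<^sub>R \<eta>) (at 0 within {0..1})"
      using has_vector_derivative_affine_reparam[of "ref_chart A (\<sigma> 0) \<circ> \<sigma>" \<eta> 0 s 0 "{0..1}" "{0..1}"] vel img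
      by (simp add: has_velocity_def comp_def)
  qed
  ultimately show ?thesis using \<sigma>0 by (simp add: geodesic_from_def)
qed

lemma riem_exp_eq:
  assumes "exp_defined A g p \<eta>" "geodesic_from A g p \<eta> \<sigma>"
  shows "riem_exp A g p \<eta> = \<sigma> 1"
  using assms theI'[of "\<lambda>q. \<exists>\<gamma>. geodesic_from A g p \<eta> \<gamma> \<and> \<gamma> 1 = q"]
  unfolding exp_defined_def riem_exp_def by blast

text \<open>\<open>exp_domain\<close> says that the ray is a geodesic of constant speed, but not
  with which velocity it starts. By rescaling, the ray agrees on \<open>{0..1}\<close> with a single
  geodesic \<sigma> that starts with \<eta>. This identifies the transporting field at time 0 with
  \<open>B p \<eta>\<close>.\<close>

lemma velocity_riem_exp_0:
  fixes A :: "('m::{t2_space,second_countable_topology}, 'e::real_normed_vector) chart set"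
  assumes A: "smooth_atlas A" and g: "riemannian_metric A g"
    and ex: "\<And>t. t \<in> {0..1} \<Longrightarrow> exp_defined A g p (t *\<^sub>R \<eta>)"
  shows "velocity A (\<lambda>t. riem_exp A g p (t *\<^sub>R \<eta>)) {0..1} 0 = \<eta>"
proof -
  obtain \<sigma> where \<sigma>: "geodesic_from A g p \<eta> \<sigma>"
    using ex[of 1] by (auto simp: exp_defined_def)
  have eq: "riem_exp A g p (t *\<^sub>R \<eta>) = \<sigma> t" if "t \<in> {0..1}" for t
    using riem_exp_eq[OF ex[OF that] geodesic_from_scale[OF A g \<sigma> that]] by simp
  have "((ref_chart A (\<sigma> 0) \<circ> \<sigma>) has_vector_derivative \<eta>) (at 0 within {0..1})"
    using \<sigma> by (auto simp: geodesic_from_def has_velocity_def)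
  then have "((ref_chart A (\<sigma> 0) \<circ> (\<lambda>t. riem_exp A g p (t *\<^sub>R \<eta>))) has_vector_derivative \<eta>) (at 0 within {0..1})"
    by (rule has_vector_derivative_transform[rotated 2]) (auto simp: eq)
  moreover have "riem_exp A g p (0 *\<^sub>R \<eta>) = \<sigma> 0" using eq[of 0] by simp
  ultimately show ?thesis unfolding velocity_def
    using vector_derivative_within_cbox[of 0 1 0 _ \<eta>] by simp
qed

text \<open>An upper bound for the infimum needs one competitor on \<open>{0..1}\<close>: the arc
  between the two times, reparametrized affinely. The factor \<open>m\<close> may be negative, so
  the arc may run backwards, which covers both orders of the arguments without symmetry of
  \<open>riem_dist\<close>.\<close>

lemma geodesic_riem_dist_le:
  fixes A :: "('m::{t2_space,second_countable_topology}, 'e::real_normed_vector) chart set"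
  assumes A: "smooth_atlas A" and g: "riemannian_metric A g"
    and \<gamma>: "geodesic A g \<gamma>" "\<gamma> ` {0..1} \<subseteq> S"
    and speed: "\<And>t. t \<in> {0..1} \<Longrightarrow> tangent_norm g (\<gamma> t) (velocity A \<gamma> {0..1} t) = d"
    and st: "s \<in> {0..1}" "t \<in> {0..1}"
  shows "riem_dist A g S (\<gamma> s) (\<gamma> t) \<le> d * \<bar>s - t\<bar>"
proof -
  define m where "m = t - s"
  define \<beta> where "\<beta> r = \<gamma> (s + m * r)" for r
  have d: "0 \<le> d"
  proof -
    have "0 \<le> g p u u" for p u
      using g less_imp_le linear_0[of "g p u"] unfolding riemannian_metric_def by (metis order_refl)
    then show ?thesis using speed[of 0] by (auto simp: tangent_norm_def)
  qed
  have img: "s + m * r \<in> {0..1}" if "r \<in> {0..1}" for r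
  proof -
    have "s + m * r = (1 - r) * s + r * t" by (simp add: m_def algebra_simps)
    then show ?thesis
      using convexD_alt[of "{0..1::real}" s t r] that st by simp
  qed
  have sub: "(\<lambda>r. s + m * r) ` {0..1} \<subseteq> {0..1}" using img by blast
  have cont: "continuous_on {0..1} \<beta>"
    unfolding \<beta>_def
    by (rule continuous_on_compose2[OF geodesic_continuous[OF \<gamma>(1)] _ sub]) (intro continuous_intros)
  have vel: "velocity A \<beta> {0..1} r = m *\<^sub>R velocity A \<gamma> {0..1} (s + m * r)" if r: "r \<in> {0..1}" for r
  proof -
    have "((ref_chart A (\<beta> r) \<circ> \<beta>) has_vector_derivative m *\<^sub>R velocity A \<gamma> {0..1} (s + m * r)) (at r within {0..1})"
      using has_vector_derivative_affine_reparam[OF geodesic_has_velocity[OF A \<gamma>(1) img[OF r]] sub]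
      by (simp add: \<beta>_def comp_def)
    then show ?thesis unfolding velocity_def
      using vector_derivative_within_cbox[of 0 1 r "ref_chart A (\<beta> r) \<circ> \<beta>"] r by simp
  qed
  have spd: "tangent_norm g (\<beta> r) (velocity A \<beta> {0..1} r) = d * \<bar>m\<bar>" if r: "r \<in> {0..1}" for r
  proof -
    have lin: "linear (g p u)" "g p u w = g p w u" for p u w using g by (auto simp: riemannian_metric_def)
    have "g p (m *\<^sub>R u) (m *\<^sub>R u) = m^2 * g p u u" for p u
      using lin(2)[of p "m *\<^sub>R u" u] by (simp add: linear_scale[OF lin(1)] power2_eq_square)
    then have "tangent_norm g p (m *\<^sub>R u) = \<bar>m\<bar> * tangent_norm g p u" for p u
      by (simp add: tangent_norm_def real_sqrt_mult)
    then show ?thesis using speed[OF img[OF r]] by (simp add: vel[OF r] \<beta>_def)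
  qed
  have pw: "piecewise_C1_curve A \<beta>"
    unfolding piecewise_C1_curve_def
  proof (intro conjI ballI allI impI cont)
    fix c a b assume c: "c \<in> A" and ab: "0 \<le> a \<and> a \<le> b \<and> b \<le> 1 \<and> \<beta> ` {a..b} \<subseteq> fst c"
    let ?I = "{t\<in>{0..1}. \<gamma> t \<in> fst c}"
    obtain x' where x': "\<And>t. t \<in> ?I \<Longrightarrow> ((snd c \<circ> \<gamma>) has_vector_derivative x' t) (at t within ?I)"
      "\<And>t. t \<in> ?I \<Longrightarrow> (x' has_vector_derivative - christoffel A g c ((snd c \<circ> \<gamma>) t) (x' t) (x' t)) (at t within ?I)"
      using \<gamma>(1) c unfolding geodesic_def Let_def by blast
    have J: "(\<lambda>r. s + m * r) ` {a..b} \<subseteq> ?I"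
    proof
      fix y assume "y \<in> (\<lambda>r. s + m * r) ` {a..b}"
      then obtain r where r: "r \<in> {a..b}" "y = s + m * r" by blast
      then have "\<beta> r \<in> fst c" "r \<in> {0..1}" using ab by auto
      then show "y \<in> ?I" using img[of r] r(2) by (auto simp: \<beta>_def)
    qed
    have der: "((snd c \<circ> \<beta>) has_vector_derivative m *\<^sub>R x' (s + m * r)) (at r within {a..b})"
      if "r \<in> {a..b}" for r
      using has_vector_derivative_affine_reparam[OF x'(1)[OF subsetD[OF J imageI[OF that]]] J]
      by (simp add: \<beta>_def comp_def)
    have cx: "continuous_on {a..b} (\<lambda>r. m *\<^sub>R x' (s + m * r))"
    proof -
      have x'_cont: "continuous_on ?I x'"
        using x'(2) by (intro continuous_on_vector_derivative)
      have "continuous_on {a..b} (\<lambda>r. x' (s + m * r))"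
        by (rule continuous_on_compose2[OF x'_cont _ J]) (intro continuous_intros)
      then show ?thesis by (intro continuous_intros)
    qed
    \<comment> \<open>\<open>C1_differentiable_on\<close> asks for two-sided derivatives, and at
      \<open>a\<close> and \<open>b\<close> only one-sided ones are known; hence both endpoints
      become exceptional points.\<close>
    show "(snd c \<circ> \<beta>) piecewise_C1_differentiable_on {a..b}"
      unfolding piecewise_C1_differentiable_on_def
    proof (intro conjI exI[of _ "{a, b}"])
      show "continuous_on {a..b} (snd c \<circ> \<beta>)"
        using der by (intro continuous_on_vector_derivative)
      have "((snd c \<circ> \<beta>) has_vector_derivative m *\<^sub>R x' (s + m * r)) (at r)" if "r \<in> {a..b} - {a, b}" for r
        using der[of r] that at_within_Icc_at[of a r b] by (auto simp del: o_apply)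
      moreover have "continuous_on ({a..b} - {a, b}) (\<lambda>r. m *\<^sub>R x' (s + m * r))"
        using cx by (rule continuous_on_subset) auto
      ultimately show "(snd c \<circ> \<beta>) C1_differentiable_on {a..b} - {a, b}"
        unfolding C1_differentiable_on_def by (intro exI conjI ballI)
    qed auto
  qed
  have len: "curve_length A g \<beta> = ennreal (d * \<bar>m\<bar>)"
  proof -
    have "curve_length A g \<beta> = (\<integral>\<^sup>+ r\<in>{0..1::real}. ennreal (d * \<bar>m\<bar>) \<partial>lborel)"
      unfolding curve_length_def by (intro set_nn_integral_cong) (auto simp: spd)
    then show ?thesis by (simp add: nn_integral_cmult_indicator)
  qed
  have "\<beta> ` {0..1} \<subseteq> S" using \<gamma>(2) sub by (auto simp: \<beta>_def)
  moreover have "\<beta> 0 = \<gamma> s" "\<beta> 1 = \<gamma> t" by (auto simp: \<beta>_def m_def)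
  ultimately have "(INF \<gamma>\<in>{\<gamma>'. piecewise_C1_curve A \<gamma>' \<and> \<gamma>' ` {0..1} \<subseteq> S \<and> \<gamma>' 0 = \<gamma> s \<and> \<gamma>' 1 = \<gamma> t}.
      curve_length A g \<gamma>) \<le> ennreal (d * \<bar>m\<bar>)"
    using pw len by (intro INF_lower2[of \<beta>]) auto
  then have "riem_dist A g S (\<gamma> s) (\<gamma> t) \<le> enn2real (ennreal (d * \<bar>m\<bar>))"
    unfolding riem_dist_def by (intro enn2real_mono) auto
  then show ?thesis using d by (simp add: m_def abs_minus_commute)
qed


section \<open>Lipschitz curves with prescribed derivative almost everywhere\<close>

text \<open>Dominated convergence for the difference quotients, whose integrals converge to the increment.\<close>

lemma lipschitz_zero_derivative_const:
  fixes h :: "real \<Rightarrow> real"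
  assumes lip: "L-lipschitz_on {0..1} h"
    and ae: "AE t in lborel. t \<in> {0..1} \<longrightarrow> (h has_real_derivative 0) (at t within {0..1})"
    and b: "b \<in> {0..1}"
  shows "h b = h 0"
proof -
  \<comment> \<open>Constant extension of \<open>h\<close> beyond the unit interval, so that forward
    difference quotients make sense up to time 1.\<close>
  define F where "F t = h (max 0 (min 1 t))" for t
  have L: "0 \<le> L" using lip by (rule lipschitz_on_nonneg)
  have Flip: "\<bar>F s - F t\<bar> \<le> L * \<bar>s - t\<bar>" for s t
  proof -
    have "\<bar>F s - F t\<bar> \<le> L * \<bar>max 0 (min 1 s) - max 0 (min 1 t)\<bar>"
      unfolding F_def using lipschitz_onD[OF lip, of "max 0 (min 1 s)" "max 0 (min 1 t)"]
      by (auto simp: dist_real_def)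
    also have "\<dots> \<le> L * \<bar>s - t\<bar>" using L by (intro mult_left_mono) auto
    finally show ?thesis .
  qed
  then have "L-lipschitz_on UNIV F" using L by (auto intro!: lipschitz_onI simp: dist_real_def)
  then have Fcont: "continuous_on X F" for X
    using lipschitz_on_continuous_on continuous_on_subset subset_UNIV by metis
  define P where "P t = integral {-1..t} F" for t
  have P: "(P has_real_derivative F t) (at t)" if "t \<in> {0..2}" for t
  proof -
    have "(P has_vector_derivative F t) (at t within {-1..3})"
      unfolding P_def using that by (intro integral_has_vector_derivative Fcont) auto
    then show ?thesis
      using that at_within_Icc_at[of "-1" t 3] by (simp add: has_real_derivative_iff_has_vector_derivative)
  qed
  define q where "q n t = real (Suc n) * (F (t + 1 / real (Suc n)) - F t)" for n t
  define Q where "Q n t = real (Suc n) * (P (t + 1 / real (Suc n)) - P t)" for n t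
  have Qder: "(Q n has_real_derivative q n t) (at t)" if "t \<in> {0..1}" for n t
  proof -
    have "1 / real (Suc n) \<le> 1" by simp
    then have t': "t + 1 / real (Suc n) \<in> {0..2}" using that
      by (metis (no_types, opaque_lifting) add_mono atLeastAtMost_iff add_nonneg_nonneg divide_nonneg_nonneg of_nat_0_le_iff one_add_one zero_le_one)
    have "((\<lambda>t. P (t + 1 / real (Suc n))) has_real_derivative F (t + 1 / real (Suc n))) (at t)"
      using P[OF t'] DERIV_shift[of P "F (t + 1 / real (Suc n))" t "1 / real (Suc n)"] by simp
    moreover have "(P has_real_derivative F t) (at t)" using that by (intro P) auto
    ultimately show ?thesis unfolding Q_def q_def by (intro DERIV_cmult DERIV_diff)
  qed
  have qint: "(q n has_integral (Q n b - Q n 0)) {0..b}" for n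
    using b Qder by (intro fundamental_theorem_of_calculus)
      (auto simp flip: has_real_derivative_iff_has_vector_derivative intro: has_field_derivative_at_within)
  have Qlim: "(\<lambda>n. Q n t) \<longlonglongrightarrow> F t" if "t \<in> {0..1}" for t
  proof -
    have 1: "((\<lambda>k. (P (t + k) - P t) / k) \<longlongrightarrow> F t) (at 0)"
      using P[of t] that by (simp add: DERIV_def)
    have "filterlim (\<lambda>n. 1 / real (Suc n)) (at 0) sequentially"
      unfolding filterlim_at using LIMSEQ_inverse_real_of_nat by (simp add: inverse_eq_divide)
    from filterlim_compose[OF 1 this] show ?thesis by (simp add: Q_def mult.commute)
  qed
  obtain N where N: "negligible N" "\<And>t. t \<in> {0..1} \<Longrightarrow> t \<notin> N \<Longrightarrow> (h has_real_derivative 0) (at t within {0..1})"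
  proof -
    have "AE t in lebesgue. t \<in> {0..1} \<longrightarrow> (h has_real_derivative 0) (at t within {0..1})"
      using ae by (rule AE_completion)
    then obtain N where "N \<in> null_sets lebesgue"
      "{t\<in>space lebesgue. \<not> (t \<in> {0..1} \<longrightarrow> (h has_real_derivative 0) (at t within {0..1}))} \<subseteq> N"
      unfolding eventually_ae_filter by blast
    then show ?thesis by (intro that[of N]) (auto simp: negligible_iff_null_sets)
  qed
  \<comment> \<open>Adding 0 and 1 turns derivatives within \<open>{0..1}\<close> into two-sided
    ones. Resetting the quotients to 0 on this null set keeps their integrals and makes the
    convergence hold at every point, as \<open>dominated_convergence\<close> demands.\<close>
  define N' where "N' = insert 0 (insert 1 N)"
  have N': "negligible N'" using N(1) by (simp add: N'_def negligible_insert)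
  define q' where "q' n t = (if t \<in> N' then 0 else q n t)" for n t
  have q'int: "(q' n has_integral (Q n b - Q n 0)) {0..b}" for n
    by (rule has_integral_spike[OF N' _ qint]) (auto simp: q'_def)
  have bound: "\<bar>q n t\<bar> \<le> L" for n t
  proof -
    have "\<bar>F (t + 1 / real (Suc n)) - F t\<bar> \<le> L / real (Suc n)"
      using Flip[of "t + 1 / real (Suc n)" t] by simp
    then have "real (Suc n) * \<bar>F (t + 1 / real (Suc n)) - F t\<bar> \<le> L"
      by (simp add: pos_le_divide_eq mult.commute del: of_nat_Suc)
    then show ?thesis unfolding q_def abs_mult by simp
  qed
  have lim0: "(\<lambda>n. q' n t) \<longlonglongrightarrow> 0" if t: "t \<in> {0..b}" for t
  proof (cases "t \<in> N'")
    case False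
    then have t': "t \<in> {0..1}" "0 < t" "t < 1" "t \<notin> N" using t b by (auto simp: N'_def)
    have "(h has_real_derivative 0) (at t)"
      using N(2)[OF t'(1,4)] t' at_within_Icc_at[of 0 t 1] by simp
    then have "(F has_real_derivative 0) (at t)"
      by (rule has_field_derivative_transform_within_open[of _ _ _ "{0<..<1}"]) (use t' in \<open>auto simp: F_def\<close>)
    then have 1: "((\<lambda>k. (F (t + k) - F t) / k) \<longlongrightarrow> 0) (at 0)" by (simp add: DERIV_def)
    have "filterlim (\<lambda>n. 1 / real (Suc n)) (at 0) sequentially"
      unfolding filterlim_at using LIMSEQ_inverse_real_of_nat by (simp add: inverse_eq_divide)
    from filterlim_compose[OF 1 this] show ?thesis using False by (simp add: q'_def q_def mult.commute)
  qed (simp add: q'_def)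
  have "(\<lambda>n. integral {0..b} (q' n)) \<longlonglongrightarrow> integral {0..b} (\<lambda>t. 0)"
  proof (rule dominated_convergence(2))
    show "q' n integrable_on {0..b}" for n using q'int by blast
    show "(\<lambda>t::real. L) integrable_on {0..b}" by (rule integrable_const_ivl)
    show "norm (q' n t) \<le> L" for n t using bound L by (simp add: q'_def)
    show "(\<lambda>n. q' n t) \<longlonglongrightarrow> 0" if "t \<in> {0..b}" for t using lim0 that by simp
  qed
  then have "(\<lambda>n. Q n b - Q n 0) \<longlonglongrightarrow> 0" using integral_unique[OF q'int] by simp
  moreover have "(\<lambda>n. Q n b - Q n 0) \<longlonglongrightarrow> F b - F 0" using b by (intro tendsto_diff Qlim) auto
  ultimately have "F b - F 0 = 0" using LIMSEQ_unique by blast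
  then show ?thesis using b by (simp add: F_def)
qed

text \<open>Subtracting a primitive of \<open>v\<close> leaves a Lipschitz function with zero
  derivative almost everywhere, which is constant in each coordinate. Flows satisfy their equation
  for almost every time; when the right side is continuous in time, this upgrades it to every
  time.\<close>

lemma lipschitz_ae_derivative_continuous:
  fixes f v :: "real \<Rightarrow> 'a::euclidean_space"
  assumes lip: "L-lipschitz_on {0..1} f"
    and ae: "AE t in lborel. t \<in> {0..1} \<longrightarrow> (f has_vector_derivative v t) (at t within {0..1})"
    and cont: "continuous_on {0..1} v" and t: "t \<in> {0..1}"
  shows "(f has_vector_derivative v t) (at t within {0..1})"
proof -
  define V where "V t = integral {0..t} v" for t
  have V: "(V has_vector_derivative v t) (at t within {0..1})" if "t \<in> {0..1}" for t
    unfolding V_def using cont that by (rule integral_has_vector_derivative)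
  obtain M where M: "\<And>t. t \<in> {0..1} \<Longrightarrow> norm (v t) \<le> M"
    using compact_imp_bounded[OF compact_continuous_image[OF cont compact_Icc]]
    unfolding bounded_iff by (metis imageI)
  have "0 \<le> M" using M[of 0] norm_ge_zero[of "v 0"] by (simp del: norm_ge_zero)
  have Vlip: "M-lipschitz_on {0..1} V"
  proof (rule bounded_derivative_imp_lipschitz[where f = V and f' = "\<lambda>x h. h *\<^sub>R v x"])
    show "(V has_derivative (\<lambda>h. h *\<^sub>R v x)) (at x within {0..1})" if "x \<in> {0..1}" for x
      using V[OF that] by (simp add: has_vector_derivative_def)
    show "onorm (\<lambda>h. h *\<^sub>R v x) \<le> M" if "x \<in> {0..1}" for x
      using M[OF that] by (intro onorm_le) (simp add: mult.commute[of M] mult_left_mono)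
    show "convex {0..1::real}" "0 \<le> M" using \<open>0 \<le> M\<close> by auto
  qed
  have const: "f b - V b = f 0 - V 0" if b: "b \<in> {0..1}" for b
  proof (rule euclidean_eqI)
    fix e :: 'a assume e: "e \<in> Basis"
    have lip': "(L + M)-lipschitz_on {0..1} (\<lambda>t. f t - V t)"
      using lip Vlip by (rule lipschitz_on_diff)
    have "(L + M)-lipschitz_on {0..1} (\<lambda>t. (f t - V t) \<bullet> e)"
    proof (rule lipschitz_onI)
      fix x y :: real assume xy: "x \<in> {0..1}" "y \<in> {0..1}"
      have "dist ((f x - V x) \<bullet> e) ((f y - V y) \<bullet> e) \<le> dist (f x - V x) (f y - V y)"
        using Basis_le_norm[OF e, of "(f x - V x) - (f y - V y)"] by (simp add: dist_norm inner_diff_left)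
      also have "\<dots> \<le> (L + M) * dist x y" using lipschitz_onD[OF lip'] xy by blast
      finally show "dist ((f x - V x) \<bullet> e) ((f y - V y) \<bullet> e) \<le> (L + M) * dist x y" .
    qed (use lipschitz_on_nonneg[OF lip'] in simp)
    moreover have "AE t in lborel. t \<in> {0..1} \<longrightarrow> ((\<lambda>t. (f t - V t) \<bullet> e) has_real_derivative 0) (at t within {0..1})"
      using ae
    proof eventually_elim
      case (elim t)
      show ?case
      proof
        assume t: "t \<in> {0..1}"
        then have "((\<lambda>t. f t - V t) has_vector_derivative (v t - v t)) (at t within {0..1})"
          using elim V by (intro derivative_intros) auto
        then have "((\<lambda>t. f t - V t) has_derivative (\<lambda>h. 0)) (at t within {0..1})"
          by (simp add: has_vector_derivative_def)
        from has_derivative_inner_left[OF this, of e]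
        show "((\<lambda>t. (f t - V t) \<bullet> e) has_real_derivative 0) (at t within {0..1})"
          by (simp add: has_field_derivative_def lambda_zero)
      qed
    qed
    ultimately show "(f b - V b) \<bullet> e = (f 0 - V 0) \<bullet> e"
      using b by (rule lipschitz_zero_derivative_const)
  qed
  have der: "((\<lambda>t. V t + (f 0 - V 0)) has_vector_derivative v t) (at t within {0..1})"
    using V[OF t] by (auto intro!: derivative_eq_intros)
  have eq: "f b = V b + (f 0 - V 0)" if "b \<in> {0..1}" for b
    using const[OF that] by (metis add.commute diff_add_cancel)
  show ?thesis by (rule has_vector_derivative_transform[OF t eq der])
qed


section \<open>Couplings and potentials\<close>

lemma gradient_has_derivative: "GDERIV f x :> D \<Longrightarrow> (f has_derivative (\<lambda>h. D \<bullet> h)) (at x)"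
  by (simp add: gderiv_def inner_commute)

text \<open>Mean value inequality on the segment, along which the gradient differs from
  \<open>u x\<close> by at most \<open>M * norm (y - x)\<close>. The sharp constant would be M/2;
  the factor 2 is harmless below.\<close>

lemma gradient_taylor:
  fixes f :: "'a::euclidean_space \<Rightarrow> real"
  assumes f: "\<And>x. GDERIV f x :> u x" and u: "\<And>x y. norm (u x - u y) \<le> M * norm (x - y)"
  shows "\<bar>f y - f x - u x \<bullet> (y - x)\<bar> \<le> M * (norm (y - x))^2"
proof -
  have M: "0 \<le> M * norm (y - x)"
    using u[of y x] norm_ge_zero order_trans by blast
  have "norm (f y - f x - (\<lambda>h. u x \<bullet> h) (y - x)) \<le> norm (y - x) * (M * norm (y - x))"
  proof (rule differentiable_bound_linearization[where S = "closed_segment x y" and f' = "\<lambda>z h. u z \<bullet> h"])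
    show "x + t *\<^sub>R (y - x) \<in> closed_segment x y" if "t \<in> {0..1}" for t
      using that by (auto simp: in_segment algebra_simps intro!: exI[of _ t])
    show "(f has_derivative (\<lambda>h. u z \<bullet> h)) (at z within closed_segment x y)" for z
      using gradient_has_derivative[OF f] by (rule has_derivative_at_withinI)
    show "onorm ((\<lambda>h. u z \<bullet> h) - (\<lambda>h. u x \<bullet> h)) \<le> M * norm (y - x)" if "z \<in> closed_segment x y" for z
    proof (rule onorm_bound[OF M])
      fix h :: 'a
      have "norm (z - x) \<le> norm (y - x)"
        using segment_bound(1)[OF that] by simp
      moreover have "0 \<le> M" if "y \<noteq> x" using M that by (simp add: zero_le_mult_iff)
      ultimately have "M * norm (z - x) \<le> M * norm (y - x)"
        by (cases "y = x") (auto intro: mult_left_mono)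
      then have "norm (u z - u x) \<le> M * norm (y - x)" using u[of z x] by linarith
      then have "norm (u z - u x) * norm h \<le> M * norm (y - x) * norm h" by (rule mult_right_mono) simp
      then show "norm (((\<lambda>h. u z \<bullet> h) - (\<lambda>h. u x \<bullet> h)) h) \<le> M * norm (y - x) * norm h"
        using Cauchy_Schwarz_ineq2[of "u z - u x" h] by (simp add: inner_diff_left)
    qed
  qed auto
  then show ?thesis by (simp add: power2_eq_square mult_ac)
qed

lemma gradient_lipschitz:
  fixes f :: "'a::euclidean_space \<Rightarrow> real"
  assumes f: "\<And>x. GDERIV f x :> u x" and u: "\<And>x. norm (u x) \<le> M"
  shows "\<bar>f x - f y\<bar> \<le> M * norm (x - y)"
proof -
  have "norm (f x - f y) \<le> M * norm (x - y)"
  proof (rule differentiable_bound[OF convex_UNIV])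
    show "(f has_derivative (\<lambda>h. u z \<bullet> h)) (at z)" for z
      by (rule gradient_has_derivative[OF f])
    show "onorm (\<lambda>h. u z \<bullet> h) \<le> M" for z
    proof (rule onorm_le)
      fix h
      have "norm (u z \<bullet> h) \<le> norm (u z) * norm h" using Cauchy_Schwarz_ineq2 by simp
      also have "\<dots> \<le> M * norm h" using u by (intro mult_right_mono) auto
      finally show "norm (u z \<bullet> h) \<le> M * norm h" .
    qed
  qed auto
  then show ?thesis by simp
qed

lemma bounded_lipschitz_continuous:
  fixes f :: "'a::metric_space \<Rightarrow> 'b::metric_space"
  assumes "\<And>x y. dist (f x) (f y) \<le> M * dist x y"
  shows "continuous_on X f"
proof -
  have "\<bar>M\<bar>-lipschitz_on UNIV f"
  proof (rule lipschitz_onI)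
    show "dist (f x) (f y) \<le> \<bar>M\<bar> * dist x y" for x y
      by (rule order_trans[OF assms mult_right_mono]) auto
  qed auto
  then show ?thesis using lipschitz_on_continuous_on continuous_on_subset subset_UNIV by metis
qed

section \<open>Couplings of measures on a compact set\<close>

lemma prob_measures_onD:
  assumes "\<mu> \<in> prob_measures_on \<Omega>" "closed \<Omega>"
  shows "prob_space \<mu>" "sets \<mu> = sets borel" "AE x in \<mu>. x \<in> \<Omega>" "space \<mu> = UNIV"
proof -
  show "prob_space \<mu>" and s: "sets \<mu> = sets borel" using assms by (auto simp: prob_measures_on_def)
  have "- \<Omega> \<in> null_sets \<mu>" using assms s by (auto simp: prob_measures_on_def null_sets_def)
  then show "AE x in \<mu>. x \<in> \<Omega>" by (rule AE_I') auto
  show "space \<mu> = UNIV" using sets_eq_imp_space_eq[OF s] by simp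
qed

lemma integrable_continuous_prob_measure:
  fixes h :: "'a::euclidean_space \<Rightarrow> 'b::{banach, second_countable_topology}"
  assumes \<mu>: "\<mu> \<in> prob_measures_on \<Omega>" and \<Omega>: "compact \<Omega>" and h: "continuous_on UNIV h"
  shows "integrable \<mu> h"
proof -
  note D = prob_measures_onD[OF \<mu> compact_imp_closed[OF \<Omega>]]
  interpret prob_space \<mu> by (rule D(1))
  have "bounded (h ` \<Omega>)"
    using compact_continuous_image[OF continuous_on_subset[OF h] \<Omega>] compact_imp_bounded by blast
  then obtain C where C: "\<And>x. x \<in> \<Omega> \<Longrightarrow> norm (h x) \<le> C" unfolding bounded_iff by (metis imageI)
  have "h \<in> borel_measurable \<mu>"
    using borel_measurable_continuous_onI[OF h] D(2) by (simp cong: measurable_cong_sets)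
  then show ?thesis
    using D(3) by (intro integrable_const_bound[of _ C]) (auto elim: eventually_mono simp: C)
qed

lemma couplings_marginals:
  assumes "\<pi> \<in> couplings \<mu> \<nu>"
  shows "fst \<in> \<pi> \<rightarrow>\<^sub>M borel" "snd \<in> \<pi> \<rightarrow>\<^sub>M borel"
    "distr \<pi> borel fst = \<mu>" "distr \<pi> borel snd = \<nu>"
proof -
  have s: "sets \<pi> = sets borel" using assms by (simp add: couplings_def)
  show "fst \<in> \<pi> \<rightarrow>\<^sub>M borel" "snd \<in> \<pi> \<rightarrow>\<^sub>M borel"
    unfolding measurable_cong_sets[OF s refl]
    by (intro borel_measurable_continuous_onI continuous_intros)+
qed (use assms in \<open>auto simp: couplings_def\<close>)

text \<open>Couplings are concentrated on the product of \<Omega> with itself, where the cost is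
  bounded; hence \<open>transport_cost\<close> may be replaced by a real integral.\<close>

lemma coupling_facts:
  fixes \<mu> \<nu> :: "'a::euclidean_space measure"
  assumes \<pi>: "\<pi> \<in> couplings \<mu> \<nu>" and \<mu>: "\<mu> \<in> prob_measures_on \<Omega>" and \<nu>: "\<nu> \<in> prob_measures_on \<Omega>"
    and \<Omega>: "compact \<Omega>"
  shows "prob_space \<pi>" "AE z in \<pi>. fst z \<in> \<Omega> \<and> snd z \<in> \<Omega>"
    "integrable \<pi> (\<lambda>z. (norm (fst z - snd z))^2)" "integrable \<pi> (\<lambda>z. norm (fst z - snd z))"
    "transport_cost \<pi> = ennreal (LINT z|\<pi>. (norm (fst z - snd z))^2)"
proof -
  note m = couplings_marginals[OF \<pi>]
  note D = prob_measures_onD[OF \<mu> compact_imp_closed[OF \<Omega>]] prob_measures_onD[OF \<nu> compact_imp_closed[OF \<Omega>]]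
  show p: "prob_space \<pi>" using prob_space_distrD[OF m(1)] D(1) m(3) by simp
  show ae: "AE z in \<pi>. fst z \<in> \<Omega> \<and> snd z \<in> \<Omega>"
    using AE_distrD[OF m(1), of "\<lambda>x. x \<in> \<Omega>"] AE_distrD[OF m(2), of "\<lambda>x. x \<in> \<Omega>"] D(3,7)
    unfolding m(3,4) by simp
  obtain R where R: "\<And>x. x \<in> \<Omega> \<Longrightarrow> norm x \<le> R"
    using compact_imp_bounded[OF \<Omega>] unfolding bounded_iff by blast
  have bd: "AE z in \<pi>. norm (fst z - snd z) \<le> 2 * R"
    using ae
  proof eventually_elim
    case (elim z)
    then show ?case using R[of "fst z"] R[of "snd z"] norm_triangle_ineq4[of "fst z" "snd z"] by simp
  qed
  interpret prob_space \<pi> by (rule p)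
  note [measurable] = m(1,2)
  show "integrable \<pi> (\<lambda>z. norm (fst z - snd z))"
    using bd by (intro integrable_const_bound[of _ "2 * R"]) auto
  show i: "integrable \<pi> (\<lambda>z. (norm (fst z - snd z))^2)"
  proof (rule integrable_const_bound[of _ "(2 * R)^2"])
    show "AE z in \<pi>. norm ((norm (fst z - snd z))^2) \<le> (2 * R)^2"
      using bd by eventually_elim (metis abs_of_nonneg norm_ge_zero power_mono real_norm_def zero_le_power)
  qed simp
  show "transport_cost \<pi> = ennreal (LINT z|\<pi>. (norm (fst z - snd z))^2)"
    unfolding transport_cost_def by (intro nn_integral_eq_integral i) auto
qed

lemma W_nonneg [simp]: "0 \<le> W \<mu> \<nu>"
  by (simp add: W_def)

lemma W_sq_le:
  fixes \<mu> \<nu> :: "'a::euclidean_space measure"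
  assumes \<pi>: "\<pi> \<in> couplings \<mu> \<nu>" and \<mu>: "\<mu> \<in> prob_measures_on \<Omega>" and \<nu>: "\<nu> \<in> prob_measures_on \<Omega>"
    and \<Omega>: "compact \<Omega>"
  shows "(W \<mu> \<nu>)^2 \<le> (LINT z|\<pi>. (norm (fst z - snd z))^2)"
proof -
  have "(INF \<pi>\<in>couplings \<mu> \<nu>. transport_cost \<pi>) \<le> ennreal (LINT z|\<pi>. (norm (fst z - snd z))^2)"
    using coupling_facts(5)[OF assms] by (metis INF_lower \<pi>)
  then have "enn2real (INF \<pi>\<in>couplings \<mu> \<nu>. transport_cost \<pi>) \<le> (LINT z|\<pi>. (norm (fst z - snd z))^2)"
    using enn2real_mono by fastforce
  then show ?thesis by (simp add: W_def)
qed

text \<open>Lower bounds for \<open>W\<close> depend on it: an infimum over no couplings would be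
  \<open>top\<close>, which \<open>enn2real\<close> sends to 0. The product provides a coupling of
  finite cost.\<close>

lemma product_coupling:
  fixes \<mu> \<nu> :: "'a::euclidean_space measure"
  assumes "prob_space \<mu>" "sets \<mu> = sets borel" "prob_space \<nu>" "sets \<nu> = sets borel"
  shows "\<mu> \<Otimes>\<^sub>M \<nu> \<in> couplings \<mu> \<nu>"
proof -
  interpret \<mu>: prob_space \<mu> by (rule assms(1))
  interpret \<nu>: prob_space \<nu> by (rule assms(3))
  interpret pair_prob_space \<mu> \<nu> ..
  have "sets (\<mu> \<Otimes>\<^sub>M \<nu>) = sets borel"
    using sets_pair_measure_cong[OF assms(2,4)] borel_prod by metis
  moreover have "distr (\<mu> \<Otimes>\<^sub>M \<nu>) borel fst = \<mu>"
  proof (rule measure_eqI)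
    fix X assume "X \<in> sets (distr (\<mu> \<Otimes>\<^sub>M \<nu>) borel fst)"
    then have X: "X \<in> sets \<mu>" using assms by simp
    have "fst -` X \<inter> space (\<mu> \<Otimes>\<^sub>M \<nu>) = X \<times> space \<nu>"
      using sets.sets_into_space[OF X] by (auto simp: space_pair_measure)
    then show "emeasure (distr (\<mu> \<Otimes>\<^sub>M \<nu>) borel fst) X = emeasure \<mu> X"
      using X assms(2) \<nu>.emeasure_pair_measure_Times[OF X sets.top] \<nu>.emeasure_space_1
      by (simp add: emeasure_distr measurable_cong_sets[OF refl assms(2)[symmetric]])
  qed (use assms in simp)
  moreover have "distr (\<mu> \<Otimes>\<^sub>M \<nu>) borel snd = \<nu>"
  proof (rule measure_eqI)
    fix X assume "X \<in> sets (distr (\<mu> \<Otimes>\<^sub>M \<nu>) borel snd)"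
    then have X: "X \<in> sets \<nu>" using assms by simp
    have "snd -` X \<inter> space (\<mu> \<Otimes>\<^sub>M \<nu>) = space \<mu> \<times> X"
      using sets.sets_into_space[OF X] by (auto simp: space_pair_measure)
    then show "emeasure (distr (\<mu> \<Otimes>\<^sub>M \<nu>) borel snd) X = emeasure \<nu> X"
      using X assms(4) \<nu>.emeasure_pair_measure_Times[OF sets.top X, of \<mu>] \<mu>.emeasure_space_1
      by (simp add: emeasure_distr measurable_cong_sets[OF refl assms(4)[symmetric]])
  qed (use assms in simp)
  ultimately show ?thesis by (simp add: couplings_def)
qed

lemma W_sq_ge:
  fixes \<mu> \<nu> :: "'a::euclidean_space measure"
  assumes \<mu>: "\<mu> \<in> prob_measures_on \<Omega>" and \<nu>: "\<nu> \<in> prob_measures_on \<Omega>" and \<Omega>: "compact \<Omega>"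
    and q: "\<And>\<pi>. \<pi> \<in> couplings \<mu> \<nu> \<Longrightarrow> q \<le> (LINT z|\<pi>. (norm (fst z - snd z))^2)"
  shows "q \<le> (W \<mu> \<nu>)^2"
proof -
  let ?I = "INF \<pi>\<in>couplings \<mu> \<nu>. transport_cost \<pi>"
  note D = prob_measures_onD[OF \<mu> compact_imp_closed[OF \<Omega>]] prob_measures_onD[OF \<nu> compact_imp_closed[OF \<Omega>]]
  have c: "\<mu> \<Otimes>\<^sub>M \<nu> \<in> couplings \<mu> \<nu>" using D by (intro product_coupling)
  have "?I \<le> transport_cost (\<mu> \<Otimes>\<^sub>M \<nu>)" using c by (rule INF_lower)
  also have "\<dots> < \<infinity>" using coupling_facts(5)[OF c \<mu> \<nu> \<Omega>] by simp
  finally have fin: "?I < \<infinity>" .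
  have "ennreal q \<le> ?I"
    using q coupling_facts(5)[OF _ \<mu> \<nu> \<Omega>] by (intro INF_greatest) (simp add: ennreal_leI)
  then have "enn2real (ennreal q) \<le> enn2real ?I" using fin by (intro enn2real_mono) auto
  \<comment> \<open>Only an inequality, because \<open>ennreal\<close> sends negative numbers to
    0.\<close>
  moreover have "q \<le> enn2real (ennreal q)" by (cases "0 \<le> q") (auto intro: order_trans[of _ 0])
  ultimately show ?thesis by (simp add: W_def)
qed

lemma W_commute:
  fixes \<mu> \<nu> :: "'a::euclidean_space measure"
  shows "W \<mu> \<nu> = W \<nu> \<mu>"
proof -
  have sw: "distr \<pi> borel prod.swap \<in> couplings \<nu> \<mu> \<and> transport_cost (distr \<pi> borel prod.swap) = transport_cost \<pi>"
    if \<pi>: "\<pi> \<in> couplings \<mu> \<nu>" for \<pi> and \<mu> \<nu> :: "'a measure"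
  proof -
    have s: "sets \<pi> = sets borel" using \<pi> by (simp add: couplings_def)
    have [measurable]: "prod.swap \<in> \<pi> \<rightarrow>\<^sub>M (borel :: ('a \<times> 'a) measure)"
      unfolding measurable_cong_sets[OF s refl]
      by (intro borel_measurable_continuous_onI) (auto simp: prod.swap_def intro!: continuous_intros)
    have [measurable]: "(fst :: 'a \<times> 'a \<Rightarrow> 'a) \<in> borel_measurable borel" "(snd :: 'a \<times> 'a \<Rightarrow> 'a) \<in> borel_measurable borel"
      by (intro borel_measurable_continuous_onI continuous_intros)+
    have "distr (distr \<pi> borel prod.swap) borel fst = \<nu>" "distr (distr \<pi> borel prod.swap) borel snd = \<mu>"
      using couplings_marginals(3,4)[OF \<pi>] by (auto simp: distr_distr comp_def)
    moreover have "transport_cost (distr \<pi> borel prod.swap) = transport_cost \<pi>"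
      unfolding transport_cost_def by (subst nn_integral_distr) (auto simp: norm_minus_commute)
    ultimately show ?thesis by (simp add: couplings_def)
  qed
  have "(INF \<pi>\<in>couplings \<mu> \<nu>. transport_cost \<pi>) \<le> (INF \<pi>\<in>couplings \<nu> \<mu>. transport_cost \<pi>)" for \<mu> \<nu> :: "'a measure"
    by (rule INF_greatest) (metis sw INF_lower)
  then have "(INF \<pi>\<in>couplings \<mu> \<nu>. transport_cost \<pi>) = (INF \<pi>\<in>couplings \<nu> \<mu>. transport_cost \<pi>)"
    by (intro antisym)
  then show ?thesis by (simp add: W_def)
qed

lemma coupling_integral_diff:
  fixes h :: "'a::euclidean_space \<Rightarrow> real"
  assumes \<pi>: "\<pi> \<in> couplings \<mu> \<nu>" and \<mu>: "\<mu> \<in> prob_measures_on \<Omega>" and \<nu>: "\<nu> \<in> prob_measures_on \<Omega>"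
    and \<Omega>: "compact \<Omega>" and h: "continuous_on UNIV h"
  shows "integrable \<pi> (\<lambda>z. h (fst z))" "integrable \<pi> (\<lambda>z. h (snd z))"
    "(LINT z|\<pi>. h (fst z)) = (LINT x|\<mu>. h x)" "(LINT z|\<pi>. h (snd z)) = (LINT x|\<nu>. h x)"
proof -
  note m = couplings_marginals[OF \<pi>]
  have hm: "h \<in> borel_measurable borel" using h by (rule borel_measurable_continuous_onI)
  show "integrable \<pi> (\<lambda>z. h (fst z))" "integrable \<pi> (\<lambda>z. h (snd z))"
    using integrable_continuous_prob_measure[OF \<mu> \<Omega> h] integrable_continuous_prob_measure[OF \<nu> \<Omega> h]
      integrable_distr[OF m(1), of h] integrable_distr[OF m(2), of h] m(3,4) by auto
  show "(LINT z|\<pi>. h (fst z)) = (LINT x|\<mu>. h x)" "(LINT z|\<pi>. h (snd z)) = (LINT x|\<nu>. h x)"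
    using integral_distr[OF m(1) hm] integral_distr[OF m(2) hm] m(3,4) by auto
qed

text \<open>The easy half of Kantorovich-Rubinstein duality bounds the difference by
  \<open>M\<close> times the mean displacement of any coupling. The mean displacement is at most the
  root of the mean square, since a variance is nonnegative.\<close>

lemma integral_diff_le_W:
  fixes h :: "'a::euclidean_space \<Rightarrow> real"
  assumes \<mu>: "\<mu> \<in> prob_measures_on \<Omega>" and \<nu>: "\<nu> \<in> prob_measures_on \<Omega>" and \<Omega>: "compact \<Omega>"
    and h: "\<And>x y. \<bar>h x - h y\<bar> \<le> M * norm (x - y)" and M: "0 \<le> M"
  shows "\<bar>(LINT x|\<mu>. h x) - (LINT x|\<nu>. h x)\<bar> \<le> M * W \<mu> \<nu>"
proof -
  have hc: "continuous_on UNIV h"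
    using h by (intro bounded_lipschitz_continuous[of h M]) (simp add: dist_norm)
  let ?d = "(LINT x|\<mu>. h x) - (LINT x|\<nu>. h x)"
  have "?d^2 / M^2 \<le> (W \<mu> \<nu>)^2"
  proof (rule W_sq_ge[OF \<mu> \<nu> \<Omega>])
    fix \<pi> assume \<pi>: "\<pi> \<in> couplings \<mu> \<nu>"
    note f = coupling_facts[OF \<pi> \<mu> \<nu> \<Omega>] and c = coupling_integral_diff[OF \<pi> \<mu> \<nu> \<Omega> hc]
    interpret prob_space \<pi> by (rule f(1))
    let ?n = "LINT z|\<pi>. norm (fst z - snd z)"
    have "\<bar>?d\<bar> = \<bar>LINT z|\<pi>. h (fst z) - h (snd z)\<bar>" using c by simp
    also have "\<dots> \<le> (LINT z|\<pi>. \<bar>h (fst z) - h (snd z)\<bar>)" by (rule integral_abs_bound)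
    also have "\<dots> \<le> (LINT z|\<pi>. M * norm (fst z - snd z))"
      using c f(4) h by (intro integral_mono) auto
    finally have 1: "\<bar>?d\<bar> \<le> M * ?n" by simp
    have "0 \<le> (LINT z|\<pi>. (norm (fst z - snd z) - ?n)^2)" by simp
    also have "\<dots> = (LINT z|\<pi>. (norm (fst z - snd z))^2) - ?n^2" using f(4,3) by (rule variance_eq)
    finally have 2: "?n^2 \<le> (LINT z|\<pi>. (norm (fst z - snd z))^2)" by simp
    have "?d^2 \<le> M^2 * ?n^2"
      using power_mono[OF 1, of 2] by (simp add: power_mult_distrib)
    then have "?d^2 / M^2 \<le> ?n^2"
      by (cases "M = 0") (auto simp: field_simps)
    with 2 show "?d^2 / M^2 \<le> (LINT z|\<pi>. (norm (fst z - snd z))^2)" by linarith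
  qed
  \<comment> \<open>For \<open>M = 0\<close> the division above returns 0 and says nothing. Then
    \<open>h\<close> is constant, and both measures have mass 1.\<close>
  moreover have "?d = 0" if "M = 0"
  proof -
    have "h x = h 0" for x using h[of x 0] that by simp
    then have "h = (\<lambda>_. h 0)" by blast
    then show ?thesis
      using prob_space.prob_space prob_measures_onD(1)[OF \<mu> compact_imp_closed[OF \<Omega>]]
        prob_measures_onD(1)[OF \<nu> compact_imp_closed[OF \<Omega>]]
      by (metis Bochner_Integration.lebesgue_integral_const diff_self)
  qed
  ultimately have "?d^2 \<le> (M * W \<mu> \<nu>)^2"
    using M by (cases "M = 0") (auto simp: field_simps power_mult_distrib)
  then have "\<bar>?d\<bar> \<le> \<bar>M * W \<mu> \<nu>\<bar>" by (simp only: abs_le_square_iff)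
  then show ?thesis using M by simp
qed

text \<open>For every coupling, \<open>\<bar>y - x - t u(x)\<bar>^2 \<ge> 0\<close> bounds the cost below by \<open>2 t \<langle>u(x), y - x\<rangle> - t^2 \<bar>u(x)\<bar>^2\<close>,
  and \<open>\<langle>u(x), y - x\<rangle>\<close> is \<open>f(y) - f(x)\<close> up to second order.\<close>

lemma W_sq_lower_bound:
  fixes f :: "'a::euclidean_space \<Rightarrow> real"
  assumes \<mu>: "\<mu> \<in> prob_measures_on \<Omega>" and \<nu>: "\<nu> \<in> prob_measures_on \<Omega>" and \<Omega>: "compact \<Omega>"
    and f: "\<And>x. GDERIV f x :> u x" and u: "\<And>x y. norm (u x - u y) \<le> M * norm (x - y)"
    and M: "0 \<le> M" and t: "0 \<le> t"
  shows "2 * t * ((LINT x|\<nu>. f x) - (LINT x|\<mu>. f x)) - t^2 * (LINT x|\<mu>. (norm (u x))^2)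
    \<le> (1 + 2 * t * M) * (W \<mu> \<nu>)^2"
proof -
  have fc: "continuous_on UNIV f"
    using gradient_has_derivative[OF f] by (intro has_derivative_continuous_on)
  have uc: "continuous_on UNIV u"
    using u by (intro bounded_lipschitz_continuous[of u M]) (simp add: dist_norm)
  then have hc: "continuous_on UNIV (\<lambda>x. (norm (u x))^2)" by (intro continuous_intros)
  let ?q = "2 * t * ((LINT x|\<nu>. f x) - (LINT x|\<mu>. f x)) - t^2 * (LINT x|\<mu>. (norm (u x))^2)"
  have k: "0 < 1 + 2 * t * M" using M t by (simp add: add_pos_nonneg)
  have "?q / (1 + 2 * t * M) \<le> (W \<mu> \<nu>)^2"
  proof (rule W_sq_ge[OF \<mu> \<nu> \<Omega>])
    fix \<pi> assume \<pi>: "\<pi> \<in> couplings \<mu> \<nu>"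
    note fa = coupling_facts[OF \<pi> \<mu> \<nu> \<Omega>] and c = coupling_integral_diff[OF \<pi> \<mu> \<nu> \<Omega> fc]
      and d = coupling_integral_diff[OF \<pi> \<mu> \<nu> \<Omega> hc]
    have "?q = (LINT z|\<pi>. 2 * t * (f (snd z) - f (fst z)) - t^2 * (norm (u (fst z)))^2)"
      using c d by simp
    also have "\<dots> \<le> (LINT z|\<pi>. (1 + 2 * t * M) * (norm (fst z - snd z))^2)"
    proof (intro integral_mono)
      show "integrable \<pi> (\<lambda>z. 2 * t * (f (snd z) - f (fst z)) - t^2 * (norm (u (fst z)))^2)"
        using c d by simp
      show "integrable \<pi> (\<lambda>z. (1 + 2 * t * M) * (norm (fst z - snd z))^2)" using fa by simp
      fix z :: "'a \<times> 'a"
      define x y where "x = fst z" and "y = snd z"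
      have "f y - f x \<le> u x \<bullet> (y - x) + M * (norm (y - x))^2"
        using gradient_taylor[OF f u, of y x] by linarith
      then have 1: "2 * t * (f y - f x) \<le> 2 * t * (u x \<bullet> (y - x) + M * (norm (y - x))^2)"
        using t by (intro mult_left_mono) auto
      have "0 \<le> (norm ((y - x) - t *\<^sub>R u x))^2" by simp
      also have "\<dots> = (norm (y - x))^2 - 2 * t * (u x \<bullet> (y - x)) + t^2 * (norm (u x))^2"
        unfolding power2_norm_eq_inner by (simp add: inner_diff_left inner_diff_right inner_commute power2_eq_square algebra_simps)
      finally have "2 * t * (f y - f x) - t^2 * (norm (u x))^2 \<le> (1 + 2 * t * M) * (norm (y - x))^2"
        using 1 by (simp add: algebra_simps)
      then show "2 * t * (f (snd z) - f (fst z)) - t^2 * (norm (u (fst z)))^2 \<le> (1 + 2 * t * M) * (norm (fst z - snd z))^2"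
        by (simp add: x_def y_def norm_minus_commute)
    qed
    also have "\<dots> = (1 + 2 * t * M) * (LINT z|\<pi>. (norm (fst z - snd z))^2)" by simp
    finally show "?q / (1 + 2 * t * M) \<le> (LINT z|\<pi>. (norm (fst z - snd z))^2)"
      using k by (simp only: pos_divide_le_eq mult.commute)
  qed
  then show ?thesis using k by (simp add: field_simps)
qed

lemma distr_pair_coupling:
  fixes F G :: "'a::euclidean_space \<Rightarrow> 'a"
  assumes s: "sets M = sets borel" and F: "F \<in> borel_measurable borel" and G: "G \<in> borel_measurable borel"
  shows "distr M borel (\<lambda>x. (F x, G x)) \<in> couplings (distr M borel F) (distr M borel G)"
    "(LINT z|distr M borel (\<lambda>x. (F x, G x)). (norm (fst z - snd z))^2) = (LINT x|M. (norm (F x - G x))^2)"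
proof -
  have FM: "F \<in> borel_measurable M" "G \<in> borel_measurable M"
    using F G measurable_cong_sets[OF s refl] by auto
  have p: "(\<lambda>x. (F x, G x)) \<in> borel_measurable M" using FM by (rule borel_measurable_Pair)
  have [measurable]: "(fst :: 'a \<times> 'a \<Rightarrow> 'a) \<in> borel_measurable borel" "(snd :: 'a \<times> 'a \<Rightarrow> 'a) \<in> borel_measurable borel"
    by (intro borel_measurable_continuous_onI continuous_intros)+
  show "distr M borel (\<lambda>x. (F x, G x)) \<in> couplings (distr M borel F) (distr M borel G)"
    using p by (simp add: couplings_def distr_distr comp_def)
  show "(LINT z|distr M borel (\<lambda>x. (F x, G x)). (norm (fst z - snd z))^2) = (LINT x|M. (norm (F x - G x))^2)"
    by (subst integral_distr[OF p]) auto
qed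

lemma W_sq_le_maps:
  fixes F G :: "'a::euclidean_space \<Rightarrow> 'a"
  assumes "sets M = sets borel" "F \<in> borel_measurable borel" "G \<in> borel_measurable borel" "compact \<Omega>"
    and "distr M borel F \<in> prob_measures_on \<Omega>" "distr M borel G \<in> prob_measures_on \<Omega>"
  shows "(W (distr M borel F) (distr M borel G))^2 \<le> (LINT x|M. (norm (F x - G x))^2)"
  using W_sq_le[OF distr_pair_coupling(1)[OF assms(1-3)] assms(5,6,4)] distr_pair_coupling(2)[OF assms(1-3)]
  by simp


section \<open>Flows of time-dependent fields\<close>

text \<open>For a non-measurable map \<^const>\<open>distr\<close> gives junk: some set and its complement both have mass \<open>0\<close>.\<close>

lemma distr_prob_imp_measurable:
  fixes f :: "'a \<Rightarrow> 'b::topological_space"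
  assumes p: "prob_space (distr M borel f)"
  shows "f \<in> borel_measurable M"
proof (rule borel_measurableI)
  let ?\<mu> = "\<lambda>A. emeasure M (f -` A \<inter> space M)"
  interpret D: prob_space "distr M borel f" by (rule p)
  have conv: "emeasure (distr M borel f) A = (if A \<in> sets borel \<and> measure_space UNIV (sets (borel :: 'b measure)) ?\<mu> then ?\<mu> A else 0)" for A
    unfolding distr_def using sets.sigma_sets_eq[of "borel :: 'b measure"]
    by (subst emeasure_measure_of_conv) auto
  \<comment> \<open>Total mass 1 excludes the default case of \<open>distr\<close>, in which every
    set has mass 0, so the masses are those of the preimages.\<close>
  have one: "emeasure (distr M borel f) UNIV = 1" using D.emeasure_space_1 by simp
  then have em: "emeasure (distr M borel f) A = ?\<mu> A" if "A \<in> sets borel" for A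
    using conv[of UNIV] conv[of A] that by (auto split: if_splits)
  fix S :: "'b set" assume "open S"
  then have S: "S \<in> sets borel" by simp
  show "f -` S \<inter> space M \<in> sets M"
  proof (rule ccontr)
    assume n: "f -` S \<inter> space M \<notin> sets M"
    have "f -` (- S) \<inter> space M \<notin> sets M"
    proof
      assume "f -` (- S) \<inter> space M \<in> sets M"
      then have "space M - (f -` (- S) \<inter> space M) \<in> sets M" by simp
      moreover have "space M - (f -` (- S) \<inter> space M) = f -` S \<inter> space M" by blast
      ultimately show False using n by simp
    qed
    then have "emeasure (distr M borel f) S = 0" "emeasure (distr M borel f) (- S) = 0"
      using n em[OF S] em[of "- S"] S emeasure_notin_sets[of _ M] by auto
    moreover have "emeasure (distr M borel f) S + emeasure (distr M borel f) (- S) = emeasure (distr M borel f) UNIV"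
      using S by (subst plus_emeasure) auto
    ultimately show False using one by simp
  qed
qed

text \<open>The modulus of continuity in time is uniform in space, so the increment splits into a
  change of time at a moving point, which is controlled uniformly, and a change of point at a fixed
  time.\<close>

lemma continuous_on_Lipschitz_in_time:
  fixes v :: "real \<Rightarrow> 'a::metric_space \<Rightarrow> 'b::real_normed_vector"
  assumes time: "\<And>s t x. s \<in> I \<Longrightarrow> t \<in> I \<Longrightarrow> norm (v s x - v t x) \<le> \<kappa> * \<bar>s - t\<bar>"
    and cont: "\<And>t. t \<in> I \<Longrightarrow> continuous_on X (v t)"
  shows "continuous_on (I \<times> X) (\<lambda>(t, x). v t x)"
  unfolding continuous_on_def
proof safe
  fix t x assume t: "t \<in> I" and x: "x \<in> X"
  let ?F = "at (t, x) within I \<times> X"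
  have ev: "\<forall>\<^sub>F z in ?F. z \<in> I \<times> X" by (simp add: eventually_at_filter)
  have f1: "filterlim fst (nhds t) ?F" and f2: "filterlim snd (nhds x) ?F"
    using tendsto_fst[OF tendsto_ident_at[of "(t, x)" "I \<times> X"]] tendsto_snd[OF tendsto_ident_at[of "(t, x)" "I \<times> X"]] by auto
  have "((\<lambda>z. v (fst z) (snd z) - v t (snd z)) \<longlongrightarrow> 0) ?F"
  proof (rule Lim_null_comparison)
    show "\<forall>\<^sub>F z in ?F. norm (v (fst z) (snd z) - v t (snd z)) \<le> \<kappa> * \<bar>fst z - t\<bar>"
      using ev by eventually_elim (use time t in auto)
    have "((\<lambda>z. \<kappa> * \<bar>fst z - t\<bar>) \<longlongrightarrow> \<kappa> * \<bar>t - t\<bar>) ?F"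
      using f1 by (intro tendsto_intros)
    then show "((\<lambda>z. \<kappa> * \<bar>fst z - t\<bar>) \<longlongrightarrow> 0) ?F" by simp
  qed
  moreover have "((\<lambda>z. v t (snd z)) \<longlongrightarrow> v t x) ?F"
    by (rule continuous_on_tendsto_compose[OF cont[OF t] f2 x]) (rule eventually_mono[OF ev], auto)
  ultimately have "((\<lambda>z. v (fst z) (snd z) - v t (snd z) + v t (snd z)) \<longlongrightarrow> 0 + v t x) ?F"
    by (rule tendsto_add)
  then show "((\<lambda>(t, x). v t x) \<longlongrightarrow> v t x) ?F" by (simp add: case_prod_unfold)
qed

lemma bound_by_derivative:
  fixes f :: "real \<Rightarrow> 'a::real_normed_vector"
  assumes t: "t \<in> {0..1}" and der: "\<And>s. s \<in> {0..1} \<Longrightarrow> (f has_vector_derivative f' s) (at s within {0..1})"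
    and bd: "\<And>s. s \<in> {0..t} \<Longrightarrow> norm (f' s) \<le> c"
  shows "norm (f t - f 0) \<le> c * t"
proof -
  have "norm (f t - f 0) \<le> c * norm (t - 0)"
  proof (rule differentiable_bound[of "{0..t}" f "\<lambda>s h. h *\<^sub>R f' s"])
    show "(f has_derivative (\<lambda>h. h *\<^sub>R f' s)) (at s within {0..t})" if "s \<in> {0..t}" for s
      using has_vector_derivative_within_subset[OF der, of s "{0..t}"] that t
      by (simp add: has_vector_derivative_def)
    show "onorm (\<lambda>h. h *\<^sub>R f' s) \<le> c" if "s \<in> {0..t}" for s
      using bd[OF that] by (intro onorm_le) (simp add: mult.commute[of c] mult_left_mono)
  qed (use t in auto)
  then show ?thesis using t by simp
qed

text \<open>Abstract form of the field along a ray: \<beta> controls its size and its spatial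
  Lipschitz constant at time 0, \<kappa> its variation in time. In use, \<beta> is of the order of
  the speed and \<kappa> of its square. That every push-forward is a probability measure is the
  source of measurability of \<open>\<phi> t\<close>, about which \<open>flow_solution\<close> is
  silent.\<close>

locale bounded_flow =
  fixes \<Omega> :: "'a::euclidean_space set" and \<mu> :: "'a measure" and v \<phi> :: "real \<Rightarrow> 'a \<Rightarrow> 'a"
    and \<beta> \<kappa> :: real
  assumes compact_\<Omega>: "compact \<Omega>" and \<mu>: "\<mu> \<in> prob_measures_on \<Omega>"
    and \<beta>: "0 \<le> \<beta>" and \<kappa>: "0 \<le> \<kappa>"
    and v0_bound: "\<And>x. norm (v 0 x) \<le> \<beta>"
    and v0_lipschitz: "\<And>x y. norm (v 0 x - v 0 y) \<le> \<beta> * norm (x - y)"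
    and v_time: "\<And>s t x. s \<in> {0..1} \<Longrightarrow> t \<in> {0..1} \<Longrightarrow> norm (v s x - v t x) \<le> \<kappa> * \<bar>s - t\<bar>"
    and v_space: "\<And>t. t \<in> {0..1} \<Longrightarrow> continuous_on UNIV (v t)"
    and flow: "flow_solution \<Omega> v \<phi>"
    and push: "\<And>t. t \<in> {0..1} \<Longrightarrow> distr (restrict_space \<mu> \<Omega>) borel (\<phi> t) \<in> prob_measures_on \<Omega>"
begin

text \<open>The identity off \<Omega>, a null set, turns the flow into a Borel map of the whole
  space, so that push-forwards need no \<open>restrict_space\<close>.\<close>

definition \<psi> :: "real \<Rightarrow> 'a \<Rightarrow> 'a"
  where "\<psi> t x = (if x \<in> \<Omega> then \<phi> t x else x)"

text \<open>Bound for how fast the field seen by a moving particle changes: \<kappa> from time, and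
  the spatial Lipschitz constant \<beta> times the particle speed \<beta> + \<kappa>.\<close>

definition rate :: real
  where "rate = \<kappa> + \<beta> * (\<beta> + \<kappa>)"

lemma rate_nonneg: "0 \<le> rate"
  using \<beta> \<kappa> by (simp add: rate_def)

lemma closed_\<Omega>: "closed \<Omega>"
  using compact_\<Omega> by (rule compact_imp_closed)

lemmas \<mu>D = prob_measures_onD[OF \<mu> closed_\<Omega>]

sublocale prob_space \<mu>
  by (rule \<mu>D(1))

lemma measurable_\<mu>: "borel_measurable \<mu> = borel_measurable borel"
  by (rule measurable_cong_sets[OF \<mu>D(2) refl])

lemma v_joint: "continuous_on ({0..1} \<times> UNIV) (\<lambda>(t, x). v t x)"
  by (rule continuous_on_Lipschitz_in_time[OF v_time v_space])

lemma \<psi>_measurable: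
  assumes t: "t \<in> {0..1}"
  shows "\<psi> t \<in> borel_measurable borel"
proof -
  have "\<phi> t \<in> borel_measurable (restrict_space \<mu> \<Omega>)"
    using prob_measures_onD(1)[OF push[OF t] closed_\<Omega>] by (rule distr_prob_imp_measurable)
  then have "(\<lambda>x. if x \<in> \<Omega> then \<phi> t x else x) \<in> borel_measurable \<mu>"
    using closed_\<Omega> \<mu>D(2)
    by (subst measurable_If_restrict_space_iff) (auto simp: \<mu>D(4) measurable_\<mu> intro!: measurable_restrict_space1)
  then show ?thesis unfolding \<psi>_def[abs_def] measurable_\<mu> .
qed

lemma push_eq:
  assumes t: "t \<in> {0..1}"
  shows "distr (restrict_space \<mu> \<Omega>) borel (\<phi> t) = distr \<mu> borel (\<psi> t)"
proof (rule measure_eqI)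
  have \<phi>m: "\<phi> t \<in> borel_measurable (restrict_space \<mu> \<Omega>)"
    using prob_measures_onD(1)[OF push[OF t] closed_\<Omega>] by (rule distr_prob_imp_measurable)
  have \<Omega>s: "\<Omega> \<inter> space \<mu> \<in> sets \<mu>" using closed_\<Omega> \<mu>D by simp
  have \<psi>m: "\<psi> t \<in> borel_measurable \<mu>" unfolding measurable_\<mu> by (rule \<psi>_measurable[OF t])
  fix X assume "X \<in> sets (distr (restrict_space \<mu> \<Omega>) borel (\<phi> t))"
  then have X: "X \<in> sets borel" by simp
  have sp: "space (restrict_space \<mu> \<Omega>) = \<Omega>" by (simp add: space_restrict_space \<mu>D(4))
  have "emeasure (distr (restrict_space \<mu> \<Omega>) borel (\<phi> t)) X = emeasure (restrict_space \<mu> \<Omega>) (\<phi> t -` X \<inter> \<Omega>)"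
    using \<phi>m X by (simp add: emeasure_distr sp)
  also have "\<dots> = emeasure \<mu> (\<phi> t -` X \<inter> \<Omega>)"
    using \<Omega>s by (rule emeasure_restrict_space) auto
  also have "\<phi> t -` X \<inter> \<Omega> = \<psi> t -` X \<inter> \<Omega>" by (auto simp: \<psi>_def)
  also have "emeasure \<mu> (\<psi> t -` X \<inter> \<Omega>) = emeasure \<mu> (\<psi> t -` X \<inter> space \<mu>)"
  proof (rule emeasure_eq_AE)
    show "AE x in \<mu>. (x \<in> \<psi> t -` X \<inter> \<Omega>) = (x \<in> \<psi> t -` X \<inter> space \<mu>)"
      using \<mu>D(3) by eventually_elim (simp add: \<mu>D(4))
    show "\<psi> t -` X \<inter> space \<mu> \<in> sets \<mu>" using \<psi>m X by (rule measurable_sets)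
    then show "\<psi> t -` X \<inter> \<Omega> \<in> sets \<mu>"
      using sets.Int[of _ \<mu> \<Omega>] \<Omega>s by (simp add: \<mu>D(4))
  qed
  also have "\<dots> = emeasure (distr \<mu> borel (\<psi> t)) X"
    using \<psi>m X by (simp add: emeasure_distr)
  finally show "emeasure (distr (restrict_space \<mu> \<Omega>) borel (\<phi> t)) X = emeasure (distr \<mu> borel (\<psi> t)) X" .
qed simp

lemma push_\<psi>: "t \<in> {0..1} \<Longrightarrow> distr \<mu> borel (\<psi> t) \<in> prob_measures_on \<Omega>"
  using push push_eq by simp

lemma \<psi>_0 [simp]: "\<psi> 0 x = x"
  using flow by (simp add: \<psi>_def flow_solution_def)

text \<open>Joint continuity of \<open>v\<close> and continuity of the trajectory make the right
  side continuous in time, so the almost-everywhere equation holds everywhere.\<close>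

lemma \<psi>_derivative:
  assumes x: "x \<in> \<Omega>" and t: "t \<in> {0..1}"
  shows "((\<lambda>s. \<psi> s x) has_vector_derivative v t (\<psi> t x)) (at t within {0..1})"
proof -
  have "\<psi> s x = \<phi> s x" for s using x by (simp add: \<psi>_def)
  moreover obtain L where L: "L-lipschitz_on {0..1} (\<lambda>t. \<phi> t x)"
    using flow x by (auto simp: flow_solution_def)
  moreover have "AE t in lborel. t \<in> {0..1} \<longrightarrow> ((\<lambda>s. \<phi> s x) has_vector_derivative v t (\<phi> t x)) (at t within {0..1})"
    using flow x by (auto simp: flow_solution_def)
  moreover have "continuous_on {0..1} (\<lambda>t. v t (\<phi> t x))"
  proof -
    have "continuous_on {0..1} (\<lambda>t. (t, \<phi> t x))"
      using lipschitz_on_continuous_on[OF L] by (intro continuous_intros)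
    then have "continuous_on {0..1} (\<lambda>t. (\<lambda>(t, x). v t x) (t, \<phi> t x))"
      by (rule continuous_on_compose2[OF v_joint]) auto
    then show ?thesis by simp
  qed
  ultimately show ?thesis
    using lipschitz_ae_derivative_continuous[of L "\<lambda>t. \<phi> t x" "\<lambda>t. v t (\<phi> t x)" t] t by simp
qed

lemma v_bound: "t \<in> {0..1} \<Longrightarrow> norm (v t x) \<le> \<beta> + \<kappa>"
proof -
  assume t: "t \<in> {0..1}"
  have "norm (v t x) \<le> norm (v 0 x) + norm (v t x - v 0 x)" by (metis add.commute norm_triangle_sub)
  also have "\<dots> \<le> \<beta> + \<kappa> * t" using v0_bound[of x] v_time[of t 0 x] t by simp
  also have "\<dots> \<le> \<beta> + \<kappa>" using \<kappa> t by (simp add: mult_left_le)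
  finally show ?thesis .
qed

lemma \<psi>_continuous: "x \<in> \<Omega> \<Longrightarrow> continuous_on {0..1} (\<lambda>t. \<psi> t x)"
  using \<psi>_derivative by (rule continuous_on_vector_derivative)

lemma \<psi>_displacement:
  assumes x: "x \<in> \<Omega>" and t: "t \<in> {0..1}"
  shows "norm (\<psi> t x - x) \<le> (\<beta> + \<kappa>) * t"
  using bound_by_derivative[OF t \<psi>_derivative[OF x], where c = "\<beta> + \<kappa>"] v_bound t by simp

lemma v_along_flow:
  assumes x: "x \<in> \<Omega>" and t: "t \<in> {0..1}"
  shows "norm (v t (\<psi> t x) - v 0 x) \<le> rate * t"
proof -
  have "norm (v t (\<psi> t x) - v 0 x) \<le> norm (v t (\<psi> t x) - v 0 (\<psi> t x)) + norm (v 0 (\<psi> t x) - v 0 x)"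
    using norm_triangle_ineq[of "v t (\<psi> t x) - v 0 (\<psi> t x)" "v 0 (\<psi> t x) - v 0 x"] by simp
  also have "\<dots> \<le> \<kappa> * t + \<beta> * norm (\<psi> t x - x)"
    using v_time[of t 0] v0_lipschitz t by (intro add_mono) auto
  also have "\<dots> \<le> \<kappa> * t + \<beta> * ((\<beta> + \<kappa>) * t)"
    using \<psi>_displacement[OF x t] \<beta> by (intro add_left_mono mult_left_mono)
  finally show ?thesis by (simp add: rate_def algebra_simps)
qed

lemma \<psi>_expansion:
  assumes x: "x \<in> \<Omega>" and t: "t \<in> {0..1}"
  shows "norm (\<psi> t x - x - t *\<^sub>R v 0 x) \<le> rate * t^2"
proof -
  have "norm ((\<psi> t x - t *\<^sub>R v 0 x) - (\<psi> 0 x - 0 *\<^sub>R v 0 x)) \<le> (rate * t) * t"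
  proof (rule bound_by_derivative[OF t])
    show "((\<lambda>s. \<psi> s x - s *\<^sub>R v 0 x) has_vector_derivative (v s (\<psi> s x) - v 0 x)) (at s within {0..1})"
      if "s \<in> {0..1}" for s
      using \<psi>_derivative[OF x that] by (auto intro!: derivative_eq_intros)
    show "norm (v s (\<psi> s x) - v 0 x) \<le> rate * t" if "s \<in> {0..t}" for s
    proof -
      have "norm (v s (\<psi> s x) - v 0 x) \<le> rate * s" using that t by (intro v_along_flow x) auto
      also have "\<dots> \<le> rate * t" using that rate_nonneg by (intro mult_left_mono) auto
      finally show ?thesis .
    qed
  qed
  then show ?thesis by (simp add: power2_eq_square algebra_simps)
qed

text \<open>The push-forwards give a null set for each time separately. Countably many of them
  settle the rational times; continuity of trajectories and closedness of \<Omega> settle the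
  others, which yields one null set for all times.\<close>

lemma AE_\<psi>_in_\<Omega>: "AE x in \<mu>. x \<in> \<Omega> \<and> (\<forall>t\<in>{0..1}. \<psi> t x \<in> \<Omega>)"
proof -
  have "AE x in \<mu>. \<psi> t x \<in> \<Omega>" if t: "t \<in> {0..1}" for t
  proof -
    have "\<psi> t \<in> borel_measurable \<mu>" unfolding measurable_\<mu> by (rule \<psi>_measurable[OF t])
    then show ?thesis
      using prob_measures_onD(3)[OF push_\<psi>[OF t] closed_\<Omega>] by (rule AE_distrD)
  qed
  then have "AE x in \<mu>. \<forall>t\<in>\<rat> \<inter> {0..1}. \<psi> t x \<in> \<Omega>"
    using countable_rat by (subst AE_ball_countable) auto
  with \<mu>D(3) show ?thesis
  proof eventually_elim
    case (elim x)
    have "\<psi> t x \<in> \<Omega>" if t: "t \<in> {0..1}" for t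
    proof -
      have "t \<in> closure (\<rat> \<inter> {0..1})"
        unfolding closure_approachable
      proof (intro allI impI)
        fix e :: real assume "0 < e"
        then have "max 0 (t - e) < min 1 (t + e)" using t by auto
        from Rats_dense_in_real[OF this] obtain r where "r \<in> \<rat>" "max 0 (t - e) < r" "r < min 1 (t + e)" by blast
        then show "\<exists>y\<in>\<rat> \<inter> {0..1}. dist y t < e"
          by (intro bexI[of _ r]) (auto simp: dist_real_def)
      qed
      moreover have "(\<lambda>t. \<psi> t x) ` closure (\<rat> \<inter> {0..1}) \<subseteq> \<Omega>"
      proof (rule image_closure_subset[OF _ closed_\<Omega>])
        have "closure (\<rat> \<inter> {0..1::real}) \<subseteq> {0..1}" by (rule closure_minimal) auto
        then show "continuous_on (closure (\<rat> \<inter> {0..1})) (\<lambda>t. \<psi> t x)"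
          using \<psi>_continuous elim continuous_on_subset by blast
        show "(\<lambda>t. \<psi> t x) ` (\<rat> \<inter> {0..1}) \<subseteq> \<Omega>" using elim by auto
      qed
      ultimately show ?thesis by blast
    qed
    then show ?case using elim by blast
  qed
qed

end


section \<open>Integrals that depend on a time parameter\<close>

lemma continuous_on_parametric_integral:
  fixes q :: "real \<Rightarrow> 'a \<Rightarrow> 'b::{banach, second_countable_topology}"
  assumes M: "finite_measure M"
    and meas: "\<And>t. t \<in> I \<Longrightarrow> q t \<in> borel_measurable M"
    and ae: "AE x in M. continuous_on I (\<lambda>t. q t x) \<and> (\<forall>t\<in>I. norm (q t x) \<le> C)"
  shows "continuous_on I (\<lambda>t. LINT x|M. q t x)"
  unfolding continuous_on_def tendsto_at_iff_sequentially
proof (intro ballI allI impI)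
  interpret finite_measure M by (rule M)
  fix t X assume t: "t \<in> I" and X: "\<forall>i. X i \<in> I - {t}" "X \<longlonglongrightarrow> t"
  have "(\<lambda>i. LINT x|M. q (X i) x) \<longlonglongrightarrow> (LINT x|M. q t x)"
  proof (rule integral_dominated_convergence[where w = "\<lambda>_. C"])
    show "AE x in M. (\<lambda>i. q (X i) x) \<longlonglongrightarrow> q t x"
      using ae
    proof eventually_elim
      case (elim x)
      then show ?case
        using X t by (intro continuous_on_tendsto_compose[of I "\<lambda>t. q t x" X t]) auto
    qed
    show "AE x in M. norm (q (X i) x) \<le> C" for i
      using ae by eventually_elim (use X in auto)
  qed (use t X meas in auto)
  then show "((\<lambda>t. LINT x|M. q t x) \<circ> X) \<longlonglongrightarrow> (LINT x|M. q t x)" by (simp add: comp_def)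
qed

text \<open>Dominated convergence of the difference quotients, which the mean value inequality
  bounds by \<open>C\<close>. That inequality uses the derivative at all intermediate times for the
  same \<open>x\<close>, hence the quantifier over \<open>t\<close> inside
  \<open>AE\<close>.\<close>

lemma has_derivative_parametric_integral:
  fixes F F' :: "real \<Rightarrow> 'a \<Rightarrow> real"
  assumes M: "finite_measure M"
    and meas: "\<And>t. t \<in> {0..1} \<Longrightarrow> F t \<in> borel_measurable M" "\<And>t. t \<in> {0..1} \<Longrightarrow> F' t \<in> borel_measurable M"
    and ae: "AE x in M. \<forall>t\<in>{0..1}. ((\<lambda>t. F t x) has_real_derivative F' t x) (at t within {0..1}) \<and>
      \<bar>F t x\<bar> \<le> C \<and> \<bar>F' t x\<bar> \<le> C"
    and t: "t \<in> {0..1}"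
  shows "((\<lambda>t. LINT x|M. F t x) has_real_derivative (LINT x|M. F' t x)) (at t within {0..1})"
  unfolding has_field_derivative_iff tendsto_at_iff_sequentially
proof (intro allI impI)
  interpret finite_measure M by (rule M)
  fix X assume X: "\<forall>i. X i \<in> {0..1} - {t}" "X \<longlonglongrightarrow> t"
  have int: "integrable M (F s)" if "s \<in> {0..1}" for s
  proof (rule integrable_const_bound)
    show "AE x in M. norm (F s x) \<le> C" using ae by eventually_elim (use that in auto)
  qed (use meas that in auto)
  have "(\<lambda>i. LINT x|M. (F (X i) x - F t x) / (X i - t)) \<longlonglongrightarrow> (LINT x|M. F' t x)"
  proof (rule integral_dominated_convergence[where w = "\<lambda>_. C"])
    show "AE x in M. (\<lambda>i. (F (X i) x - F t x) / (X i - t)) \<longlonglongrightarrow> F' t x"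
      using ae
    proof eventually_elim
      case (elim x)
      then have "((\<lambda>s. (F s x - F t x) / (s - t)) \<longlongrightarrow> F' t x) (at t within {0..1})"
        using t by (simp add: has_field_derivative_iff)
      then show ?case using X by (auto simp: tendsto_at_iff_sequentially comp_def)
    qed
    show "AE x in M. norm ((F (X i) x - F t x) / (X i - t)) \<le> C" for i
      using ae
    proof eventually_elim
      case (elim x)
      have "norm (F (X i) x - F t x) \<le> C * norm (X i - t)"
        using elim X t by (intro field_differentiable_bound[of "{0..1}" "\<lambda>s. F s x" "\<lambda>s. F' s x"]) auto
      moreover have "X i \<noteq> t" using X by blast
      ultimately show ?case by (simp add: abs_divide pos_divide_le_eq)
    qed
    show "(\<lambda>x. (F (X i) x - F t x) / (X i - t)) \<in> borel_measurable M" for i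
      using meas(1)[of "X i"] meas(1)[OF t] X by auto
  qed (use t meas in auto)
  moreover have "(LINT x|M. (F (X i) x - F t x) / (X i - t)) = ((LINT x|M. F (X i) x) - (LINT x|M. F t x)) / (X i - t)" for i
    using int[of "X i"] int[OF t] X by simp
  ultimately show "((\<lambda>s. ((LINT x|M. F s x) - (LINT x|M. F t x)) / (s - t)) \<circ> X) \<longlonglongrightarrow> (LINT x|M. F' t x)"
    by (simp only: comp_def)
qed

section \<open>The continuity equation and the energy along the flow\<close>

context bounded_flow
begin

context
  fixes \<rho> :: "real \<Rightarrow> 'a measure"
  assumes \<rho>: "\<And>t. t \<in> {0..1} \<Longrightarrow> \<rho> t = distr \<mu> borel (\<psi> t)"
begin

text \<open>Test functions are continuous only over \<Omega>. The indicator makes them Borel on the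
  whole space, which permits the change of variables back to \<mu>.\<close>

lemma set_integral_\<rho>:
  fixes q :: "real \<times> 'a \<Rightarrow> real"
  assumes q: "continuous_on ({0..1} \<times> \<Omega>) q" and t: "t \<in> {0..1}"
  shows "(\<lambda>x. indicator \<Omega> (\<psi> t x) *\<^sub>R q (t, \<psi> t x)) \<in> borel_measurable \<mu>"
    "(LINT x:\<Omega>|\<rho> t. q (t, x)) = (LINT x|\<mu>. indicator \<Omega> (\<psi> t x) *\<^sub>R q (t, \<psi> t x))"
proof -
  have "continuous_on \<Omega> (\<lambda>x. q (t, x))"
    using t by (intro continuous_on_compose2[OF q]) (auto intro!: continuous_intros)
  then have m: "(\<lambda>x. indicator \<Omega> x *\<^sub>R q (t, x)) \<in> borel_measurable borel"
    using closed_\<Omega> by (intro borel_measurable_continuous_on_indicator) auto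
  have \<psi>m: "\<psi> t \<in> borel_measurable \<mu>" unfolding measurable_\<mu> by (rule \<psi>_measurable[OF t])
  show "(\<lambda>x. indicator \<Omega> (\<psi> t x) *\<^sub>R q (t, \<psi> t x)) \<in> borel_measurable \<mu>"
    using measurable_compose[OF \<psi>m m] by simp
  show "(LINT x:\<Omega>|\<rho> t. q (t, x)) = (LINT x|\<mu>. indicator \<Omega> (\<psi> t x) *\<^sub>R q (t, \<psi> t x))"
    unfolding set_lebesgue_integral_def \<rho>[OF t] by (rule integral_distr[OF \<psi>m m])
qed

lemma continuous_bound:
  fixes q :: "real \<times> 'a \<Rightarrow> real"
  assumes q: "continuous_on ({0..1} \<times> \<Omega>) q"
  obtains C where "\<And>t x. t \<in> {0..1} \<Longrightarrow> x \<in> \<Omega> \<Longrightarrow> \<bar>q (t, x)\<bar> \<le> C"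
proof -
  have "compact ({0..1::real} \<times> \<Omega>)" using compact_\<Omega> by (intro compact_Times compact_Icc)
  then have "bounded (q ` ({0..1} \<times> \<Omega>))"
    using q by (intro compact_imp_bounded compact_continuous_image)
  then obtain C where "\<forall>y\<in>q ` ({0..1} \<times> \<Omega>). norm y \<le> C" unfolding bounded_iff by blast
  then show ?thesis by (intro that[of C]) auto
qed

lemma continuous_set_integral_\<rho>:
  fixes q :: "real \<times> 'a \<Rightarrow> real"
  assumes q: "continuous_on ({0..1} \<times> \<Omega>) q"
  shows "continuous_on {0..1} (\<lambda>t. LINT x:\<Omega>|\<rho> t. q (t, x))"
proof -
  obtain C where C: "\<And>t x. t \<in> {0..1} \<Longrightarrow> x \<in> \<Omega> \<Longrightarrow> \<bar>q (t, x)\<bar> \<le> C" using q by (rule continuous_bound) blast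
  have "continuous_on {0..1} (\<lambda>t. LINT x|\<mu>. indicator \<Omega> (\<psi> t x) *\<^sub>R q (t, \<psi> t x))"
  proof (rule continuous_on_parametric_integral[where C = C])
    show "finite_measure \<mu>" by unfold_locales
    show "AE x in \<mu>. continuous_on {0..1} (\<lambda>t. indicator \<Omega> (\<psi> t x) *\<^sub>R q (t, \<psi> t x)) \<and>
        (\<forall>t\<in>{0..1}. norm (indicator \<Omega> (\<psi> t x) *\<^sub>R q (t, \<psi> t x)) \<le> C)"
      using AE_\<psi>_in_\<Omega>
    proof eventually_elim
      case (elim x)
      have "continuous_on {0..1} (\<lambda>t. q (t, \<psi> t x))"
        using elim \<psi>_continuous[of x] by (intro continuous_on_compose2[OF q]) (auto intro!: continuous_intros)
      then have "continuous_on {0..1} (\<lambda>t. indicator \<Omega> (\<psi> t x) *\<^sub>R q (t, \<psi> t x))"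
        by (rule continuous_on_eq) (use elim in auto)
      then show ?case using elim C by auto
    qed
  qed (rule set_integral_\<rho>(1)[OF q])
  then show ?thesis
    by (rule continuous_on_eq) (simp add: set_integral_\<rho>(2)[OF q])
qed

text \<open>Chain rule along almost every trajectory, followed by differentiation under the
  integral. The trajectory has to stay in \<Omega> for all times, because a test function is
  differentiable only within \<open>{0..1} \<times> \<Omega>\<close>.\<close>

lemma test_function_along_flow:
  assumes tf: "C1_test_function \<Omega> f ft G" and t: "t \<in> {0..1}"
  shows "((\<lambda>t. LINT x:\<Omega>|\<rho> t. f (t, x)) has_real_derivative
    (LINT x:\<Omega>|\<rho> t. ft (t, x)) + (LINT x:\<Omega>|\<rho> t. G (t, x) \<bullet> v t x)) (at t within {0..1})"
proof -
  have ft: "continuous_on ({0..1} \<times> \<Omega>) ft" and G: "continuous_on ({0..1} \<times> \<Omega>) G"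
    and df: "\<And>z. z \<in> {0..1} \<times> \<Omega> \<Longrightarrow> (f has_derivative (\<lambda>h. fst h * ft z + G z \<bullet> snd h)) (at z within {0..1} \<times> \<Omega>)"
    using tf by (auto simp: C1_test_function_def)
  have f: "continuous_on ({0..1} \<times> \<Omega>) f" using df by (rule has_derivative_continuous_on)
  have vc: "continuous_on ({0..1} \<times> \<Omega>) (\<lambda>z. v (fst z) (snd z))"
    using continuous_on_subset[OF v_joint, of "{0..1} \<times> \<Omega>"] by (auto simp: case_prod_unfold)
  define q where "q z = ft z + G z \<bullet> v (fst z) (snd z)" for z
  have Gv: "continuous_on ({0..1} \<times> \<Omega>) (\<lambda>z. G z \<bullet> v (fst z) (snd z))"
    by (intro continuous_intros G vc)
  then have q: "continuous_on ({0..1} \<times> \<Omega>) q" unfolding q_def by (rule continuous_on_add[OF ft])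
  obtain C1 where C1: "\<And>t x. t \<in> {0..1} \<Longrightarrow> x \<in> \<Omega> \<Longrightarrow> \<bar>f (t, x)\<bar> \<le> C1" using f by (rule continuous_bound) blast
  obtain C2 where C2: "\<And>t x. t \<in> {0..1} \<Longrightarrow> x \<in> \<Omega> \<Longrightarrow> \<bar>q (t, x)\<bar> \<le> C2" using q by (rule continuous_bound) blast
  let ?I = "\<lambda>(h :: real \<times> 'a \<Rightarrow> real) t x. indicator \<Omega> (\<psi> t x) *\<^sub>R h (t, \<psi> t x)"
  have "((\<lambda>t. LINT x|\<mu>. ?I f t x) has_real_derivative (LINT x|\<mu>. ?I q t x)) (at t within {0..1})"
  proof (rule has_derivative_parametric_integral[where C = "max C1 C2", OF _ set_integral_\<rho>(1)[OF f] set_integral_\<rho>(1)[OF q] _ t])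
    show "finite_measure \<mu>" by unfold_locales
    show "AE x in \<mu>. \<forall>t\<in>{0..1}. ((\<lambda>t. ?I f t x) has_real_derivative ?I q t x) (at t within {0..1}) \<and>
        \<bar>?I f t x\<bar> \<le> max C1 C2 \<and> \<bar>?I q t x\<bar> \<le> max C1 C2"
      using AE_\<psi>_in_\<Omega>
    proof eventually_elim
      case (elim x)
      show ?case
      proof (intro ballI conjI)
        fix t :: real assume t: "t \<in> {0..1}"
        show "\<bar>?I f t x\<bar> \<le> max C1 C2" "\<bar>?I q t x\<bar> \<le> max C1 C2"
          using elim C1[OF t, of "\<psi> t x"] C2[OF t, of "\<psi> t x"] t by auto
        let ?z = "\<lambda>s. (s, \<psi> s x)"
        have z: "(?z has_derivative (\<lambda>h. (h, h *\<^sub>R v t (\<psi> t x)))) (at t within {0..1})"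
          using \<psi>_derivative[of x t] elim t by (auto simp: has_vector_derivative_def intro!: derivative_intros)
        have img: "?z ` {0..1} \<subseteq> {0..1} \<times> \<Omega>" using elim by auto
        then have "?z t \<in> {0..1} \<times> \<Omega>" using t by blast
        from has_derivative_in_compose2[OF df img t z]
        have "((\<lambda>s. f (?z s)) has_derivative (\<lambda>h. h * ft (?z t) + G (?z t) \<bullet> (h *\<^sub>R v t (\<psi> t x)))) (at t within {0..1})"
          by simp
        then have "((\<lambda>s. f (?z s)) has_real_derivative q (?z t)) (at t within {0..1})"
          unfolding has_field_derivative_def
          by (rule has_derivative_eq_rhs) (auto simp: q_def fun_eq_iff algebra_simps)
        then have "((\<lambda>t. ?I f t x) has_real_derivative q (?z t)) (at t within {0..1})"
          by (rule has_field_derivative_transform_within[OF _ zero_less_one t]) (use elim in auto)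
        then show "((\<lambda>t. ?I f t x) has_real_derivative ?I q t x) (at t within {0..1})"
          using elim t by simp
      qed
    qed
  qed
  then have "((\<lambda>t. LINT x:\<Omega>|\<rho> t. f (t, x)) has_real_derivative (LINT x|\<mu>. ?I q t x)) (at t within {0..1})"
    by (rule has_field_derivative_transform_within[OF _ zero_less_one t]) (simp add: set_integral_\<rho>(2)[OF f])
  moreover have "(LINT x|\<mu>. ?I q t x) = (LINT x:\<Omega>|\<rho> t. ft (t, x)) + (LINT x:\<Omega>|\<rho> t. G (t, x) \<bullet> v t x)"
  proof -
    have int: "integrable \<mu> (?I h t)" if h: "continuous_on ({0..1} \<times> \<Omega>) h" for h
    proof -
      obtain C where C: "\<And>t x. t \<in> {0..1} \<Longrightarrow> x \<in> \<Omega> \<Longrightarrow> \<bar>h (t, x)\<bar> \<le> C" using h by (rule continuous_bound) blast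
      show ?thesis
      proof (rule integrable_const_bound)
        show "AE x in \<mu>. norm (?I h t x) \<le> C"
          using AE_\<psi>_in_\<Omega> by eventually_elim (use C t in auto)
      qed (rule set_integral_\<rho>(1)[OF h t])
    qed
    have "(LINT x|\<mu>. ?I q t x) = (LINT x|\<mu>. ?I ft t x + ?I (\<lambda>z. G z \<bullet> v (fst z) (snd z)) t x)"
      by (simp add: q_def algebra_simps)
    also have "\<dots> = (LINT x|\<mu>. ?I ft t x) + (LINT x|\<mu>. ?I (\<lambda>z. G z \<bullet> v (fst z) (snd z)) t x)"
      using int[OF ft] int[OF Gv] by (rule Bochner_Integration.integral_add)
    finally show ?thesis
      using set_integral_\<rho>(2)[OF ft t] set_integral_\<rho>(2)[OF Gv t] by simp
  qed
  ultimately show ?thesis by simp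
qed

text \<open>\<open>CE\<close> asks for joint Borel measurability over all real times, whereas
  \<open>v\<close> is controlled only on the unit interval.\<close>

definition vel :: "real \<Rightarrow> 'a \<Rightarrow> 'a"
  where "vel t x = (if t \<in> {0..1} then v t x else 0)"

lemma vel_CE: "vel \<in> CE \<Omega> \<rho>"
  unfolding CE_def mem_Collect_eq
proof (intro conjI ballI allI impI)
  have "(\<lambda>z. if z \<in> {0..1} \<times> UNIV then (\<lambda>(t, x). v t x) z else 0) \<in> borel_measurable borel"
    using v_joint by (intro borel_measurable_continuous_on_if borel_closed closed_Times) auto
  moreover have "(\<lambda>z. if z \<in> {0..1} \<times> UNIV then (\<lambda>(t, x). v t x) z else 0) = (\<lambda>(t, x). vel t x)"
    by (auto simp: vel_def fun_eq_iff)
  ultimately show "(\<lambda>(t, x). vel t x) \<in> borel_measurable borel" by simp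
  fix t :: real assume t: "t \<in> {0..1}"
  then have "continuous_on UNIV (\<lambda>x. (norm (vel t x))^2)"
    using v_space[OF t] by (auto simp: vel_def intro!: continuous_intros)
  then show "integrable (\<rho> t) (\<lambda>x. (norm (vel t x))^2)"
    using integrable_continuous_prob_measure[OF push_\<psi>[OF t] compact_\<Omega>] \<rho>[OF t] by simp
next
  fix f ft :: "real \<times> 'a \<Rightarrow> real" and G assume tf: "C1_test_function \<Omega> f ft G"
  have ft: "continuous_on ({0..1} \<times> \<Omega>) ft" and G: "continuous_on ({0..1} \<times> \<Omega>) G"
    using tf by (auto simp: C1_test_function_def)
  let ?a = "\<lambda>t. LINT x:\<Omega>|\<rho> t. ft (t, x)" and ?b = "\<lambda>t. LINT x:\<Omega>|\<rho> t. G (t, x) \<bullet> v t x"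
    and ?b' = "\<lambda>t. LINT x:\<Omega>|\<rho> t. G (t, x) \<bullet> vel t x"
  have beq: "?b' t = ?b t" if "t \<in> {0..1}" for t using that by (simp add: vel_def)
  have ca: "continuous_on {0..1} ?a" by (rule continuous_set_integral_\<rho>[OF ft])
  have vc: "continuous_on ({0..1} \<times> \<Omega>) (\<lambda>z. v (fst z) (snd z))"
    using continuous_on_subset[OF v_joint, of "{0..1} \<times> \<Omega>"] by (auto simp: case_prod_unfold)
  have "continuous_on ({0..1} \<times> \<Omega>) (\<lambda>z. G z \<bullet> v (fst z) (snd z))"
    by (intro continuous_intros G vc)
  from continuous_set_integral_\<rho>[OF this] have "continuous_on {0..1} ?b" by simp
  then have cb: "continuous_on {0..1} ?b'" by (rule continuous_on_eq) (simp add: beq)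
  show "set_integrable lborel {0..1} ?b'" using cb by (rule borel_integrable_atLeastAtMost')
  have "(LINT t:{0..1}|lborel. ?a t + ?b' t) = (LINT x:\<Omega>|\<rho> 1. f (1, x)) - (LINT x:\<Omega>|\<rho> 0. f (0, x))"
    unfolding set_lebesgue_integral_def[of lborel]
  proof (rule integral_FTC_atLeastAtMost)
    show "((\<lambda>t. LINT x:\<Omega>|\<rho> t. f (t, x)) has_vector_derivative ?a t + ?b' t) (at t within {0..1})"
      if "0 \<le> t" "t \<le> 1" for t
      using test_function_along_flow[OF tf, of t] beq[of t] that
      by (simp add: has_real_derivative_iff_has_vector_derivative)
    show "continuous_on {0..1} (\<lambda>t. ?a t + ?b' t)" by (intro continuous_intros ca cb)
  qed simp
  moreover have "(LINT t:{0..1}|lborel. ?a t + ?b' t) = (LINT t:{0..1}|lborel. ?a t) + (LINT t:{0..1}|lborel. ?b' t)"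
    using ca cb by (intro set_integral_add borel_integrable_atLeastAtMost')
  ultimately show "(LINT t:{0..1}|lborel. ?a t) + (LINT t:{0..1}|lborel. ?b' t)
      = (LINT x:\<Omega>|\<rho> 1. f (1, x)) - (LINT x:\<Omega>|\<rho> 0. f (0, x))" by simp
qed

text \<open>Changing variables back to time 0, a particle sees the field \<open>v 0 x\<close> up to
  an error of at most \<open>rate\<close>. Squaring \<open>norm (v 0 x) + rate\<close> and using the
  bound \<beta> in the mixed term gives the constant.\<close>

lemma energy_le: "energy \<Omega> \<rho> \<le> ennreal ((LINT x|\<mu>. (norm (v 0 x))^2) + 2 * \<beta> * rate + rate^2)"
proof -
  let ?c = "ennreal ((LINT x|\<mu>. (norm (v 0 x))^2) + 2 * \<beta> * rate + rate^2)"
  have v0c: "continuous_on UNIV (\<lambda>x. (norm (v 0 x))^2)"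
    using v_space[of 0] by (intro continuous_intros) auto
  have "(\<integral>\<^sup>+ x. ennreal ((norm (vel t x))^2) \<partial>\<rho> t) \<le> ?c" if t: "t \<in> {0..1}" for t
  proof -
    have \<psi>m: "\<psi> t \<in> borel_measurable \<mu>" unfolding measurable_\<mu> by (rule \<psi>_measurable[OF t])
    have vm: "v t \<in> borel_measurable borel" using v_space[OF t] by (rule borel_measurable_continuous_onI)
    have "(\<integral>\<^sup>+ x. ennreal ((norm (vel t x))^2) \<partial>\<rho> t) = (\<integral>\<^sup>+ x. ennreal ((norm (v t (\<psi> t x)))^2) \<partial>\<mu>)"
      unfolding \<rho>[OF t] using t \<psi>m vm by (subst nn_integral_distr) (auto simp: vel_def)
    also have "\<dots> \<le> (\<integral>\<^sup>+ x. ennreal ((norm (v 0 x))^2 + (2 * \<beta> * rate + rate^2)) \<partial>\<mu>)"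
    proof (rule nn_integral_mono_AE)
      show "AE x in \<mu>. ennreal ((norm (v t (\<psi> t x)))^2) \<le> ennreal ((norm (v 0 x))^2 + (2 * \<beta> * rate + rate^2))"
        using \<mu>D(3)
      proof eventually_elim
        case (elim x)
        have "norm (v t (\<psi> t x) - v 0 x) \<le> rate * t" using elim t by (rule v_along_flow)
        also have "\<dots> \<le> rate" using rate_nonneg t by (simp add: mult_left_le)
        finally have "norm (v t (\<psi> t x)) \<le> norm (v 0 x) + rate"
          using norm_triangle_sub[of "v t (\<psi> t x)" "v 0 x"] by linarith
        then have "(norm (v t (\<psi> t x)))^2 \<le> (norm (v 0 x) + rate)^2" by (intro power_mono) auto
        also have "\<dots> = (norm (v 0 x))^2 + (2 * norm (v 0 x) * rate + rate^2)"
          by (simp add: power2_sum)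
        also have "\<dots> \<le> (norm (v 0 x))^2 + (2 * \<beta> * rate + rate^2)"
          using v0_bound[of x] rate_nonneg by (simp add: mult_right_mono)
        finally show ?case by (rule ennreal_leI)
      qed
    qed
    also have "\<dots> = ennreal (LINT x|\<mu>. (norm (v 0 x))^2 + (2 * \<beta> * rate + rate^2))"
      using integrable_continuous_prob_measure[OF \<mu> compact_\<Omega> v0c] \<beta> rate_nonneg
      by (intro nn_integral_eq_integral) auto
    also have "(LINT x|\<mu>. (norm (v 0 x))^2 + (2 * \<beta> * rate + rate^2)) = (LINT x|\<mu>. (norm (v 0 x))^2) + 2 * \<beta> * rate + rate^2"
      using integrable_continuous_prob_measure[OF \<mu> compact_\<Omega> v0c] prob_space by simp
    finally show ?thesis .
  qed
  then have "(\<integral>\<^sup>+ t\<in>{0..1}. (\<integral>\<^sup>+ x. ennreal ((norm (vel t x))^2) \<partial>\<rho> t) \<partial>lborel) \<le> (\<integral>\<^sup>+ t\<in>{0..1::real}. ?c \<partial>lborel)"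
    by (intro nn_integral_mono) (auto split: split_indicator)
  also have "\<dots> = ?c" by (simp add: nn_integral_cmult_indicator)
  finally show ?thesis unfolding energy_def using vel_CE by (rule INF_lower2[rotated])
qed

end

end


section \<open>Lower bound for the energy\<close>

lemma set_integral_prob_measures_on:
  fixes h :: "'a::euclidean_space \<Rightarrow> real"
  assumes \<mu>: "\<mu> \<in> prob_measures_on \<Omega>" and \<Omega>: "closed \<Omega>" and h: "continuous_on UNIV h"
  shows "(LINT x:\<Omega>|\<mu>. h x) = (LINT x|\<mu>. h x)"
  unfolding set_lebesgue_integral_def
proof (rule integral_cong_AE)
  note D = prob_measures_onD[OF \<mu> \<Omega>]
  have eq: "borel_measurable \<mu> = borel_measurable borel" by (rule measurable_cong_sets[OF D(2) refl])
  show "h \<in> borel_measurable \<mu>" unfolding eq using h by (rule borel_measurable_continuous_onI)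
  show "(\<lambda>x. indicat_real \<Omega> x *\<^sub>R h x) \<in> borel_measurable \<mu>"
    unfolding eq using \<Omega> continuous_on_subset[OF h] by (intro borel_measurable_continuous_on_indicator) auto
  show "AE x in \<mu>. indicat_real \<Omega> x *\<^sub>R h x = h x"
    using D(3) by eventually_elim simp
qed

lemma integral_le_nn_integral:
  assumes "integrable M f"
  shows "ennreal (LINT x|M. f x) \<le> (\<integral>\<^sup>+ x. ennreal (f x) \<partial>M)"
proof -
  have i: "integrable M (\<lambda>x. max 0 (f x))" using assms by simp
  have "ennreal (LINT x|M. f x) \<le> ennreal (LINT x|M. max 0 (f x))"
    by (intro ennreal_leI integral_mono assms i) auto
  also have "\<dots> = (\<integral>\<^sup>+ x. ennreal (max 0 (f x)) \<partial>M)"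
    using i by (intro nn_integral_eq_integral[symmetric]) auto
  also have "\<dots> = (\<integral>\<^sup>+ x. ennreal (f x) \<partial>M)"
    by (intro nn_integral_cong) (simp add: max_def ennreal_neg)
  finally show ?thesis .
qed

lemma nn_integral_indicator_mono:
  fixes f :: "'a \<Rightarrow> real"
  assumes "\<And>x. x \<in> X \<Longrightarrow> ennreal (f x) \<le> g x"
  shows "(\<integral>\<^sup>+ x. ennreal (indicat_real X x *\<^sub>R f x) \<partial>M) \<le> (\<integral>\<^sup>+ x\<in>X. g x \<partial>M)"
  by (intro nn_integral_mono) (auto split: split_indicator simp: assms)

lemma CE_continuity_equation:
  assumes "v \<in> CE \<Omega> \<rho>" "C1_test_function \<Omega> \<phi> \<phi>t G"
  shows "(LINT t:{0..1}|lborel. (LINT x:\<Omega>|\<rho> t. \<phi>t (t, x))) + (LINT t:{0..1}|lborel. (LINT x:\<Omega>|\<rho> t. G (t, x) \<bullet> v t x))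
    = (LINT x:\<Omega>|\<rho> 1. \<phi> (1, x)) - (LINT x:\<Omega>|\<rho> 0. \<phi> (0, x))"
  using assms(1)[unfolded CE_def mem_Collect_eq, THEN conjunct2, THEN conjunct2, rule_format, OF assms(2), THEN conjunct2] .

text \<open>Integrates the nonnegative square of \<open>v - a G\<close>. The majorant
  \<open>H\<close> stands in for the time-dependent integral of the squared norm of
  \<open>G\<close>, so that a constant can replace a function of time of unknown measurability. The
  conclusion is in \<open>ennreal\<close> because the cost of \<open>v\<close> may be
  infinite.\<close>

lemma CE_young:
  fixes \<Omega> :: "'a::euclidean_space set"
  assumes \<Omega>: "compact \<Omega>" and \<rho>: "\<And>t. t \<in> {0..1} \<Longrightarrow> \<rho> t \<in> prob_measures_on \<Omega>"
    and v: "v \<in> CE \<Omega> \<rho>" and tf: "C1_test_function \<Omega> \<phi> \<phi>t G"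
    and H: "set_integrable lborel {0..1} H" "\<And>t. t \<in> {0..1} \<Longrightarrow> (LINT x:\<Omega>|\<rho> t. (norm (G (t, x)))^2) \<le> H t"
  shows "ennreal (2 * a * (LINT t:{0..1}|lborel. (LINT x:\<Omega>|\<rho> t. G (t, x) \<bullet> v t x)) - a^2 * (LINT t:{0..1}|lborel. H t))
    \<le> (\<integral>\<^sup>+ t\<in>{0..1}. (\<integral>\<^sup>+ x. ennreal ((norm (v t x))^2) \<partial>\<rho> t) \<partial>lborel)"
proof -
  let ?b = "\<lambda>t. LINT x:\<Omega>|\<rho> t. G (t, x) \<bullet> v t x"
  let ?m = "\<lambda>t. 2 * a * ?b t - a^2 * H t"
  have b: "set_integrable lborel {0..1} ?b" using v tf unfolding CE_def by blast
  have Gc: "continuous_on ({0..1} \<times> \<Omega>) G" using tf by (simp add: C1_test_function_def)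
  have m_le: "ennreal (?m t) \<le> (\<integral>\<^sup>+ x. ennreal ((norm (v t x))^2) \<partial>\<rho> t)" if t: "t \<in> {0..1}" for t
  proof -
    note D = prob_measures_onD[OF \<rho>[OF t] compact_imp_closed[OF \<Omega>]]
    interpret prob_space "\<rho> t" by (rule D(1))
    have eq: "borel_measurable (\<rho> t) = borel_measurable borel"
      by (rule measurable_cong_sets[OF D(2) refl])
    have "(\<lambda>(t, x). v t x) \<circ> Pair t \<in> borel_measurable borel"
      using v by (intro measurable_comp borel_measurable_continuous_onI) (auto simp: CE_def intro!: continuous_intros)
    then have vm: "v t \<in> borel_measurable (\<rho> t)" unfolding measurable_cong_sets[OF D(2) refl] by (simp add: comp_def)
    have vi: "integrable (\<rho> t) (\<lambda>x. (norm (v t x))^2)" using v t by (auto simp: CE_def)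
    define g where "g x = indicat_real \<Omega> x *\<^sub>R G (t, x)" for x
    have Gt: "continuous_on \<Omega> (\<lambda>x. G (t, x))"
      using t by (intro continuous_on_compose2[OF Gc]) (auto intro!: continuous_intros)
    then have gm: "g \<in> borel_measurable (\<rho> t)"
      unfolding measurable_cong_sets[OF D(2) refl] g_def
      using compact_imp_closed[OF \<Omega>] by (intro borel_measurable_continuous_on_indicator) auto
    obtain C where C: "\<And>x. x \<in> \<Omega> \<Longrightarrow> norm (G (t, x)) \<le> C"
      using compact_imp_bounded[OF compact_continuous_image[OF Gt \<Omega>]] unfolding bounded_iff by (metis imageI)
    have gi: "integrable (\<rho> t) (\<lambda>x. (norm (g x))^2)"
    proof (rule integrable_const_bound)
      show "AE x in \<rho> t. norm ((norm (g x))^2) \<le> C^2"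
        using D(3) by eventually_elim (use C in \<open>auto simp: g_def intro!: power_mono\<close>)
    qed (use gm in measurable)
    have gv: "\<bar>g x \<bullet> v t x\<bar> \<le> (norm (g x))^2 + (norm (v t x))^2" for x
    proof -
      have "\<bar>g x \<bullet> v t x\<bar> \<le> norm (g x) * norm (v t x)" by (rule Cauchy_Schwarz_ineq2)
      also have "\<dots> \<le> (norm (g x))^2 + (norm (v t x))^2"
        using sum_squares_bound[of "norm (g x)" "norm (v t x)"] mult_nonneg_nonneg[OF norm_ge_zero[of "g x"] norm_ge_zero[of "v t x"]]
        by linarith
      finally show ?thesis .
    qed
    have ii: "integrable (\<rho> t) (\<lambda>x. g x \<bullet> v t x)"
    proof (rule Bochner_Integration.integrable_bound[OF Bochner_Integration.integrable_add[OF gi vi]])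
      show "(\<lambda>x. g x \<bullet> v t x) \<in> borel_measurable (\<rho> t)" using gm vm by measurable
      show "AE x in \<rho> t. norm (g x \<bullet> v t x) \<le> norm ((norm (g x))^2 + (norm (v t x))^2)"
        using gv by (auto intro!: AE_I2)
    qed
    have bt: "?b t = (LINT x|\<rho> t. g x \<bullet> v t x)"
      by (simp add: set_lebesgue_integral_def g_def)
    have "(LINT x:\<Omega>|\<rho> t. (norm (G (t, x)))^2) = (LINT x|\<rho> t. (norm (g x))^2)"
      unfolding set_lebesgue_integral_def g_def
      by (intro Bochner_Integration.integral_cong) (auto split: split_indicator)
    then have "a^2 * (LINT x|\<rho> t. (norm (g x))^2) \<le> a^2 * H t"
      using H(2)[OF t] by (intro mult_left_mono) auto
    then have "?m t \<le> 2 * a * (LINT x|\<rho> t. g x \<bullet> v t x) - a^2 * (LINT x|\<rho> t. (norm (g x))^2)"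
      by (simp add: bt)
    also have "2 * a * (LINT x|\<rho> t. g x \<bullet> v t x) - a^2 * (LINT x|\<rho> t. (norm (g x))^2)
        = (LINT x|\<rho> t. 2 * a * (g x \<bullet> v t x) - a^2 * (norm (g x))^2)"
      using ii gi by simp
    also have "\<dots> \<le> (LINT x|\<rho> t. (norm (v t x))^2)"
    proof (intro integral_mono vi)
      show "integrable (\<rho> t) (\<lambda>x. 2 * a * (g x \<bullet> v t x) - a^2 * (norm (g x))^2)" using ii gi by simp
      fix x
      have "0 \<le> (norm (v t x - a *\<^sub>R g x))^2" by simp
      also have "\<dots> = (norm (v t x))^2 - 2 * a * (g x \<bullet> v t x) + a^2 * (norm (g x))^2"
        unfolding power2_norm_eq_inner
        by (simp add: inner_diff_left inner_diff_right inner_commute power2_eq_square algebra_simps)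
      finally show "2 * a * (g x \<bullet> v t x) - a^2 * (norm (g x))^2 \<le> (norm (v t x))^2" by simp
    qed
    finally have "ennreal (?m t) \<le> ennreal (LINT x|\<rho> t. (norm (v t x))^2)" by (rule ennreal_leI)
    also have "\<dots> = (\<integral>\<^sup>+ x. ennreal ((norm (v t x))^2) \<partial>\<rho> t)"
      using vi by (intro nn_integral_eq_integral[symmetric]) auto
    finally show ?thesis .
  qed
  have mi: "set_integrable lborel {0..1} ?m"
    using b H(1) by (intro set_integral_diff(1) set_integrable_mult_right)
  have eq: "2 * a * (LINT t:{0..1}|lborel. ?b t) - a^2 * (LINT t:{0..1}|lborel. H t) = (LINT t:{0..1}|lborel. ?m t)"
    using b H(1) by (subst set_integral_diff(2)) auto
  have "ennreal (LINT t:{0..1}|lborel. ?m t) \<le> (\<integral>\<^sup>+ t. ennreal (indicat_real {0..1} t *\<^sub>R ?m t) \<partial>lborel)"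
    unfolding set_lebesgue_integral_def[of lborel]
    using mi unfolding set_integrable_def by (rule integral_le_nn_integral)
  also have "\<dots> \<le> (\<integral>\<^sup>+ t\<in>{0..1}. (\<integral>\<^sup>+ x. ennreal ((norm (v t x))^2) \<partial>\<rho> t) \<partial>lborel)"
    by (rule nn_integral_indicator_mono[OF m_le])
  finally show ?thesis unfolding eq .
qed

text \<open>A competitor \<open>\<rho>\<close> need not stay close to \<open>\<rho> 0\<close>; testing the continuity equation with \<open>(1 - t) \<bar>u\<bar>^2\<close> bounds
  the time average of \<open>\<integral> \<bar>u\<bar>^2 d\<rho>(t)\<close> by its value at \<open>0\<close> and the energy.\<close>

lemma energy_lower_bound:
  fixes \<Omega> :: "'a::euclidean_space set" and u' :: "'a \<Rightarrow> 'a \<Rightarrow>\<^sub>L 'a"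
  assumes \<Omega>: "compact \<Omega>" and \<rho>: "\<And>t. t \<in> {0..1} \<Longrightarrow> \<rho> t \<in> prob_measures_on \<Omega>"
    and lip: "\<And>s t. s \<in> {0..1} \<Longrightarrow> t \<in> {0..1} \<Longrightarrow> W (\<rho> s) (\<rho> t) \<le> L * \<bar>s - t\<bar>"
    and f: "\<And>x. GDERIV f x :> u x"
    and u: "\<And>x. (u has_derivative blinfun_apply (u' x)) (at x)" and u'c: "continuous_on UNIV u'"
    and M: "\<And>x. norm (u x) \<le> M" "\<And>x. norm (u' x) \<le> M"
    and t: "0 < t" and fin: "energy \<Omega> \<rho> < \<infinity>"
  shows "2 * t * ((LINT x|\<rho> 1. f x) - (LINT x|\<rho> 0. f x)) - t^2 * (LINT x|\<rho> 0. (norm (u x))^2) - 2 * t^3 * M^4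
    \<le> (1 + t / 2) * enn2real (energy \<Omega> \<rho>)"
proof -
  note cl = compact_imp_closed[OF \<Omega>]
  have M0: "0 \<le> M" using order_trans[OF norm_ge_zero M(1)] .
  define h where "h x = (norm (u x))^2" for x
  \<comment> \<open>The gradient of \<open>h\<close>, that is twice the adjoint of
    \<open>u' x\<close> applied to \<open>u x\<close>, written out in coordinates.\<close>
  define g where "g x = (\<Sum>i\<in>Basis. (2 * (u x \<bullet> blinfun_apply (u' x) i)) *\<^sub>R i)" for x
  have uc: "continuous_on UNIV u" using u by (intro has_derivative_continuous_on) (auto intro: has_derivative_at_withinI)
  have fc: "continuous_on UNIV f"
    using gradient_has_derivative[OF f] by (intro has_derivative_continuous_on)
  have gc: "continuous_on UNIV g" unfolding g_def
    by (intro continuous_intros uc u'c)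
  have gin: "g x \<bullet> w = 2 * (u x \<bullet> blinfun_apply (u' x) w)" for x w
  proof -
    have "g x \<bullet> w = (\<Sum>i\<in>Basis. 2 * (u x \<bullet> blinfun_apply (u' x) i) * (i \<bullet> w))"
      by (simp add: g_def inner_sum_left)
    also have "\<dots> = 2 * (u x \<bullet> blinfun_apply (u' x) (\<Sum>i\<in>Basis. (w \<bullet> i) *\<^sub>R i))"
      by (simp add: blinfun.sum_right blinfun.scaleR_right inner_sum_right sum_distrib_left mult_ac inner_commute)
    finally show ?thesis by (simp only: euclidean_representation)
  qed
  have hd: "(h has_derivative (\<lambda>w. g x \<bullet> w)) (at x)" for x
    unfolding h_def power2_norm_eq_inner
    by (rule has_derivative_eq_rhs[OF has_derivative_inner[OF u u]]) (simp add: gin inner_commute[of _ "u x"] fun_eq_iff)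
  have hc: "continuous_on UNIV h" unfolding h_def by (intro continuous_intros uc)
  have gb: "norm (g x) \<le> 2 * M^2" for x
  proof -
    have "g x \<bullet> g x \<le> 2 * (M * (M * norm (g x)))"
    proof -
      have "u x \<bullet> blinfun_apply (u' x) (g x) \<le> norm (u x) * norm (blinfun_apply (u' x) (g x))"
        by (rule norm_cauchy_schwarz)
      also have "\<dots> \<le> M * (norm (u' x) * norm (g x))"
        using M(1)[of x] norm_blinfun[of "u' x" "g x"] M0 by (intro mult_mono) auto
      also have "\<dots> \<le> M * (M * norm (g x))" using M(2)[of x] M0 by (intro mult_left_mono mult_right_mono) auto
      finally show ?thesis unfolding gin[of x "g x"] by simp
    qed
    then have "norm (g x) * norm (g x) \<le> (2 * M^2) * norm (g x)"
      by (simp add: power2_norm_eq_inner[symmetric] power2_eq_square mult_ac)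
    then show ?thesis
      using M0 by (cases "g x = 0") auto
  qed
  have hG: "GDERIV h x :> g x" for x using hd by (simp add: gderiv_def inner_commute)
  \<comment> \<open>The Lipschitz condition on the competitor makes the integral of \<open>h\<close>
    continuous in time, hence its time average \<open>H\<close> meaningful.\<close>
  have Hlip: "\<bar>(LINT x|\<rho> s. h x) - (LINT x|\<rho> t. h x)\<bar> \<le> (2 * M^2 * L) * \<bar>s - t\<bar>" if st: "s \<in> {0..1}" "t \<in> {0..1}" for s t
  proof -
    have "\<bar>(LINT x|\<rho> s. h x) - (LINT x|\<rho> t. h x)\<bar> \<le> 2 * M^2 * W (\<rho> s) (\<rho> t)"
      using gradient_lipschitz[OF hG gb] by (intro integral_diff_le_W[OF \<rho>[OF st(1)] \<rho>[OF st(2)] \<Omega>]) auto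
    also have "\<dots> \<le> 2 * M^2 * (L * \<bar>s - t\<bar>)" using lip[OF st] by (intro mult_left_mono) auto
    finally show ?thesis by (simp add: mult_ac)
  qed
  have "continuous_on {0..1} (\<lambda>t. LINT x|\<rho> t. h x)"
  proof (rule lipschitz_on_continuous_on[of "\<bar>2 * M^2 * L\<bar>"], rule lipschitz_onI)
    show "dist (LINT x|\<rho> s. h x) (LINT x|\<rho> t. h x) \<le> \<bar>2 * M^2 * L\<bar> * dist s t" if "s \<in> {0..1}" "t \<in> {0..1}" for s t
      unfolding dist_real_def by (rule order_trans[OF Hlip[OF that] mult_right_mono]) auto
  qed auto
  then have Hi: "set_integrable lborel {0..1} (\<lambda>t. LINT x|\<rho> t. h x)" by (rule borel_integrable_atLeastAtMost')
  define H where "H = (LINT t:{0..1}|lborel. (LINT x|\<rho> t. h x))"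
  define \<Delta> where "\<Delta> = (LINT x|\<rho> 1. f x) - (LINT x|\<rho> 0. f x)"
  define H0 where "H0 = (LINT x|\<rho> 0. h x)"
  have tf1: "C1_test_function \<Omega> (\<lambda>z. f (snd z)) (\<lambda>z. 0) (\<lambda>z. u (snd z))"
    unfolding C1_test_function_def
  proof (intro conjI ballI)
    show "continuous_on ({0..1} \<times> \<Omega>) (\<lambda>z. u (snd z))"
      by (intro continuous_on_compose2[OF uc] continuous_intros) auto
    fix z :: "real \<times> 'a"
    have "((\<lambda>z. f (snd z)) has_derivative (\<lambda>h. u (snd z) \<bullet> snd h)) (at z within {0..1} \<times> \<Omega>)"
      using has_derivative_compose[of snd snd z "{0..1} \<times> \<Omega>" f "\<lambda>h. u (snd z) \<bullet> h"] gradient_has_derivative[OF f]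
      by (simp add: bounded_linear_imp_has_derivative bounded_linear_snd)
    then show "((\<lambda>z. f (snd z)) has_derivative (\<lambda>h. fst h * 0 + u (snd z) \<bullet> snd h)) (at z within {0..1} \<times> \<Omega>)"
      by simp
  qed (rule continuous_on_const)
  \<comment> \<open>The factor 1 - t removes the terminal term, so that this test yields
    \<open>H = H0 + I\<close> with no information on \<open>\<rho> 1\<close>.\<close>
  have tf2: "C1_test_function \<Omega> (\<lambda>z. (1 - fst z) * h (snd z)) (\<lambda>z. - h (snd z)) (\<lambda>z. (1 - fst z) *\<^sub>R g (snd z))"
    unfolding C1_test_function_def
  proof (intro conjI ballI)
    show "continuous_on ({0..1} \<times> \<Omega>) (\<lambda>z. - h (snd z))"
      by (intro continuous_intros continuous_on_compose2[OF hc]) auto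
    show "continuous_on ({0..1} \<times> \<Omega>) (\<lambda>z. (1 - fst z) *\<^sub>R g (snd z))"
      by (intro continuous_intros continuous_on_compose2[OF gc]) auto
    fix z :: "real \<times> 'a"
    have 1: "((\<lambda>z. h (snd z)) has_derivative (\<lambda>w. g (snd z) \<bullet> snd w)) (at z within {0..1} \<times> \<Omega>)"
      using has_derivative_compose[of snd snd z "{0..1} \<times> \<Omega>" h "\<lambda>h. g (snd z) \<bullet> h"] hd
      by (simp add: bounded_linear_imp_has_derivative bounded_linear_snd)
    have 2: "((\<lambda>z :: real \<times> 'a. 1 - fst z) has_derivative (\<lambda>w. - fst w)) (at z within {0..1} \<times> \<Omega>)"
      by (auto intro!: derivative_eq_intros)
    show "((\<lambda>z. (1 - fst z) * h (snd z)) has_derivative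
        (\<lambda>w. fst w * - h (snd z) + ((1 - fst z) *\<^sub>R g (snd z)) \<bullet> snd w)) (at z within {0..1} \<times> \<Omega>)"
      by (rule has_derivative_eq_rhs[OF has_derivative_mult[OF 2 1]]) (simp add: fun_eq_iff)
  qed
  have key: "ennreal ((2 * t * \<Delta> - t^2 * H0 - 2 * t^3 * M^4) / (1 + t / 2))
      \<le> (\<integral>\<^sup>+ t\<in>{0..1}. (\<integral>\<^sup>+ x. ennreal ((norm (v t x))^2) \<partial>\<rho> t) \<partial>lborel)" (is "_ \<le> ?e")
    if v: "v \<in> CE \<Omega> \<rho>" for v
  proof (cases "?e < \<infinity>")
    case True
    define r where "r = enn2real ?e"
    have r: "?e = ennreal r" "0 \<le> r" using True by (auto simp: r_def)
    have red: "(LINT x:\<Omega>|\<rho> s. q x) = (LINT x|\<rho> s. q x)" if "s \<in> {0..1}" "continuous_on UNIV q" for s and q :: "'a \<Rightarrow> real"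
      using set_integral_prob_measures_on[OF \<rho>[OF that(1)] cl that(2)] .
    define U where "U = (LINT s:{0..1}|lborel. (LINT x:\<Omega>|\<rho> s. u x \<bullet> v s x))"
    define I where "I = (LINT s:{0..1}|lborel. (LINT x:\<Omega>|\<rho> s. ((1 - s) *\<^sub>R g x) \<bullet> v s x))"
    have "(LINT s:{0..1}|lborel. (LINT x:\<Omega>|\<rho> s. 0)) + U = (LINT x:\<Omega>|\<rho> 1. f x) - (LINT x:\<Omega>|\<rho> 0. f x)"
      using CE_continuity_equation[OF v tf1] unfolding U_def snd_conv .
    then have U: "U = \<Delta>" using red[of 1 f] red[of 0 f] fc by (simp add: \<Delta>_def)
    have "(LINT s:{0..1}|lborel. (LINT x:\<Omega>|\<rho> s. - h x)) + I = (LINT x:\<Omega>|\<rho> 1. (1 - 1) * h x) - (LINT x:\<Omega>|\<rho> 0. (1 - 0) * h x)"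
      using CE_continuity_equation[OF v tf2] unfolding I_def fst_conv snd_conv .
    moreover have "(LINT s:{0..1}|lborel. (LINT x:\<Omega>|\<rho> s. - h x)) = (LINT s:{0..1}|lborel. - (LINT x|\<rho> s. h x))"
      using red[of _ h] hc by (intro set_lebesgue_integral_cong) (auto simp: set_lebesgue_integral_def)
    ultimately have I: "H = H0 + I"
      using red[of 0 h] hc Hi by (simp add: H_def H0_def set_lebesgue_integral_def)
    have e1: "ennreal (2 * t * U - t^2 * H) \<le> ennreal r"
      using CE_young[OF \<Omega> \<rho> v tf1 Hi, of t] red[of _ h] hc unfolding H_def U_def r(1)[symmetric] by (simp add: h_def[abs_def])
    have e2: "ennreal (2 * t * I - t^2 * (LINT s:{0..1::real}|lborel. (2 * M^2)^2)) \<le> ennreal r"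
      unfolding I_def r(1)[symmetric]
    proof (rule order_trans[OF _ CE_young[OF \<Omega> \<rho> v tf2, of "\<lambda>_. (2 * M^2)^2" t]])
      show "set_integrable lborel {0..1::real} (\<lambda>_. (2 * M^2)^2)" by (rule borel_integrable_atLeastAtMost') auto
      fix s :: real assume s: "s \<in> {0..1}"
      interpret prob_space "\<rho> s" by (rule prob_measures_onD(1)[OF \<rho>[OF s] cl])
      have "norm ((1 - s) *\<^sub>R g x) \<le> 2 * M^2" for x
        using gb[of x] s mult_mono[of "1 - s" 1 "norm (g x)" "2 * M^2"] by simp
      then have *: "(norm ((1 - s) *\<^sub>R g x))^2 \<le> (2 * M^2)^2" for x by (intro power_mono) auto
      have c: "continuous_on UNIV (\<lambda>x. (norm ((1 - s) *\<^sub>R g x))^2)" by (intro continuous_intros gc)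
      have "(LINT x|\<rho> s. (norm ((1 - s) *\<^sub>R g x))^2) \<le> (LINT x|\<rho> s. (2 * M^2)^2)"
        using * by (intro integral_mono integrable_continuous_prob_measure[OF \<rho>[OF s] \<Omega> c]) auto
      then show "(LINT x:\<Omega>|\<rho> s. (norm ((1 - fst (s, x)) *\<^sub>R g (snd (s, x))))^2) \<le> (2 * M^2)^2"
        using red[OF s c] prob_space by simp
    qed simp
    have "(LINT s:{0..1::real}|lborel. (2 * M^2)^2) = (2 * M^2)^2" by (simp add: set_integral_const)
    then have 1: "2 * t * \<Delta> - t^2 * (H0 + I) \<le> r" and 2: "2 * t * I - t^2 * (2 * M^2)^2 \<le> r"
      using e1 e2 r(2) U I by (auto simp: ennreal_le_iff)
    \<comment> \<open>With the weight t/2, adding this to the first inequality cancels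
      \<open>t^2 * I\<close>; the weighted constant term is \<open>2 * t^3 * M^4\<close>.\<close>
    have "(t / 2) * (2 * t * I - t^2 * (2 * M^2)^2) \<le> (t / 2) * r" using 2 t by (intro mult_left_mono) auto
    then have "t^2 * I - 2 * t^3 * M^4 \<le> (t / 2) * r"
      by (simp add: power2_eq_square power3_eq_cube power4_eq_xxxx algebra_simps)
    with 1 have "2 * t * \<Delta> - t^2 * H0 - 2 * t^3 * M^4 \<le> (1 + t / 2) * r" by (simp add: algebra_simps)
    then have "(2 * t * \<Delta> - t^2 * H0 - 2 * t^3 * M^4) / (1 + t / 2) \<le> r"
      using t by (simp add: pos_divide_le_eq mult.commute)
    then show ?thesis unfolding r(1) by (rule ennreal_leI)
  qed (auto simp: top_unique not_less)
  have "ennreal ((2 * t * \<Delta> - t^2 * H0 - 2 * t^3 * M^4) / (1 + t / 2)) \<le> energy \<Omega> \<rho>"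
    unfolding energy_def by (rule INF_greatest) (rule key)
  then have "(2 * t * \<Delta> - t^2 * H0 - 2 * t^3 * M^4) / (1 + t / 2) \<le> enn2real (energy \<Omega> \<rho>)"
    using fin by (smt (verit) enn2real_mono enn2real_ennreal enn2real_nonneg infinity_ennreal_def)
  then show ?thesis
    using t by (simp add: pos_divide_le_eq mult.commute \<Delta>_def H0_def h_def)
qed

section \<open>Estimating the infimum that defines the restricted distance\<close>

lemma W_restr_upper_bound:
  assumes "\<rho> \<in> W_Lipschitz_curves \<Lambda>" "\<rho> 0 = \<mu>" "\<rho> 1 = \<nu>" "energy \<Omega> \<rho> \<le> ennreal e" "0 \<le> e"
  shows "0 \<le> W_restr \<Omega> \<Lambda> \<mu> \<nu>" "(W_restr \<Omega> \<Lambda> \<mu> \<nu>)^2 \<le> e"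
proof -
  let ?X = "{sqrt (enn2real (energy \<Omega> \<rho>)) | \<rho>. \<rho> \<in> W_Lipschitz_curves \<Lambda> \<and> \<rho> 0 = \<mu> \<and> \<rho> 1 = \<nu> \<and> energy \<Omega> \<rho> < \<infinity>}"
  have "energy \<Omega> \<rho> < \<infinity>" using assms(4) by (rule order_le_less_trans) simp
  then have mem: "sqrt (enn2real (energy \<Omega> \<rho>)) \<in> ?X" using assms by blast
  then show 0: "0 \<le> W_restr \<Omega> \<Lambda> \<mu> \<nu>" unfolding W_restr_def by (intro cInf_greatest) auto
  have "bdd_below ?X" by (rule bdd_belowI[of _ 0]) auto
  with mem have "W_restr \<Omega> \<Lambda> \<mu> \<nu> \<le> sqrt (enn2real (energy \<Omega> \<rho>))" unfolding W_restr_def by (rule cInf_lower)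
  also have "\<dots> \<le> sqrt e"
    using enn2real_mono[OF assms(4)] assms(5) by simp
  finally have "(W_restr \<Omega> \<Lambda> \<mu> \<nu>)^2 \<le> (sqrt e)^2" using 0 by (rule power_mono)
  then show "(W_restr \<Omega> \<Lambda> \<mu> \<nu>)^2 \<le> e" using assms(5) by simp
qed

text \<open>The real infimum of an empty set carries no information, so a lower bound for all
  competitors has to come with one competitor \<open>\<rho>0\<close> of finite energy.\<close>

lemma W_restr_lower_bound:
  assumes "\<rho>0 \<in> W_Lipschitz_curves \<Lambda>" "\<rho>0 0 = \<mu>" "\<rho>0 1 = \<nu>" "energy \<Omega> \<rho>0 < \<infinity>"
    and q: "\<And>\<rho>. \<rho> \<in> W_Lipschitz_curves \<Lambda> \<Longrightarrow> \<rho> 0 = \<mu> \<Longrightarrow> \<rho> 1 = \<nu> \<Longrightarrow> energy \<Omega> \<rho> < \<infinity> \<Longrightarrow> q \<le> enn2real (energy \<Omega> \<rho>)"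
  shows "q \<le> (W_restr \<Omega> \<Lambda> \<mu> \<nu>)^2"
proof (cases "0 \<le> q")
  case True
  have "sqrt q \<le> W_restr \<Omega> \<Lambda> \<mu> \<nu>"
    unfolding W_restr_def using assms(1-4) q by (intro cInf_greatest) auto
  then have "(sqrt q)^2 \<le> (W_restr \<Omega> \<Lambda> \<mu> \<nu>)^2" using True by (intro power_mono) auto
  then show ?thesis using True by simp
qed (auto intro: order_trans[OF _ zero_le_power2])


section \<open>Rays in a parametrized submanifold\<close>

lemma C1_field_bounds:
  fixes f :: "'a::euclidean_space \<Rightarrow> 'a"
  assumes f: "C1_field f" and c: "C1_norm f \<le> ennreal c" "0 \<le> c"
  obtains f' :: "'a \<Rightarrow> 'a \<Rightarrow>\<^sub>L 'a" where "continuous_on UNIV f'"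
    "\<And>x. (f has_derivative blinfun_apply (f' x)) (at x)" "\<And>x. norm (f x) \<le> c" "\<And>x. norm (f' x) \<le> c"
proof -
  obtain f' :: "'a \<Rightarrow> 'a \<Rightarrow>\<^sub>L 'a" where f': "continuous_on UNIV f'"
      "\<And>x. (f has_derivative blinfun_apply (f' x)) (at x)"
    using f unfolding C1_field_def by blast
  have "(SUP x. ennreal (norm (f x))) \<le> ennreal c" "(SUP x. ennreal (onorm (frechet_derivative f (at x)))) \<le> ennreal c"
    using c(1) by (simp_all add: C1_norm_def)
  then have "ennreal (norm (f x)) \<le> ennreal c" "ennreal (onorm (frechet_derivative f (at x))) \<le> ennreal c" for x
    by (auto simp: SUP_le_iff)
  then have b: "norm (f x) \<le> c" "onorm (frechet_derivative f (at x)) \<le> c" for x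
    using c(2) by (simp_all add: ennreal_le_iff)
  have "norm (f' x) \<le> c" for x
    using b(2)[of x] frechet_derivative_at[OF f'(2)[of x]] by (simp add: norm_blinfun.rep_eq)
  with f' b(1) show ?thesis by (intro that)
qed

lemma C1_field_continuous:
  assumes "C1_field f"
  shows "continuous_on UNIV f"
proof -
  obtain f' where "\<And>x. (f has_derivative blinfun_apply (f' x)) (at x)"
    using assms unfolding C1_field_def by blast
  then show ?thesis by (intro has_derivative_continuous_on)
qed

lemma norm_diff_le_derivative_bound:
  fixes f :: "'a::euclidean_space \<Rightarrow> 'a" and f' :: "'a \<Rightarrow> 'a \<Rightarrow>\<^sub>L 'a"
  assumes "\<And>x. (f has_derivative blinfun_apply (f' x)) (at x)" "\<And>x. norm (f' x) \<le> c"
  shows "norm (f x - f y) \<le> c * norm (x - y)"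
proof (rule differentiable_bound[OF convex_UNIV])
  show "(f has_derivative blinfun_apply (f' z)) (at z)" for z by (rule assms(1))
  show "onorm (blinfun_apply (f' z)) \<le> c" for z
    using assms(2)[of z] by (simp only: norm_blinfun.rep_eq)
qed simp_all

locale wasserstein_submanifold =
  fixes \<Omega> :: "'a::euclidean_space set"
    and A :: "('m::{t2_space,second_countable_topology}, 'e::real_normed_vector) chart set"
    and g :: "'m \<Rightarrow> 'e \<Rightarrow> 'e \<Rightarrow> real" and S :: "'m set" and \<D> :: "('m \<times> 'e) set"
    and E :: "'m \<Rightarrow> 'a measure" and B :: "'m \<Rightarrow> 'e \<Rightarrow> 'a \<Rightarrow> 'a" and k K C0 :: real
  assumes \<Omega>: "compact \<Omega>"
    and atlas: "smooth_atlas A" and metric: "riemannian_metric A g"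
    and exp_dom: "exp_domain A g S \<D>"
    and E_prob: "\<And>p. p \<in> S \<Longrightarrow> E p \<in> prob_measures_on \<Omega>"
    and k: "0 < k"
    and dist_le_W: "\<And>p q. p \<in> S \<Longrightarrow> q \<in> S \<Longrightarrow> k * riem_dist A g S p q \<le> W (E p) (E q)"
    and W_le_dist: "\<And>p q. p \<in> S \<Longrightarrow> q \<in> S \<Longrightarrow> W (E p) (E q) \<le> K * riem_dist A g S p q"
    and K: "0 \<le> K"
    and B_linear: "\<And>p x. p \<in> S \<Longrightarrow> linear (\<lambda>\<eta>. B p \<eta> x)"
    and B_C1: "\<And>p \<eta>. p \<in> S \<Longrightarrow> C1_field (B p \<eta>)"
    and B_gradient: "\<And>p \<eta>. p \<in> S \<Longrightarrow> gradient_field (B p \<eta>)"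
    and C0: "0 < C0"
    and B_norm: "\<And>p \<eta>. (p, \<eta>) \<in> \<D> \<Longrightarrow> C1_norm (B p \<eta>) \<le> ennreal (C0 * tangent_norm g p \<eta>)"
    and B_time: "\<And>p \<eta> x t. (p, \<eta>) \<in> \<D> \<Longrightarrow> t \<in> {0..1} \<Longrightarrow>
      \<exists>w. ((\<lambda>s. B (riem_exp A g p (s *\<^sub>R \<eta>)) (velocity A (\<lambda>s. riem_exp A g p (s *\<^sub>R \<eta>)) {0..1} s) x)
            has_vector_derivative w) (at t within {0..1}) \<and> norm w \<le> C0 * (tangent_norm g p \<eta>)^2"
    and transports: "transports_along_curves A g S \<Omega> E B"
begin

abbreviation dS :: "'m \<Rightarrow> 'm \<Rightarrow> real" where "dS \<equiv> riem_dist A g S"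

abbreviation ray :: "'m \<Rightarrow> 'e \<Rightarrow> real \<Rightarrow> 'm" where "ray p \<eta> t \<equiv> riem_exp A g p (t *\<^sub>R \<eta>)"

abbreviation speed :: "'m \<Rightarrow> 'e \<Rightarrow> real" where "speed p \<eta> \<equiv> tangent_norm g p \<eta>"

definition ray_field :: "'m \<Rightarrow> 'e \<Rightarrow> real \<Rightarrow> 'a \<Rightarrow> 'a"
  where "ray_field p \<eta> t = B (ray p \<eta> t) (velocity A (ray p \<eta>) {0..1} t)"

lemma closed_\<Omega>: "closed \<Omega>"
  using \<Omega> by (rule compact_imp_closed)

lemma dS_nonneg: "0 \<le> dS p q"
  by (simp add: riem_dist_def)

text \<open>Symmetry of \<open>W\<close> together with the bi-Lipschitz bounds replaces the reversal
  of curves. The factor \<open>K / k\<close> is harmless in estimates of order o(t).\<close>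

lemma dS_commute_le:
  assumes "p \<in> S" "q \<in> S"
  shows "dS q p \<le> K / k * dS p q"
proof -
  have "k * dS q p \<le> K * dS p q"
    using dist_le_W[OF assms(2,1)] W_le_dist[OF assms] W_commute[of "E p" "E q"] by simp
  then show ?thesis using k by (simp add: pos_le_divide_eq mult.commute)
qed

lemma exp_domainD:
  assumes D: "(p, \<eta>) \<in> \<D>"
  shows "p \<in> S" "exp_defined A g p \<eta>" "\<And>t. t \<in> {0..1} \<Longrightarrow> (p, t *\<^sub>R \<eta>) \<in> \<D>"
    "geodesic A g (ray p \<eta>)" "ray p \<eta> 0 = p" "\<And>t. t \<in> {0..1} \<Longrightarrow> ray p \<eta> t \<in> S"
    "\<And>t. t \<in> {0..1} \<Longrightarrow> tangent_norm g (ray p \<eta> t) (velocity A (ray p \<eta>) {0..1} t) = speed p \<eta>"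
    "speed p \<eta> = dS p (riem_exp A g p \<eta>)"
proof -
  note * = bspec[OF conjunct1[OF exp_dom[unfolded exp_domain_def]] D, unfolded prod.case Let_def]
  show "p \<in> S" "exp_defined A g p \<eta>" "geodesic A g (ray p \<eta>)" "ray p \<eta> 0 = p"
    "speed p \<eta> = dS p (riem_exp A g p \<eta>)"
    using * by blast+
  show "(p, t *\<^sub>R \<eta>) \<in> \<D>" "ray p \<eta> t \<in> S"
    "tangent_norm g (ray p \<eta> t) (velocity A (ray p \<eta>) {0..1} t) = speed p \<eta>" if "t \<in> {0..1}" for t
    using * that by blast+
qed

lemma exp_domain_connect:
  assumes "p \<in> S" "q \<in> S"
  obtains \<eta> where "(p, \<eta>) \<in> \<D>" "q = riem_exp A g p \<eta>"
proof -
  have "\<forall>p\<in>S. \<forall>q\<in>S. \<exists>\<eta>. (p, \<eta>) \<in> \<D> \<and> q = riem_exp A g p \<eta>"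
    using exp_dom unfolding exp_domain_def by (rule conjunct2)
  with assms show ?thesis using that by blast
qed

lemma speed_nonneg: "(p, \<eta>) \<in> \<D> \<Longrightarrow> 0 \<le> speed p \<eta>"
  using dS_nonneg[of p "riem_exp A g p \<eta>"] exp_domainD(8)[of p \<eta>] by simp

lemma ray_field_0:
  assumes D: "(p, \<eta>) \<in> \<D>"
  shows "ray_field p \<eta> 0 = B p \<eta>"
proof -
  have "exp_defined A g p (t *\<^sub>R \<eta>)" if "t \<in> {0..1}" for t
    by (rule exp_domainD(2)[OF exp_domainD(3)[OF D that]])
  then have "velocity A (ray p \<eta>) {0..1} 0 = \<eta>" by (rule velocity_riem_exp_0[OF atlas metric])
  then show ?thesis unfolding ray_field_def exp_domainD(5)[OF D] by simp
qed

lemma ray_Lipschitz: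
  assumes D: "(p, \<eta>) \<in> \<D>" and st: "s \<in> {0..1}" "t \<in> {0..1}"
  shows "dS (ray p \<eta> s) (ray p \<eta> t) \<le> speed p \<eta> * \<bar>s - t\<bar>"
proof (rule geodesic_riem_dist_le[OF atlas metric exp_domainD(4)[OF D] _ exp_domainD(7)[OF D] st])
  show "ray p \<eta> ` {0..1} \<subseteq> S" by (rule image_subsetI) (rule exp_domainD(6)[OF D])
qed

text \<open>The spatial bounds on \<open>B\<close> are available only on \<open>\<D>\<close>, which need not contain the velocities of a ray
  at later times.  Hence everything is compared with time \<open>0\<close>.\<close>

lemma ray_field_time:
  assumes D: "(p, \<eta>) \<in> \<D>" and st: "s \<in> {0..1}" "t \<in> {0..1}"
  shows "norm (ray_field p \<eta> s x - ray_field p \<eta> t x) \<le> C0 * (speed p \<eta>)^2 * \<bar>s - t\<bar>"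
proof -
  have "\<forall>r\<in>{0..1}. \<exists>w. ((\<lambda>s. ray_field p \<eta> s x) has_vector_derivative w) (at r within {0..1}) \<and>
      norm w \<le> C0 * (speed p \<eta>)^2"
    unfolding ray_field_def by (intro ballI B_time[OF D])
  from bchoice[OF this] obtain w where
    w: "\<And>r. r \<in> {0..1} \<Longrightarrow> ((\<lambda>s. ray_field p \<eta> s x) has_vector_derivative w r) (at r within {0..1})"
    "\<And>r. r \<in> {0..1} \<Longrightarrow> norm (w r) \<le> C0 * (speed p \<eta>)^2"
    by blast
  have "norm (ray_field p \<eta> s x - ray_field p \<eta> t x) \<le> C0 * (speed p \<eta>)^2 * norm (s - t)"
  proof (rule differentiable_bound[of "{0..1}" "\<lambda>s. ray_field p \<eta> s x" "\<lambda>r h. h *\<^sub>R w r"])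
    show "((\<lambda>s. ray_field p \<eta> s x) has_derivative (\<lambda>h. h *\<^sub>R w r)) (at r within {0..1})" if "r \<in> {0..1}" for r
      using w(1)[OF that] by (simp add: has_vector_derivative_def)
    show "onorm (\<lambda>h. h *\<^sub>R w r) \<le> C0 * (speed p \<eta>)^2" if "r \<in> {0..1}" for r
      using w(2)[OF that] by (intro onorm_le) (simp add: mult.commute[of "C0 * (speed p \<eta>)^2"] mult_left_mono)
  qed (use st in auto)
  then show ?thesis by simp
qed

lemma field_bounds:
  assumes D: "(p, \<eta>) \<in> \<D>"
  shows "norm (B p \<eta> x) \<le> C0 * speed p \<eta>" "norm (B p \<eta> x - B p \<eta> y) \<le> C0 * speed p \<eta> * norm (x - y)"
proof -
  have "0 \<le> C0 * speed p \<eta>" using C0 speed_nonneg[OF D] by simp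
  then obtain f' :: "'a \<Rightarrow> 'a \<Rightarrow>\<^sub>L 'a" where f': "continuous_on UNIV f'"
      "\<And>x. (B p \<eta> has_derivative blinfun_apply (f' x)) (at x)"
      "\<And>x. norm (B p \<eta> x) \<le> C0 * speed p \<eta>" "\<And>x. norm (f' x) \<le> C0 * speed p \<eta>"
    by (rule C1_field_bounds[OF B_C1[OF exp_domainD(1)[OF D]] B_norm[OF D]]) simp_all
  show "norm (B p \<eta> x) \<le> C0 * speed p \<eta>" by (rule f'(3))
  show "norm (B p \<eta> x - B p \<eta> y) \<le> C0 * speed p \<eta> * norm (x - y)"
    using f'(2,4) by (rule norm_diff_le_derivative_bound)
qed

text \<open>For a ray of speed \<open>n\<close> the flow has \<beta> = C0 n and \<kappa> = C0 n^2.
  Then \<open>drift\<close> is the particle speed \<beta> + \<kappa>, and \<open>err\<close> below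
  is \<open>rate\<close>; for bounded \<open>n\<close> they are of order n and n^2.\<close>

definition drift :: "real \<Rightarrow> real"
  where "drift n = C0 * n + C0 * n^2"

definition err :: "real \<Rightarrow> real"
  where "err n = C0 * n^2 + C0 * n * drift n"

text \<open>The interface to the flow: assumption (iv) is applied to the ray, which is Lipschitz,
  and all later arguments use the flow only through these five properties.\<close>

lemma ray_flow:
  assumes D: "(p, \<eta>) \<in> \<D>"
  obtains \<psi> where "\<And>t. t \<in> {0..1} \<Longrightarrow> \<psi> t \<in> borel_measurable borel"
    "\<And>t. t \<in> {0..1} \<Longrightarrow> E (ray p \<eta> t) = distr (E p) borel (\<psi> t)"
    "\<And>t x. x \<in> \<Omega> \<Longrightarrow> t \<in> {0..1} \<Longrightarrow> norm (\<psi> t x - x) \<le> drift (speed p \<eta>) * t"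
    "\<And>t x. x \<in> \<Omega> \<Longrightarrow> t \<in> {0..1} \<Longrightarrow> norm (\<psi> t x - x - t *\<^sub>R B p \<eta> x) \<le> err (speed p \<eta>) * t^2"
    "energy \<Omega> (\<lambda>t. E (ray p \<eta> t)) \<le> ennreal ((LINT x|E p. (norm (B p \<eta> x))^2)
        + 2 * (C0 * speed p \<eta>) * err (speed p \<eta>) + (err (speed p \<eta>))^2)"
proof -
  let ?n = "speed p \<eta>"
  have n: "0 \<le> ?n" by (rule speed_nonneg[OF D])
  note d = exp_domainD[OF D]
  have "ray p \<eta> ` {0..1} \<subseteq> S \<and> (\<exists>L. \<forall>s\<in>{0..1}. \<forall>t\<in>{0..1}. dS (ray p \<eta> s) (ray p \<eta> t) \<le> L * \<bar>s - t\<bar>)"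
    using d(6) ray_Lipschitz[OF D] by blast
  from transports[unfolded transports_along_curves_def, THEN spec, THEN mp, OF this]
  obtain \<phi> where \<phi>: "flow_solution \<Omega> (ray_field p \<eta>) \<phi>"
    "\<And>t. t \<in> {0..1} \<Longrightarrow> E (ray p \<eta> t) = distr (restrict_space (E p) \<Omega>) borel (\<phi> t)"
    unfolding d(5) ray_field_def[symmetric, abs_def] by blast
  interpret bounded_flow \<Omega> "E p" "ray_field p \<eta>" \<phi> "C0 * ?n" "C0 * ?n^2"
  proof
    show "compact \<Omega>" by (rule \<Omega>)
    show "E p \<in> prob_measures_on \<Omega>" by (rule E_prob[OF d(1)])
    show "0 \<le> C0 * ?n" "0 \<le> C0 * ?n^2" using C0 n by auto
    show "norm (ray_field p \<eta> 0 x) \<le> C0 * ?n" for x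
      unfolding ray_field_0[OF D] by (rule field_bounds(1)[OF D])
    show "norm (ray_field p \<eta> 0 x - ray_field p \<eta> 0 y) \<le> C0 * ?n * norm (x - y)" for x y
      unfolding ray_field_0[OF D] by (rule field_bounds(2)[OF D])
    show "norm (ray_field p \<eta> s x - ray_field p \<eta> t x) \<le> C0 * ?n^2 * \<bar>s - t\<bar>" if "s \<in> {0..1}" "t \<in> {0..1}" for s t x
      by (rule ray_field_time[OF D that])
    show "continuous_on UNIV (ray_field p \<eta> t)" if "t \<in> {0..1}" for t
      unfolding ray_field_def by (rule C1_field_continuous[OF B_C1[OF d(6)[OF that]]])
    show "flow_solution \<Omega> (ray_field p \<eta>) \<phi>" by (rule \<phi>(1))
    show "distr (restrict_space (E p) \<Omega>) borel (\<phi> t) \<in> prob_measures_on \<Omega>" if "t \<in> {0..1}" for t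
      using \<phi>(2)[OF that] E_prob[OF d(6)[OF that]] by simp
  qed
  have r: "rate = err ?n" by (simp add: rate_def err_def drift_def)
  have E\<psi>: "E (ray p \<eta> t) = distr (E p) borel (\<psi> t)" if "t \<in> {0..1}" for t
    using \<phi>(2)[OF that] push_eq[OF that] by simp
  show ?thesis
  proof (rule that[of \<psi>])
    show "\<psi> t \<in> borel_measurable borel" if "t \<in> {0..1}" for t by (rule \<psi>_measurable[OF that])
    show "E (ray p \<eta> t) = distr (E p) borel (\<psi> t)" if "t \<in> {0..1}" for t by (rule E\<psi>[OF that])
    show "norm (\<psi> t x - x) \<le> drift ?n * t" if "x \<in> \<Omega>" "t \<in> {0..1}" for t x
      using \<psi>_displacement[OF that] by (simp add: drift_def)
    show "norm (\<psi> t x - x - t *\<^sub>R B p \<eta> x) \<le> err ?n * t^2" if "x \<in> \<Omega>" "t \<in> {0..1}" for t x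
      using \<psi>_expansion[OF that] by (simp add: r ray_field_0[OF D])
    show "energy \<Omega> (\<lambda>t. E (ray p \<eta> t)) \<le> ennreal ((LINT x|E p. (norm (B p \<eta> x))^2)
        + 2 * (C0 * ?n) * err ?n + (err ?n)^2)"
      using energy_le[of "\<lambda>t. E (ray p \<eta> t)"] E\<psi> by (simp add: r ray_field_0[OF D])
  qed
qed

lemma drift_nonneg: "0 \<le> n \<Longrightarrow> 0 \<le> drift n" and err_nonneg: "0 \<le> n \<Longrightarrow> 0 \<le> err n"
  using C0 by (simp_all add: drift_def err_def)

lemma ray_curve: 
  assumes D: "(p, \<eta>) \<in> \<D>"
  shows "(\<lambda>t. E (ray p \<eta> t)) \<in> W_Lipschitz_curves (E ` S)"
proof -
  have "W (E (ray p \<eta> s)) (E (ray p \<eta> t)) \<le> K * speed p \<eta> * \<bar>s - t\<bar>" if "s \<in> {0..1}" "t \<in> {0..1}" for s t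
  proof -
    have "W (E (ray p \<eta> s)) (E (ray p \<eta> t)) \<le> K * dS (ray p \<eta> s) (ray p \<eta> t)"
      using exp_domainD(6)[OF D] that by (intro W_le_dist)
    also have "\<dots> \<le> K * (speed p \<eta> * \<bar>s - t\<bar>)" using ray_Lipschitz[OF D that] K by (rule mult_left_mono)
    finally show ?thesis by (simp add: mult_ac)
  qed
  then show ?thesis using exp_domainD(6)[OF D] unfolding W_Lipschitz_curves_def by blast
qed

section \<open>Potentials along rays and comparison of the two distances\<close>

text \<open>The gradient \<open>u\<close> is unrelated to the direction \<eta> of the ray, so one
  potential can later be tested against two rays. The \<open>err\<close> term is the second-order
  error of the flow, the \<open>drift\<close> term the Taylor remainder of \<open>f\<close>.\<close>

lemma potential_increment:
  assumes D: "(p, \<eta>) \<in> \<D>" and t: "t \<in> {0..1}"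
    and f: "\<And>x. GDERIV f x :> u x" and u: "\<And>x. norm (u x) \<le> M" "\<And>x y. norm (u x - u y) \<le> M * norm (x - y)"
  shows "\<bar>(LINT x|E (ray p \<eta> t). f x) - (LINT x|E p. f x) - t * (LINT x|E p. u x \<bullet> B p \<eta> x)\<bar>
    \<le> M * (err (speed p \<eta>) + (drift (speed p \<eta>))^2) * t^2"
proof -
  let ?n = "speed p \<eta>"
  obtain \<psi> where \<psi>: "\<psi> t \<in> borel_measurable borel" "E (ray p \<eta> t) = distr (E p) borel (\<psi> t)"
    "\<And>x. x \<in> \<Omega> \<Longrightarrow> norm (\<psi> t x - x) \<le> drift ?n * t"
    "\<And>x. x \<in> \<Omega> \<Longrightarrow> norm (\<psi> t x - x - t *\<^sub>R B p \<eta> x) \<le> err ?n * t^2"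
    using ray_flow[OF D] t by metis
  have pS: "p \<in> S" by (rule exp_domainD(1)[OF D])
  note P = prob_measures_onD[OF E_prob[OF pS] closed_\<Omega>]
  interpret prob_space "E p" by (rule P(1))
  have M: "0 \<le> M" using order_trans[OF norm_ge_zero u(1)] .
  have fc: "continuous_on UNIV f" using gradient_has_derivative[OF f] by (intro has_derivative_continuous_on)
  have uc: "continuous_on UNIV u" using u(2) by (intro bounded_lipschitz_continuous[of u M]) (simp add: dist_norm)
  have bc: "continuous_on UNIV (B p \<eta>)"
    using field_bounds(2)[OF D] by (intro bounded_lipschitz_continuous[of _ "C0 * ?n"]) (simp add: dist_norm)
  note int = integrable_continuous_prob_measure[OF E_prob[OF pS] \<Omega>]
  have fi: "integrable (E p) f" by (rule int[OF fc])
  have ubi: "integrable (E p) (\<lambda>x. u x \<bullet> B p \<eta> x)" by (intro int continuous_intros uc bc)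
  have \<psi>m: "\<psi> t \<in> E p \<rightarrow>\<^sub>M borel" unfolding measurable_cong_sets[OF P(2) refl] by (rule \<psi>(1))
  have fm: "f \<in> borel_measurable borel" using fc by (rule borel_measurable_continuous_onI)
  have "integrable (distr (E p) borel (\<psi> t)) f"
    using integrable_continuous_prob_measure[OF E_prob[OF exp_domainD(6)[OF D t]] \<Omega> fc] \<psi>(2) by simp
  then have f\<psi>i: "integrable (E p) (\<lambda>x. f (\<psi> t x))" using integrable_distr[OF \<psi>m] by blast
  let ?c = "M * (err ?n + (drift ?n)^2) * t^2"
  have pw: "AE x in E p. norm (f (\<psi> t x) - f x - t * (u x \<bullet> B p \<eta> x)) \<le> ?c"
    using P(3)
  proof eventually_elim
    case (elim x)
    let ?y = "\<psi> t x"
    have 1: "\<bar>f ?y - f x - u x \<bullet> (?y - x)\<bar> \<le> M * (norm (?y - x))^2"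
      by (rule gradient_taylor[OF f u(2)])
    have "(norm (?y - x))^2 \<le> (drift ?n * t)^2" using \<psi>(3)[OF elim] by (intro power_mono) auto
    then have 2: "M * (norm (?y - x))^2 \<le> M * (drift ?n * t)^2" using M by (rule mult_left_mono)
    have "\<bar>u x \<bullet> (?y - x - t *\<^sub>R B p \<eta> x)\<bar> \<le> norm (u x) * norm (?y - x - t *\<^sub>R B p \<eta> x)"
      by (rule Cauchy_Schwarz_ineq2)
    also have "\<dots> \<le> M * (err ?n * t^2)" using u(1)[of x] \<psi>(4)[OF elim] M by (intro mult_mono) auto
    finally have 3: "\<bar>u x \<bullet> (?y - x) - t * (u x \<bullet> B p \<eta> x)\<bar> \<le> M * (err ?n * t^2)"
      by (simp add: inner_diff_right)
    have "\<bar>f ?y - f x - t * (u x \<bullet> B p \<eta> x)\<bar> \<le> M * (drift ?n * t)^2 + M * (err ?n * t^2)"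
      using 1 2 3 by linarith
    also have "\<dots> = ?c" by (simp add: algebra_simps power_mult_distrib)
    finally show ?case by simp
  qed
  have "(LINT x|E (ray p \<eta> t). f x) - (LINT x|E p. f x) - t * (LINT x|E p. u x \<bullet> B p \<eta> x)
      = (LINT x|E p. f (\<psi> t x) - f x - t * (u x \<bullet> B p \<eta> x))"
    unfolding \<psi>(2) integral_distr[OF \<psi>m fm] using f\<psi>i fi ubi by simp
  also have "\<bar>\<dots>\<bar> \<le> (LINT x|E p. norm (f (\<psi> t x) - f x - t * (u x \<bullet> B p \<eta> x)))"
    using integral_norm_bound[of "E p" "\<lambda>x. f (\<psi> t x) - f x - t * (u x \<bullet> B p \<eta> x)"] by simp
  also have "\<dots> \<le> (LINT x|E p. ?c)"
    using f\<psi>i fi ubi pw by (intro integral_mono_AE) auto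
  also have "\<dots> = ?c" by (simp add: prob_space)
  finally show ?thesis .
qed

lemma potential_exists:
  assumes "p \<in> S"
  obtains f where "\<And>x. GDERIV f x :> B p \<eta> x"
  using B_gradient[OF assms, of \<eta>] unfolding gradient_field_def by blast

lemma ray_W_restr:
  assumes D: "(p, \<eta>) \<in> \<D>" and q: "q = riem_exp A g p \<eta>"
  shows "0 \<le> W_restr \<Omega> (E ` S) (E p) (E q)"
    "(W_restr \<Omega> (E ` S) (E p) (E q))^2 \<le> (LINT x|E p. (norm (B p \<eta> x))^2)
        + 2 * (C0 * speed p \<eta>) * err (speed p \<eta>) + (err (speed p \<eta>))^2"
    "\<exists>\<rho>\<in>W_Lipschitz_curves (E ` S). \<rho> 0 = E p \<and> \<rho> 1 = E q \<and> energy \<Omega> \<rho> < \<infinity>"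
proof -
  let ?n = "speed p \<eta>" and ?\<rho> = "\<lambda>t. E (ray p \<eta> t)"
  let ?e = "(LINT x|E p. (norm (B p \<eta> x))^2) + 2 * (C0 * ?n) * err ?n + (err ?n)^2"
  have n: "0 \<le> ?n" by (rule speed_nonneg[OF D])
  have e: "energy \<Omega> ?\<rho> \<le> ennreal ?e" by (rule ray_flow[OF D])
  have 0: "?\<rho> 0 = E p" "?\<rho> 1 = E q" using exp_domainD(5)[OF D] q by auto
  have "0 \<le> ?e" using C0 n err_nonneg[OF n] by (intro add_nonneg_nonneg mult_nonneg_nonneg) auto
  from W_restr_upper_bound[OF ray_curve[OF D] 0 e this]
  show "0 \<le> W_restr \<Omega> (E ` S) (E p) (E q)" "(W_restr \<Omega> (E ` S) (E p) (E q))^2 \<le> ?e" by auto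
  have "energy \<Omega> ?\<rho> < \<infinity>" using e by (rule order_le_less_trans) simp
  then show "\<exists>\<rho>\<in>W_Lipschitz_curves (E ` S). \<rho> 0 = E p \<and> \<rho> 1 = E q \<and> energy \<Omega> \<rho> < \<infinity>"
    using 0 by (intro bexI[OF _ ray_curve[OF D]] conjI)
qed

text \<open>The lower bound for \<open>W\<close> with parameter 1 and the potential of
  \<open>B p \<eta>\<close> itself: the increment of the potential is then the squared norm of the
  field up to third order in the speed, so twice the increment minus this square returns it.\<close>

lemma ray_speed_le_W:
  assumes D: "(p, \<eta>) \<in> \<D>" and q: "q = riem_exp A g p \<eta>"
  shows "(LINT x|E p. (norm (B p \<eta> x))^2) \<le> (1 + 2 * (C0 * speed p \<eta>)) * (W (E p) (E q))^2
    + 2 * (C0 * speed p \<eta>) * (err (speed p \<eta>) + (drift (speed p \<eta>))^2)"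
proof -
  let ?n = "speed p \<eta>"
  have pS: "p \<in> S" by (rule exp_domainD(1)[OF D])
  have qS: "q \<in> S" using exp_domainD(6)[OF D, of 1] q by simp
  obtain f where f: "\<And>x. GDERIV f x :> B p \<eta> x" using potential_exists[OF pS] by blast
  have "0 \<le> C0 * ?n" using C0 speed_nonneg[OF D] by simp
  from W_sq_lower_bound[OF E_prob[OF pS] E_prob[OF qS] \<Omega> f field_bounds(2)[OF D] this, of 1]
  have 1: "2 * ((LINT x|E q. f x) - (LINT x|E p. f x)) - (LINT x|E p. (norm (B p \<eta> x))^2)
      \<le> (1 + 2 * (C0 * ?n)) * (W (E p) (E q))^2" by simp
  have "\<bar>(LINT x|E q. f x) - (LINT x|E p. f x) - (LINT x|E p. (norm (B p \<eta> x))^2)\<bar>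
      \<le> C0 * ?n * (err ?n + (drift ?n)^2)"
    using potential_increment[OF D, of 1 f "B p \<eta>", OF _ f field_bounds[OF D]]
    by (simp add: q power2_norm_eq_inner)
  with 1 show ?thesis by (simp add: algebra_simps)
qed

text \<open>A single ray joins the two points. Its energy is the squared norm of its initial field
  up to third order in the distance, and so is the lower bound for the square of \<open>W\<close>.
  This lets later upper bounds for \<open>W\<close> serve for \<open>W_restr\<close>.\<close>

lemma W_restr_le_W:
  obtains C where "0 \<le> C" "\<And>p q. p \<in> S \<Longrightarrow> q \<in> S \<Longrightarrow> dS p q \<le> 1 \<Longrightarrow>
    (W_restr \<Omega> (E ` S) (E p) (E q))^2 \<le> (W (E p) (E q))^2 + C * (dS p q)^3"
proof -
  \<comment> \<open>For n at most 1, \<open>drift n\<close> is at most 2 C0 n, hence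
    \<open>err n\<close> at most R n^2. The summands of \<open>C\<close> come from the factor in
    front of W^2 and the remainder in \<open>ray_speed_le_W\<close>, then from the two energy errors
    in \<open>ray_W_restr\<close>.\<close>
  define R where "R = C0 + 2 * C0^2"
  have R: "0 \<le> R" using C0 by (simp add: R_def)
  define C where "C = 2 * C0 * K^2 + 2 * C0 * (R + 4 * C0^2) + 2 * C0 * R + R^2"
  have C: "0 \<le> C" using C0 R by (simp add: C_def)
  show ?thesis
  proof (rule that[OF C])
    fix p q assume p: "p \<in> S" and q: "q \<in> S" and d1: "dS p q \<le> 1"
    obtain \<eta> where D: "(p, \<eta>) \<in> \<D>" and qe: "q = riem_exp A g p \<eta>" by (rule exp_domain_connect[OF p q])
    define n where "n = dS p q"
    have n: "speed p \<eta> = n" "0 \<le> n" "n \<le> 1"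
      using exp_domainD(8)[OF D] qe dS_nonneg d1 by (auto simp: n_def)
    have nn: "n^2 \<le> n" "n^4 \<le> n^3" using n power_decreasing[of 1 2 n] power_decreasing[of 3 4 n] by auto
    have dr: "drift n \<le> 2 * C0 * n" using nn C0 by (simp add: drift_def)
    have dr2: "(drift n)^2 \<le> 4 * C0^2 * n^2"
      using power_mono[OF dr drift_nonneg[OF n(2)], of 2] by (simp add: power_mult_distrib)
    have er: "err n \<le> R * n^2"
    proof -
      have "C0 * n * drift n \<le> C0 * n * (2 * C0 * n)" using dr C0 n by (intro mult_left_mono) auto
      then show ?thesis by (simp add: err_def R_def algebra_simps power2_eq_square)
    qed
    have er2: "(err n)^2 \<le> R^2 * n^3"
    proof -
      have "(err n)^2 \<le> (R * n^2)^2" using er err_nonneg[OF n(2)] by (rule power_mono)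
      also have "\<dots> = R^2 * n^4" by (simp add: power_mult_distrib flip: power_mult)
      also have "\<dots> \<le> R^2 * n^3" using nn by (intro mult_left_mono) auto
      finally show ?thesis .
    qed
    have a: "C0 * n * err n \<le> C0 * R * n^3"
      using mult_left_mono[OF er, of "C0 * n"] C0 n by (simp add: power2_eq_square power3_eq_cube mult_ac)
    have b: "C0 * n * (drift n)^2 \<le> C0 * (4 * C0^2) * n^3"
      using mult_left_mono[OF dr2, of "C0 * n"] C0 n by (simp add: power2_eq_square power3_eq_cube mult_ac)
    have "W (E p) (E q) \<le> K * n" using W_le_dist[OF p q] by (simp add: n_def)
    then have "(W (E p) (E q))^2 \<le> (K * n)^2" by (intro power_mono) auto
    from mult_left_mono[OF this, of "2 * (C0 * n)"]
    have c: "2 * (C0 * n) * (W (E p) (E q))^2 \<le> 2 * C0 * K^2 * n^3"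
      using C0 n by (simp add: power_mult_distrib power2_eq_square power3_eq_cube mult_ac)
    have "(W_restr \<Omega> (E ` S) (E p) (E q))^2 \<le> (1 + 2 * (C0 * n)) * (W (E p) (E q))^2
        + 2 * (C0 * n) * (err n + (drift n)^2) + 2 * (C0 * n) * err n + (err n)^2"
      using ray_W_restr(2)[OF D qe] ray_speed_le_W[OF D qe] unfolding n(1) by linarith
    also have "\<dots> = (W (E p) (E q))^2 + 2 * (C0 * n) * (W (E p) (E q))^2
        + 2 * (C0 * n * err n) + 2 * (C0 * n * (drift n)^2) + 2 * (C0 * n * err n) + (err n)^2"
      by (simp add: algebra_simps)
    also have "\<dots> \<le> (W (E p) (E q))^2 + 2 * C0 * K^2 * n^3
        + 2 * (C0 * R * n^3) + 2 * (C0 * (4 * C0^2) * n^3) + 2 * (C0 * R * n^3) + R^2 * n^3"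
      using a b c er2 by (intro add_mono mult_left_mono) auto
    also have "\<dots> = (W (E p) (E q))^2 + C * n^3" by (simp add: C_def algebra_simps)
    finally show "(W_restr \<Omega> (E ` S) (E p) (E q))^2 \<le> (W (E p) (E q))^2 + C * (dS p q)^3"
      by (simp add: n_def)
  qed
qed

lemma W_restr_nonneg: "p \<in> S \<Longrightarrow> q \<in> S \<Longrightarrow> 0 \<le> W_restr \<Omega> (E ` S) (E p) (E q)"
  by (rule exp_domain_connect[of p q], assumption+) (rule ray_W_restr(1))

lemma W_self: "p \<in> S \<Longrightarrow> W (E p) (E p) = 0"
proof -
  assume p: "p \<in> S"
  note P = prob_measures_onD[OF E_prob[OF p] closed_\<Omega>]
  have "distr (E p) borel (\<lambda>x. x) = E p" using P(2) by (intro distr_id2) simp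
  then show ?thesis
    using W_sq_le_maps[OF P(2), of "\<lambda>x. x" "\<lambda>x. x" \<Omega>] \<Omega> E_prob[OF p] by simp
qed

text \<open>Needed as the value at time 0 in the derivative. The lower Lipschitz bound forces
  \<open>dS p p = 0\<close>, and then the comparison with \<open>W\<close> leaves no error.\<close>

lemma W_restr_self: "p \<in> S \<Longrightarrow> W_restr \<Omega> (E ` S) (E p) (E p) = 0"
proof -
  assume p: "p \<in> S"
  have "k * dS p p \<le> 0" using dist_le_W[OF p p] W_self[OF p] by simp
  then have d: "dS p p = 0" using k dS_nonneg[of p p] by (simp add: mult_le_0_iff)
  obtain C where "\<And>p q. p \<in> S \<Longrightarrow> q \<in> S \<Longrightarrow> dS p q \<le> 1 \<Longrightarrow>
    (W_restr \<Omega> (E ` S) (E p) (E q))^2 \<le> (W (E p) (E q))^2 + C * (dS p q)^3"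
    using W_restr_le_W by blast
  from this[OF p p] d W_self[OF p] show ?thesis by simp
qed

end


section \<open>Optimal maps along a ray\<close>

lemma integrable_continuous_pair:
  fixes T :: "'a::euclidean_space \<Rightarrow> 'a" and q :: "'a \<times> 'a \<Rightarrow> real"
  assumes \<mu>: "\<mu> \<in> prob_measures_on \<Omega>" and \<Omega>: "compact \<Omega>" and T: "T \<in> borel_measurable borel"
    and ae: "AE x in \<mu>. T x \<in> \<Omega>" and q: "continuous_on UNIV q"
  shows "integrable \<mu> (\<lambda>x. q (x, T x))"
proof -
  note P = prob_measures_onD[OF \<mu> compact_imp_closed[OF \<Omega>]]
  interpret prob_space \<mu> by (rule P(1))
  have "compact (q ` (\<Omega> \<times> \<Omega>))"
    by (intro compact_continuous_image continuous_on_subset[OF q] compact_Times \<Omega>) auto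
  then have "bounded (q ` (\<Omega> \<times> \<Omega>))" by (rule compact_imp_bounded)
  then obtain C where "\<forall>y\<in>q ` (\<Omega> \<times> \<Omega>). norm y \<le> C" unfolding bounded_iff by blast
  then have C: "norm (q z) \<le> C" if "z \<in> \<Omega> \<times> \<Omega>" for z using that by blast
  show ?thesis
  proof (rule integrable_const_bound)
    show "AE x in \<mu>. norm (q (x, T x)) \<le> C"
      using P(3) ae by eventually_elim (rule C, simp)
    have "(\<lambda>x. (x, T x)) \<in> borel_measurable borel" by (intro borel_measurable_Pair T) simp
    then have "(\<lambda>x. q (x, T x)) \<in> borel_measurable borel"
      by (rule measurable_compose[OF _ borel_measurable_continuous_onI[OF q]])
    then show "(\<lambda>x. q (x, T x)) \<in> borel_measurable \<mu>"
      unfolding measurable_cong_sets[OF P(2) refl] .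
  qed
qed

context wasserstein_submanifold
begin

lemma field_continuous: "p \<in> S \<Longrightarrow> continuous_on UNIV (B p \<eta>)"
  by (rule C1_field_continuous[OF B_C1])

text \<open>The square expands to \<open>Q - 2 * t * V + t^2 * N\<close>. With Q at most t^2 N +
  O(t^3) and V at least t N - O(t^2), the leading terms cancel and O(t^3) remains.\<close>

lemma optimal_map_expansion:
  assumes D: "(p, \<eta>) \<in> \<D>" and t: "t \<in> {0..1}"
    and T: "optimal_transport_map (E p) (E (ray p \<eta> t)) T"
  shows "T \<in> borel_measurable borel" "AE x in E p. T x \<in> \<Omega>"
    "(LINT x|E p. (norm (T x - x - t *\<^sub>R B p \<eta> x))^2)
      \<le> (4 * (C0 * speed p \<eta>) * (err (speed p \<eta>) + (drift (speed p \<eta>))^2) + (err (speed p \<eta>))^2) * t^3"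
proof -
  define a r d where "a = C0 * speed p \<eta>" and "r = err (speed p \<eta>)" and "d = drift (speed p \<eta>)"
  note n = speed_nonneg[OF D]
  have ard: "0 \<le> a" "0 \<le> r" "0 \<le> d"
    using n C0 err_nonneg[OF n] drift_nonneg[OF n] by (auto simp: a_def r_def d_def)
  have t0: "0 \<le> t" "t \<le> 1" using t by auto
  let ?b = "B p \<eta>" and ?\<mu> = "E p" and ?\<nu> = "E (ray p \<eta> t)"
  have pS: "p \<in> S" by (rule exp_domainD(1)[OF D])
  have \<mu>: "?\<mu> \<in> prob_measures_on \<Omega>" and \<nu>: "?\<nu> \<in> prob_measures_on \<Omega>"
    using E_prob pS exp_domainD(6)[OF D t] by auto
  note P = prob_measures_onD[OF \<mu> closed_\<Omega>]
  interpret prob_space ?\<mu> by (rule P(1))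
  show Tm: "T \<in> borel_measurable borel" using T by (simp add: optimal_transport_map_def)
  have idm: "(\<lambda>x :: 'a. x) \<in> borel_measurable borel" by simp
  have id: "distr ?\<mu> borel (\<lambda>x. x) = ?\<mu>" using P(2) by (intro distr_id2) simp
  have opt: "optimal_coupling ?\<mu> ?\<nu> (distr ?\<mu> borel (\<lambda>x. (x, T x)))"
    using T by (simp add: optimal_transport_map_def)
  then have \<pi>: "distr ?\<mu> borel (\<lambda>x. (x, T x)) \<in> couplings ?\<mu> ?\<nu>" by (simp add: optimal_coupling_def)
  have \<nu>T: "?\<nu> = distr ?\<mu> borel T"
    using couplings_marginals(4)[OF \<pi>] couplings_marginals(4)[OF distr_pair_coupling(1)[OF P(2) idm Tm]] by simp
  have ran: "AE x in ?\<mu>. F x \<in> \<Omega>" if F: "F \<in> borel_measurable borel" "?\<nu> = distr ?\<mu> borel F" for F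
  proof (rule AE_distrD[where f = F and M' = borel])
    show "F \<in> ?\<mu> \<rightarrow>\<^sub>M borel" unfolding measurable_cong_sets[OF P(2) refl] by (rule F(1))
    show "AE x in distr ?\<mu> borel F. x \<in> \<Omega>" unfolding F(2)[symmetric] by (rule prob_measures_onD(3)[OF \<nu> closed_\<Omega>])
  qed
  show Tr: "AE x in ?\<mu>. T x \<in> \<Omega>" by (rule ran[OF Tm \<nu>T])
  obtain \<psi> where \<psi>: "\<psi> t \<in> borel_measurable borel" "?\<nu> = distr ?\<mu> borel (\<psi> t)"
    "\<And>x. x \<in> \<Omega> \<Longrightarrow> norm (\<psi> t x - x) \<le> d * t"
    "\<And>x. x \<in> \<Omega> \<Longrightarrow> norm (\<psi> t x - x - t *\<^sub>R ?b x) \<le> r * t^2"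
    using ray_flow[OF D] t unfolding r_def d_def by metis
  have \<psi>r: "AE x in ?\<mu>. \<psi> t x \<in> \<Omega>" by (rule ran[OF \<psi>(1,2)])
  have \<pi>': "distr ?\<mu> borel (\<lambda>x. (x, \<psi> t x)) \<in> couplings ?\<mu> ?\<nu>"
    using distr_pair_coupling(1)[OF P(2) idm \<psi>(1)] id \<psi>(2) by simp
  have bc: "continuous_on UNIV ?b" by (rule field_continuous[OF pS])
  obtain f where f: "\<And>x. GDERIV f x :> ?b x" using potential_exists[OF pS] by blast
  have fc: "continuous_on UNIV f" using gradient_has_derivative[OF f] by (intro has_derivative_continuous_on)
  note int = integrable_continuous_pair[OF \<mu> \<Omega>]
  have bc2: "continuous_on UNIV (\<lambda>z :: 'a \<times> 'a. ?b (fst z))"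
    by (intro continuous_on_compose2[OF bc] continuous_intros) auto
  have fc1: "continuous_on UNIV (\<lambda>z :: 'a \<times> 'a. f (fst z))" and fc2: "continuous_on UNIV (\<lambda>z :: 'a \<times> 'a. f (snd z))"
    by (intro continuous_on_compose2[OF fc] continuous_intros; auto)+
  have "continuous_on UNIV (\<lambda>z :: 'a \<times> 'a. (norm (snd z - fst z))^2)" by (intro continuous_intros)
  from int[OF Tm Tr this] int[OF \<psi>(1) \<psi>r this]
  have i1: "integrable ?\<mu> (\<lambda>x. (norm (T x - x))^2)" "integrable ?\<mu> (\<lambda>x. (norm (\<psi> t x - x))^2)" by simp_all
  have "continuous_on UNIV (\<lambda>z :: 'a \<times> 'a. ?b (fst z) \<bullet> (snd z - fst z))" by (intro continuous_intros bc2)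
  from int[OF Tm Tr this] have i2: "integrable ?\<mu> (\<lambda>x. ?b x \<bullet> (T x - x))" by simp
  have "continuous_on UNIV (\<lambda>z :: 'a \<times> 'a. (norm (?b (fst z)))^2)" by (intro continuous_intros bc2)
  from int[OF Tm Tr this] have i3: "integrable ?\<mu> (\<lambda>x. (norm (?b x))^2)" by simp
  have i4: "integrable ?\<mu> f" "integrable ?\<mu> (\<lambda>x. f (T x))"
    using int[OF Tm Tr fc1] int[OF Tm Tr fc2] by simp_all
  define Q N where "Q = (LINT x|?\<mu>. (norm (T x - x))^2)" and "N = (LINT x|?\<mu>. (norm (?b x))^2)"
  have Q1: "Q \<le> (LINT x|?\<mu>. (norm (\<psi> t x - x))^2)"
  proof -
    have "transport_cost (distr ?\<mu> borel (\<lambda>x. (x, T x))) \<le> transport_cost (distr ?\<mu> borel (\<lambda>x. (x, \<psi> t x)))"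
      using opt \<pi>' by (auto simp: optimal_coupling_def)
    then have "ennreal (LINT x|?\<mu>. (norm (x - T x))^2) \<le> ennreal (LINT x|?\<mu>. (norm (x - \<psi> t x))^2)"
      unfolding coupling_facts(5)[OF \<pi> \<mu> \<nu> \<Omega>] coupling_facts(5)[OF \<pi>' \<mu> \<nu> \<Omega>]
        distr_pair_coupling(2)[OF P(2) idm Tm] distr_pair_coupling(2)[OF P(2) idm \<psi>(1)] .
    then show ?thesis unfolding Q_def norm_minus_commute[of "T _"] norm_minus_commute[of "\<psi> t _"]
      by (simp add: ennreal_le_iff)
  qed
  have Q2: "Q \<le> t^2 * N + 2 * a * r * t^3 + r^2 * t^4"
  proof -
    have "(LINT x|?\<mu>. (norm (\<psi> t x - x))^2) \<le> (LINT x|?\<mu>. t^2 * (norm (?b x))^2 + (2 * a * r * t^3 + r^2 * t^4))"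
    proof (rule integral_mono_AE[OF i1(2)])
      show "AE x in ?\<mu>. (norm (\<psi> t x - x))^2 \<le> t^2 * (norm (?b x))^2 + (2 * a * r * t^3 + r^2 * t^4)"
        using P(3)
      proof eventually_elim
        case (elim x)
        have "norm (\<psi> t x - x) \<le> norm (t *\<^sub>R ?b x) + norm (\<psi> t x - x - t *\<^sub>R ?b x)"
          by (rule norm_triangle_sub)
        also have "\<dots> \<le> t * norm (?b x) + r * t^2" using \<psi>(4)[OF elim] t0 by simp
        finally have "(norm (\<psi> t x - x))^2 \<le> (t * norm (?b x) + r * t^2)^2" by (intro power_mono) auto
        also have "\<dots> = t^2 * (norm (?b x))^2 + (2 * (norm (?b x) * (r * t^3)) + r^2 * t^4)"
          by (simp add: power2_eq_square power3_eq_cube power4_eq_xxxx algebra_simps)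
        also have "\<dots> \<le> t^2 * (norm (?b x))^2 + (2 * (a * (r * t^3)) + r^2 * t^4)"
          using field_bounds(1)[OF D, of x] ard t0 by (intro add_mono mult_left_mono mult_right_mono) (auto simp: a_def)
        finally show ?case by (simp add: mult_ac)
      qed
    qed (use i3 in simp)
    also have "\<dots> = t^2 * N + 2 * a * r * t^3 + r^2 * t^4" using i3 by (simp add: N_def prob_space)
    finally show ?thesis using Q1 by simp
  qed
  \<comment> \<open>A cruder bound than \<open>Q2\<close>. It turns the Taylor remainder
    \<open>a * Q\<close> of the potential into a multiple of t^2.\<close>
  have Q3: "Q \<le> d^2 * t^2"
  proof -
    have "(LINT x|?\<mu>. (norm (\<psi> t x - x))^2) \<le> (LINT x|?\<mu>. (d * t)^2)"
    proof (rule integral_mono_AE[OF i1(2)])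
      show "AE x in ?\<mu>. (norm (\<psi> t x - x))^2 \<le> (d * t)^2"
        using P(3) by eventually_elim (rule power_mono, rule \<psi>(3), auto)
    qed simp
    then show ?thesis using Q1 by (simp add: prob_space power_mult_distrib)
  qed
  define V where "V = (LINT x|?\<mu>. ?b x \<bullet> (T x - x))"
  \<comment> \<open>The potential of the field is integrated against the same image measure in two
    ways: as image under the flow, which produces \<open>t * N\<close>, and as image under
    \<open>T\<close>, which brings in \<open>V\<close>.\<close>
  have fT: "(LINT x|?\<nu>. f x) = (LINT x|?\<mu>. f (T x))"
    unfolding \<nu>T using Tm borel_measurable_continuous_onI[OF fc]
    by (intro integral_distr) (simp_all add: measurable_cong_sets[OF P(2) refl])
  have "\<bar>(LINT x|?\<nu>. f x) - (LINT x|?\<mu>. f x) - t * N\<bar> \<le> a * (r + d^2) * t^2"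
    using potential_increment[OF D t f field_bounds[OF D]]
    unfolding N_def a_def r_def d_def power2_norm_eq_inner .
  then have "t * N - a * (r + d^2) * t^2 \<le> (LINT x|?\<mu>. f (T x)) - (LINT x|?\<mu>. f x)" unfolding fT by linarith
  also have "\<dots> = (LINT x|?\<mu>. f (T x) - f x)" using i4 by simp
  also have "\<dots> \<le> (LINT x|?\<mu>. ?b x \<bullet> (T x - x) + a * (norm (T x - x))^2)"
  proof (rule integral_mono)
    fix x
    show "f (T x) - f x \<le> ?b x \<bullet> (T x - x) + a * (norm (T x - x))^2"
      using gradient_taylor[OF f field_bounds(2)[OF D], of "T x" x] unfolding a_def by linarith
  qed (use i1 i2 i4 in auto)
  also have "\<dots> = V + a * Q" using i1 i2 by (simp add: V_def Q_def)
  finally have V: "t * N - a * (r + d^2) * t^2 \<le> V + a * Q" .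
  have "a * Q \<le> a * (d^2 * t^2)" using Q3 ard(1) by (rule mult_left_mono)
  then have V2: "t * N - a * (r + 2 * d^2) * t^2 \<le> V" using V by (simp add: algebra_simps)
  have V3: "2 * t * (t * N - a * (r + 2 * d^2) * t^2) \<le> 2 * t * V"
    using V2 by (rule mult_left_mono) (use t0 in simp)
  have "(LINT x|?\<mu>. (norm (T x - x - t *\<^sub>R ?b x))^2)
      = (LINT x|?\<mu>. (norm (T x - x))^2 - 2 * t * (?b x \<bullet> (T x - x)) + t^2 * (norm (?b x))^2)"
  proof (rule Bochner_Integration.integral_cong[OF refl])
    fix x
    show "(norm (T x - x - t *\<^sub>R ?b x))^2 = (norm (T x - x))^2 - 2 * t * (?b x \<bullet> (T x - x)) + t^2 * (norm (?b x))^2"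
      unfolding power2_norm_eq_inner inner_diff_left[of _ "t *\<^sub>R ?b x"] inner_diff_right[of _ _ "t *\<^sub>R ?b x"]
      by (simp add: inner_commute[of "T x - x" "?b x"] power2_eq_square)
  qed
  also have "\<dots> = Q - 2 * t * V + t^2 * N" using i1 i2 i3 by (simp add: Q_def V_def N_def)
  also have "\<dots> \<le> (t^2 * N + 2 * a * r * t^3 + r^2 * t^4) - 2 * t * (t * N - a * (r + 2 * d^2) * t^2) + t^2 * N"
    using Q2 V3 by linarith
  also have "\<dots> = 4 * a * (r + d^2) * t^3 + r^2 * t^4"
    by (simp add: algebra_simps power2_eq_square power3_eq_cube power4_eq_xxxx)
  also have "\<dots> \<le> 4 * a * (r + d^2) * t^3 + r^2 * t^3"
    using power_decreasing[of 3 4 t] t0 by (intro add_left_mono mult_left_mono) auto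
  finally show "(LINT x|?\<mu>. (norm (T x - x - t *\<^sub>R ?b x))^2)
      \<le> (4 * (C0 * speed p \<eta>) * (err (speed p \<eta>) + (drift (speed p \<eta>))^2) + (err (speed p \<eta>))^2) * t^3"
    by (simp add: a_def r_def d_def algebra_simps)
qed

end

section \<open>Two rays from a common point\<close>

locale two_rays = wasserstein_submanifold +
  fixes \<theta> \<eta>1 \<eta>2
  assumes D1: "(\<theta>, \<eta>1) \<in> \<D>" and D2: "(\<theta>, \<eta>2) \<in> \<D>"
begin

abbreviation "b1 \<equiv> B \<theta> \<eta>1"

abbreviation "b2 \<equiv> B \<theta> \<eta>2"

abbreviation "n1 \<equiv> speed \<theta> \<eta>1"

abbreviation "n2 \<equiv> speed \<theta> \<eta>2"

definition u where "u = B \<theta> (\<eta>2 - \<eta>1)"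

text \<open>The difference of the two directions need not lie in \<D>; its field inherits bounds
  from the two separate ones by linearity.\<close>

definition M where "M = C0 * (n1 + n2)"

definition N where "N = (LINT x|E \<theta>. (norm (u x))^2)"

lemma \<theta>: "\<theta> \<in> S"
  by (rule exp_domainD(1)[OF D1])

lemma u_eq: "u x = b2 x - b1 x"
  unfolding u_def by (rule linear_diff[OF B_linear[OF \<theta>]])

lemma M: "0 \<le> M"
  using C0 speed_nonneg[OF D1] speed_nonneg[OF D2] by (simp add: M_def)

lemma u_bounds:
  obtains u' :: "'a \<Rightarrow> 'a \<Rightarrow>\<^sub>L 'a" where "continuous_on UNIV u'"
    "\<And>x. (u has_derivative blinfun_apply (u' x)) (at x)" "\<And>x. norm (u x) \<le> M" "\<And>x. norm (u' x) \<le> M"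
proof -
  have c: "0 \<le> C0 * n1" "0 \<le> C0 * n2"
    using C0 speed_nonneg[OF D1] speed_nonneg[OF D2] by auto
  obtain f1 :: "'a \<Rightarrow> 'a \<Rightarrow>\<^sub>L 'a" where f1: "continuous_on UNIV f1" "\<And>x. (b1 has_derivative blinfun_apply (f1 x)) (at x)"
      "\<And>x. norm (b1 x) \<le> C0 * n1" "\<And>x. norm (f1 x) \<le> C0 * n1"
    by (rule C1_field_bounds[OF B_C1[OF \<theta>] B_norm[OF D1] c(1)]) simp_all
  obtain f2 :: "'a \<Rightarrow> 'a \<Rightarrow>\<^sub>L 'a" where f2: "continuous_on UNIV f2" "\<And>x. (b2 has_derivative blinfun_apply (f2 x)) (at x)"
      "\<And>x. norm (b2 x) \<le> C0 * n2" "\<And>x. norm (f2 x) \<le> C0 * n2"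
    by (rule C1_field_bounds[OF B_C1[OF \<theta>] B_norm[OF D2] c(2)]) simp_all
  show ?thesis
  proof (rule that[of "\<lambda>x. f2 x - f1 x"])
    show "continuous_on UNIV (\<lambda>x. f2 x - f1 x)" by (intro continuous_intros f1 f2)
    show "(u has_derivative blinfun_apply (f2 x - f1 x)) (at x)" for x
      unfolding u_eq[abs_def]
      by (rule has_derivative_eq_rhs[OF has_derivative_diff[OF f2(2) f1(2)]]) (simp add: blinfun.diff_left fun_eq_iff)
    show "norm (u x) \<le> M" for x
      using norm_triangle_ineq4[of "b2 x" "b1 x"] f1(3)[of x] f2(3)[of x]
      by (simp add: u_eq M_def algebra_simps)
    show "norm (f2 x - f1 x) \<le> M" for x
      using norm_triangle_ineq4[of "f2 x" "f1 x"] f1(4)[of x] f2(4)[of x] by (simp add: M_def algebra_simps)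
  qed
qed

lemma u_norm: "norm (u x) \<le> M"
proof -
  obtain u' :: "'a \<Rightarrow> 'a \<Rightarrow>\<^sub>L 'a" where u': "continuous_on UNIV u'"
    "\<And>x. (u has_derivative blinfun_apply (u' x)) (at x)" "\<And>x. norm (u x) \<le> M" "\<And>x. norm (u' x) \<le> M"
    by (rule u_bounds) simp_all
  show ?thesis by (rule u'(3))
qed

lemma u_lipschitz: "norm (u x - u y) \<le> M * norm (x - y)"
proof -
  obtain u' :: "'a \<Rightarrow> 'a \<Rightarrow>\<^sub>L 'a" where u': "continuous_on UNIV u'"
    "\<And>x. (u has_derivative blinfun_apply (u' x)) (at x)" "\<And>x. norm (u x) \<le> M" "\<And>x. norm (u' x) \<le> M"
    by (rule u_bounds) simp_all
  show ?thesis using u'(2,4) by (rule norm_diff_le_derivative_bound)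
qed

lemma u_continuous: "continuous_on UNIV u"
  unfolding u_def by (rule field_continuous[OF \<theta>])

text \<open>The bracket after \<open>2 * t\<close> is the error in the increment of the potential:
  the endpoints lie off the rays by \<delta>, and the rays have second-order terms. The last summand
  is the price of integrating the squared norm of \<open>u\<close> against \<open>E q1\<close>
  instead of \<open>E \<theta>\<close>.\<close>

definition defect where "defect \<delta>1 \<delta>2 t = 2 * t * (M * K * (\<delta>1 + \<delta>2)
  + M * (err (n1) + (drift (n1))^2 + (err (n2) + (drift (n2))^2)) * t^2)
  + t^2 * (2 * M^2 * K * (\<delta>1 + n1 * t))"

text \<open>One potential of \<open>u\<close> serves both distances. Its increments along the two
  rays have slopes given by the inner products of \<open>u\<close> with \<open>b1\<close> and
  \<open>b2\<close>, whose difference is \<open>N\<close>. Leaving the rays costs only a Lipschitz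
  constant times \<open>K\<close> times the distance.\<close>

lemma lower_bounds:
  assumes t: "0 < t" "t \<le> 1" and q: "q1 \<in> S" "q2 \<in> S"
    and \<delta>: "\<delta>1 = dS q1 (ray \<theta> \<eta>1 t)" "\<delta>2 = dS q2 (ray \<theta> \<eta>2 t)"
  shows "t^2 * N - defect \<delta>1 \<delta>2 t \<le> (1 + 2 * t * M) * (W (E q1) (E q2))^2"
    "t^2 * N - defect \<delta>1 \<delta>2 t - 2 * t^3 * M^4 \<le> (1 + t / 2) * (W_restr \<Omega> (E ` S) (E q1) (E q2))^2"
proof -
  have t01: "t \<in> {0..1}" using t by auto
  obtain f where f: "\<And>x. GDERIV f x :> u x" using potential_exists[OF \<theta>] unfolding u_def by blast
  have r: "ray \<theta> \<eta>1 t \<in> S" "ray \<theta> \<eta>2 t \<in> S" using exp_domainD(6)[OF D1 t01] exp_domainD(6)[OF D2 t01] by auto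
  let ?\<Delta> = "(LINT x|E q2. f x) - (LINT x|E q1. f x)" and ?H = "LINT x|E q1. (norm (u x))^2"
  define c1 c2 where "c1 = err (n1) + (drift (n1))^2"
    and "c2 = err (n2) + (drift (n2))^2"
  have near: "\<bar>(LINT x|E p. h x) - (LINT x|E q. h x)\<bar> \<le> L * (K * dS p q)"
    if "p \<in> S" "q \<in> S" "0 \<le> L" "\<And>x y. \<bar>h x - h y\<bar> \<le> L * norm (x - y)" for p q h L
  proof -
    have "\<bar>(LINT x|E p. h x) - (LINT x|E q. h x)\<bar> \<le> L * W (E p) (E q)"
      by (rule integral_diff_le_W[OF E_prob E_prob \<Omega>]) (use that in auto)
    also have "\<dots> \<le> L * (K * dS p q)" using W_le_dist that by (intro mult_left_mono) auto
    finally show ?thesis .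
  qed
  have flip: "\<bar>f x - f y\<bar> \<le> M * norm (x - y)" for x y by (rule gradient_lipschitz[OF f u_norm])
  have f1: "\<bar>(LINT x|E q1. f x) - (LINT x|E (ray \<theta> \<eta>1 t). f x)\<bar> \<le> M * (K * \<delta>1)"
    unfolding \<delta> by (rule near[OF q(1) r(1) M flip])
  have f2: "\<bar>(LINT x|E q2. f x) - (LINT x|E (ray \<theta> \<eta>2 t). f x)\<bar> \<le> M * (K * \<delta>2)"
    unfolding \<delta> by (rule near[OF q(2) r(2) M flip])
  have g1: "\<bar>(LINT x|E (ray \<theta> \<eta>1 t). f x) - (LINT x|E \<theta>. f x) - t * (LINT x|E \<theta>. u x \<bullet> b1 x)\<bar> \<le> M * c1 * t^2"
    unfolding c1_def by (rule potential_increment[OF D1 t01 f u_norm u_lipschitz])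
  have g2: "\<bar>(LINT x|E (ray \<theta> \<eta>2 t). f x) - (LINT x|E \<theta>. f x) - t * (LINT x|E \<theta>. u x \<bullet> b2 x)\<bar> \<le> M * c2 * t^2"
    unfolding c2_def by (rule potential_increment[OF D2 t01 f u_norm u_lipschitz])
  have Neq: "(LINT x|E \<theta>. u x \<bullet> b2 x) - (LINT x|E \<theta>. u x \<bullet> b1 x) = N"
  proof -
    have "integrable (E \<theta>) (\<lambda>x. u x \<bullet> B \<theta> \<eta> x)" for \<eta>
      by (intro integrable_continuous_prob_measure[OF E_prob[OF \<theta>] \<Omega>] continuous_intros u_continuous field_continuous[OF \<theta>])
    then have "(LINT x|E \<theta>. u x \<bullet> b2 x) - (LINT x|E \<theta>. u x \<bullet> b1 x)
        = (LINT x|E \<theta>. u x \<bullet> b2 x - u x \<bullet> b1 x)" by simp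
    also have "\<dots> = N" by (simp add: N_def power2_norm_eq_inner u_eq inner_diff_right)
    finally show ?thesis .
  qed
  have "\<bar>?\<Delta> - t * N\<bar> \<le> M * K * (\<delta>1 + \<delta>2) + M * (c1 + c2) * t^2"
    using f1 f2 g1 g2 unfolding Neq[symmetric] by (simp add: algebra_simps)
  then have \<Delta>: "t * N - (M * K * (\<delta>1 + \<delta>2) + M * (c1 + c2) * t^2) \<le> ?\<Delta>" by linarith
  have hlip: "\<bar>(norm (u x))^2 - (norm (u y))^2\<bar> \<le> 2 * M^2 * norm (x - y)" for x y
  proof -
    have "\<bar>(norm (u x))^2 - (norm (u y))^2\<bar> = \<bar>norm (u x) - norm (u y)\<bar> * (norm (u x) + norm (u y))"
      by (simp add: power2_eq_square square_diff_square_factored abs_mult)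
    also have "\<dots> \<le> (M * norm (x - y)) * (M + M)"
      using norm_triangle_ineq3[of "u x" "u y"] u_lipschitz[of x y] u_norm[of x] u_norm[of y] M
      by (intro mult_mono) auto
    finally show ?thesis by (simp add: power2_eq_square algebra_simps)
  qed
  have dr: "dS (ray \<theta> \<eta>1 t) \<theta> \<le> n1 * t"
    using ray_Lipschitz[OF D1 t01, of 0] exp_domainD(5)[OF D1] t by simp
  have "?H - N \<le> 2 * M^2 * (K * \<delta>1) + 2 * M^2 * (K * dS (ray \<theta> \<eta>1 t) \<theta>)"
    using near[OF q(1) r(1) _ hlip] near[OF r(1) \<theta> _ hlip] unfolding N_def \<delta> by simp
  also have "\<dots> \<le> 2 * M^2 * (K * \<delta>1) + 2 * M^2 * (K * (n1 * t))"
    using dr K by (intro add_left_mono mult_left_mono) auto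
  finally have H: "?H \<le> N + 2 * M^2 * K * (\<delta>1 + n1 * t)" by (simp add: algebra_simps)
  have "2 * t * (t * N - (M * K * (\<delta>1 + \<delta>2) + M * (c1 + c2) * t^2)) \<le> 2 * t * ?\<Delta>"
    using \<Delta> by (rule mult_left_mono) (use t in simp)
  moreover have "t^2 * ?H \<le> t^2 * (N + 2 * M^2 * K * (\<delta>1 + n1 * t))"
    using H by (rule mult_left_mono) simp
  moreover have "2 * t * (t * N - (M * K * (\<delta>1 + \<delta>2) + M * (c1 + c2) * t^2)) - t^2 * (N + 2 * M^2 * K * (\<delta>1 + n1 * t))
      = t^2 * N - defect \<delta>1 \<delta>2 t"
    unfolding defect_def c1_def[symmetric] c2_def[symmetric] by (simp add: algebra_simps power2_eq_square)
  ultimately have key: "t^2 * N - defect \<delta>1 \<delta>2 t \<le> 2 * t * ?\<Delta> - t^2 * ?H" by linarith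
  show "t^2 * N - defect \<delta>1 \<delta>2 t \<le> (1 + 2 * t * M) * (W (E q1) (E q2))^2"
    using key W_sq_lower_bound[OF E_prob[OF q(1)] E_prob[OF q(2)] \<Omega> f u_lipschitz M less_imp_le[OF t(1)]]
    by linarith
  obtain u' :: "'a \<Rightarrow> 'a \<Rightarrow>\<^sub>L 'a" where u': "continuous_on UNIV u'"
    "\<And>x. (u has_derivative blinfun_apply (u' x)) (at x)" "\<And>x. norm (u x) \<le> M" "\<And>x. norm (u' x) \<le> M"
    by (rule u_bounds) simp_all
  let ?r = "t^2 * N - defect \<delta>1 \<delta>2 t - 2 * t^3 * M^4"
  obtain \<eta> where "(q1, \<eta>) \<in> \<D>" "q2 = riem_exp A g q1 \<eta>" by (rule exp_domain_connect[OF q])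
  from ray_W_restr(3)[OF this] obtain \<rho>0 where \<rho>0: "\<rho>0 \<in> W_Lipschitz_curves (E ` S)" "\<rho>0 0 = E q1" "\<rho>0 1 = E q2" "energy \<Omega> \<rho>0 < \<infinity>"
    by blast
  have "?r / (1 + t / 2) \<le> (W_restr \<Omega> (E ` S) (E q1) (E q2))^2"
  proof (rule W_restr_lower_bound[OF \<rho>0])
    fix \<rho> assume \<rho>: "\<rho> \<in> W_Lipschitz_curves (E ` S)" "\<rho> 0 = E q1" "\<rho> 1 = E q2" "energy \<Omega> \<rho> < \<infinity>"
    have \<rho>P: "\<rho> s \<in> prob_measures_on \<Omega>" if "s \<in> {0..1}" for s
      using \<rho>(1) that E_prob unfolding W_Lipschitz_curves_def by fastforce
    obtain L where L: "\<And>s t. s \<in> {0..1} \<Longrightarrow> t \<in> {0..1} \<Longrightarrow> W (\<rho> s) (\<rho> t) \<le> L * \<bar>s - t\<bar>"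
      using \<rho>(1) unfolding W_Lipschitz_curves_def by blast
    have "2 * t * ?\<Delta> - t^2 * ?H - 2 * t^3 * M^4 \<le> (1 + t / 2) * enn2real (energy \<Omega> \<rho>)"
      using energy_lower_bound[OF \<Omega> \<rho>P L f u'(2,1,3,4) t(1) \<rho>(4)] unfolding \<rho>(2,3) .
    then have "?r \<le> (1 + t / 2) * enn2real (energy \<Omega> \<rho>)" using key by linarith
    then show "?r / (1 + t / 2) \<le> enn2real (energy \<Omega> \<rho>)" using t by (simp only: pos_divide_le_eq mult.commute)
  qed
  then show "?r \<le> (1 + t / 2) * (W_restr \<Omega> (E ` S) (E q1) (E q2))^2"
    using t by (simp add: pos_divide_le_eq mult.commute)
qed

text \<open>Uniform bound, for maps \<open>F1\<close> and \<open>F2\<close> from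
  \<open>E \<theta>\<close> to the two endpoints, on the deviation of F2 - F1 from t u: the
  \<open>drift\<close> terms pay for the step from ray to endpoint, the \<open>err\<close> terms for
  the curvature of the flow.\<close>

definition spread where "spread \<delta>1 \<delta>2 t = drift (K / k * \<delta>1) + drift (K / k * \<delta>2)
  + (err (n1) + err (n2)) * t^2"

text \<open>The time-1 flow of a ray from p to q. Its speed is the distance from p to q, while
  tangency is stated for the reverse order; hence the factor \<open>K / k\<close>. Unlike an optimal
  map, it moves every point of \<Omega> by a controlled amount.\<close>

lemma connecting_map:
  assumes p: "p \<in> S" and q: "q \<in> S"
  obtains \<tau> where "\<tau> \<in> borel_measurable borel" "E q = distr (E p) borel \<tau>"
    "\<And>x. x \<in> \<Omega> \<Longrightarrow> norm (\<tau> x - x) \<le> drift (K / k * dS q p)"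
proof -
  obtain \<eta> where D: "(p, \<eta>) \<in> \<D>" and qe: "q = riem_exp A g p \<eta>" by (rule exp_domain_connect[OF p q])
  obtain \<psi> where \<psi>: "\<psi> 1 \<in> borel_measurable borel" "E (ray p \<eta> 1) = distr (E p) borel (\<psi> 1)"
    "\<And>x. x \<in> \<Omega> \<Longrightarrow> norm (\<psi> 1 x - x) \<le> drift (speed p \<eta>) * 1"
  proof (rule ray_flow[OF D], rule that)
    fix \<psi> :: "real \<Rightarrow> 'a \<Rightarrow> 'a"
    assume *: "\<And>t. t \<in> {0..1} \<Longrightarrow> \<psi> t \<in> borel_measurable borel"
      "\<And>t. t \<in> {0..1} \<Longrightarrow> E (ray p \<eta> t) = distr (E p) borel (\<psi> t)"
      "\<And>t x. x \<in> \<Omega> \<Longrightarrow> t \<in> {0..1} \<Longrightarrow> norm (\<psi> t x - x) \<le> drift (speed p \<eta>) * t"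
    show "\<psi> 1 \<in> borel_measurable borel" "E (ray p \<eta> 1) = distr (E p) borel (\<psi> 1)"
      "\<And>x. x \<in> \<Omega> \<Longrightarrow> norm (\<psi> 1 x - x) \<le> drift (speed p \<eta>) * 1" by (intro *; simp)+
  qed
  have "speed p \<eta> \<le> K / k * dS q p" using exp_domainD(8)[OF D] dS_commute_le[OF q p] qe by simp
  then have "drift (speed p \<eta>) \<le> drift (K / k * dS q p)"
    unfolding drift_def using C0 speed_nonneg[OF D] by (intro add_mono mult_left_mono power_mono) auto
  then have "norm (\<psi> 1 x - x) \<le> drift (K / k * dS q p)" if "x \<in> \<Omega>" for x
    using \<psi>(3)[OF that] by simp
  then show ?thesis using \<psi>(1,2) qe by (intro that[of "\<psi> 1"]) simp_all
qed

text \<open>Flowing along a ray and then to the endpoint writes both measures as images of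
  \<open>E \<theta>\<close>. The pair of maps is a coupling whose displacement is t u up to
  \<open>spread\<close>.\<close>

lemma upper_bound:
  assumes t: "0 < t" "t \<le> 1" and q: "q1 \<in> S" "q2 \<in> S"
    and \<delta>: "\<delta>1 = dS q1 (ray \<theta> \<eta>1 t)" "\<delta>2 = dS q2 (ray \<theta> \<eta>2 t)"
  shows "(W (E q1) (E q2))^2 \<le> t^2 * N + 2 * t * M * spread \<delta>1 \<delta>2 t + (spread \<delta>1 \<delta>2 t)^2"
proof -
  have t01: "t \<in> {0..1}" using t by auto
  let ?\<mu> = "E \<theta>"
  note P = prob_measures_onD[OF E_prob[OF \<theta>] closed_\<Omega>]
  interpret prob_space ?\<mu> by (rule P(1))
  have step: "\<exists>F. F \<in> borel_measurable borel \<and> E q = distr ?\<mu> borel F \<and>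
      (AE x in ?\<mu>. norm (F x - x - t *\<^sub>R B \<theta> \<eta> x) \<le> drift (K / k * dS q (ray \<theta> \<eta> t)) + err (speed \<theta> \<eta>) * t^2)"
    if D: "(\<theta>, \<eta>) \<in> \<D>" and q: "q \<in> S" for \<eta> q
  proof -
    obtain \<psi> where \<psi>: "\<psi> t \<in> borel_measurable borel" "E (ray \<theta> \<eta> t) = distr ?\<mu> borel (\<psi> t)"
      "\<And>x. x \<in> \<Omega> \<Longrightarrow> norm (\<psi> t x - x - t *\<^sub>R B \<theta> \<eta> x) \<le> err (speed \<theta> \<eta>) * t^2"
      using ray_flow[OF D] t01 by metis
    have rS: "ray \<theta> \<eta> t \<in> S" by (rule exp_domainD(6)[OF D t01])
    obtain \<tau> where \<tau>: "\<tau> \<in> borel_measurable borel" "E q = distr (E (ray \<theta> \<eta> t)) borel \<tau>"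
      "\<And>x. x \<in> \<Omega> \<Longrightarrow> norm (\<tau> x - x) \<le> drift (K / k * dS q (ray \<theta> \<eta> t))"
      by (rule connecting_map[OF rS q]) blast
    have \<psi>m: "\<psi> t \<in> ?\<mu> \<rightarrow>\<^sub>M borel" unfolding measurable_cong_sets[OF P(2) refl] by (rule \<psi>(1))
    have "AE x in distr ?\<mu> borel (\<psi> t). x \<in> \<Omega>"
      unfolding \<psi>(2)[symmetric] by (rule prob_measures_onD(3)[OF E_prob[OF rS] closed_\<Omega>])
    then have \<psi>r: "AE x in ?\<mu>. \<psi> t x \<in> \<Omega>" by (rule AE_distrD[OF \<psi>m])
    show ?thesis
    proof (intro exI[of _ "\<tau> \<circ> \<psi> t"] conjI)
      show "\<tau> \<circ> \<psi> t \<in> borel_measurable borel" using \<psi>(1) \<tau>(1) by (rule measurable_comp)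
      show "E q = distr ?\<mu> borel (\<tau> \<circ> \<psi> t)" unfolding \<tau>(2) \<psi>(2) by (rule distr_distr[OF \<tau>(1) \<psi>m])
      show "AE x in ?\<mu>. norm ((\<tau> \<circ> \<psi> t) x - x - t *\<^sub>R B \<theta> \<eta> x) \<le> drift (K / k * dS q (ray \<theta> \<eta> t)) + err (speed \<theta> \<eta>) * t^2"
        using P(3) \<psi>r
      proof eventually_elim
        case (elim x)
        have "norm (\<tau> (\<psi> t x) - x - t *\<^sub>R B \<theta> \<eta> x) \<le> norm (\<tau> (\<psi> t x) - \<psi> t x) + norm (\<psi> t x - x - t *\<^sub>R B \<theta> \<eta> x)"
          using norm_triangle_ineq[of "\<tau> (\<psi> t x) - \<psi> t x" "\<psi> t x - x - t *\<^sub>R B \<theta> \<eta> x"] by (simp add: algebra_simps)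
        then show ?case using \<tau>(3)[OF elim(2)] \<psi>(3)[OF elim(1)] by simp
      qed
    qed
  qed
  obtain F1 where F1: "F1 \<in> borel_measurable borel" "E q1 = distr ?\<mu> borel F1"
    "AE x in ?\<mu>. norm (F1 x - x - t *\<^sub>R b1 x) \<le> drift (K / k * \<delta>1) + err (n1) * t^2"
    using step[OF D1 q(1)] unfolding \<delta> by blast
  obtain F2 where F2: "F2 \<in> borel_measurable borel" "E q2 = distr ?\<mu> borel F2"
    "AE x in ?\<mu>. norm (F2 x - x - t *\<^sub>R b2 x) \<le> drift (K / k * \<delta>2) + err (n2) * t^2"
    using step[OF D2 q(2)] unfolding \<delta> by blast
  let ?s = "spread \<delta>1 \<delta>2 t"
  have s: "0 \<le> ?s"
    unfolding spread_def \<delta> using K k dS_nonneg speed_nonneg[OF D1] speed_nonneg[OF D2]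
    by (intro add_nonneg_nonneg mult_nonneg_nonneg drift_nonneg err_nonneg divide_nonneg_nonneg) auto
  have pw: "AE x in ?\<mu>. (norm (F1 x - F2 x))^2 \<le> t^2 * (norm (u x))^2 + (2 * t * M * ?s + ?s^2)"
    using F1(3) F2(3)
  proof eventually_elim
    case (elim x)
    have tri: "norm (a - b - c) \<le> norm a + norm b + norm c" for a b c :: 'a
      using norm_triangle_ineq4[of "a - b" c] norm_triangle_ineq4[of a b] by linarith
    have eq: "F1 x - F2 x = (F1 x - x - t *\<^sub>R b1 x) - (F2 x - x - t *\<^sub>R b2 x) - t *\<^sub>R u x"
      by (simp add: u_eq algebra_simps)
    have "norm (F1 x - F2 x) \<le> norm (F1 x - x - t *\<^sub>R b1 x) + norm (F2 x - x - t *\<^sub>R b2 x) + norm (t *\<^sub>R u x)"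
      unfolding eq by (rule tri)
    also have "\<dots> \<le> ?s + t * norm (u x)" using elim t by (simp add: spread_def algebra_simps)
    finally have "(norm (F1 x - F2 x))^2 \<le> (?s + t * norm (u x))^2" by (intro power_mono) auto
    also have "\<dots> = t^2 * (norm (u x))^2 + (2 * t * norm (u x) * ?s + ?s^2)"
      by (simp add: power2_sum power_mult_distrib algebra_simps)
    also have "\<dots> \<le> t^2 * (norm (u x))^2 + (2 * t * M * ?s + ?s^2)"
      using u_norm[of x] s t by (intro add_left_mono add_right_mono mult_right_mono mult_left_mono) auto
    finally show ?case .
  qed
  have ui: "integrable ?\<mu> (\<lambda>x. (norm (u x))^2)"
    by (intro integrable_continuous_prob_measure[OF E_prob[OF \<theta>] \<Omega>] continuous_intros u_continuous)
  have "(W (E q1) (E q2))^2 \<le> (LINT x|?\<mu>. (norm (F1 x - F2 x))^2)"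
    unfolding F1(2) F2(2)
    by (rule W_sq_le_maps[OF P(2) F1(1) F2(1) \<Omega> E_prob[OF q(1), unfolded F1(2)] E_prob[OF q(2), unfolded F2(2)]])
  also have "\<dots> \<le> (LINT x|?\<mu>. t^2 * (norm (u x))^2 + (2 * t * M * ?s + ?s^2))"
  proof (rule integral_mono_AE')
    show "AE x in ?\<mu>. (norm (F1 x - F2 x))^2 \<le> t^2 * (norm (u x))^2 + (2 * t * M * ?s + ?s^2)" by (rule pw)
    show "AE x in ?\<mu>. 0 \<le> t^2 * (norm (u x))^2 + (2 * t * M * ?s + ?s^2)"
      using s M t by simp
  qed (use ui in simp)
  also have "\<dots> = t^2 * N + (2 * t * M * ?s + ?s^2)" using ui by (simp add: N_def prob_space)
  finally show ?thesis by simp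
qed

end


section \<open>Passage to the limit at time 0\<close>

lemma tendsto_of_squares:
  fixes f :: "real \<Rightarrow> real"
  assumes "\<forall>\<^sub>F t in at_right 0. 0 \<le> f t" "((\<lambda>t. (f t / t)^2) \<longlongrightarrow> N) (at_right 0)"
  shows "((\<lambda>t. f t / t) \<longlongrightarrow> sqrt N) (at_right 0)"
proof (rule Lim_transform_eventually)
  show "((\<lambda>t. sqrt ((f t / t)^2)) \<longlongrightarrow> sqrt N) (at_right 0)" using assms(2) by (rule tendsto_real_sqrt)
  show "\<forall>\<^sub>F t in at_right 0. sqrt ((f t / t)^2) = f t / t"
    using assms(1) eventually_at_right_less[of 0] by eventually_elim simp
qed

context two_rays
begin

text \<open>The cross term is split by Young's inequality with weight \<open>sqrt t\<close>, which keeps both parts \<open>o(t^2)\<close>.\<close>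

lemma optimal_map_difference:
  assumes t: "0 < t" "t \<le> 1"
    and T1: "optimal_transport_map (E \<theta>) (E (ray \<theta> \<eta>1 t)) T1"
    and T2: "optimal_transport_map (E \<theta>) (E (ray \<theta> \<eta>2 t)) T2"
  defines "C \<equiv> \<lambda>\<eta>. 4 * (C0 * speed \<theta> \<eta>) * (err (speed \<theta> \<eta>) + (drift (speed \<theta> \<eta>))^2) + (err (speed \<theta> \<eta>))^2"
  shows "\<bar>(LINT x|E \<theta>. (norm (T1 x - T2 x))^2) - t^2 * N\<bar>
    \<le> sqrt t * t^2 * M^2 + 2 * (1 / sqrt t + 1) * (C \<eta>1 + C \<eta>2) * t^3"
proof -
  have t01: "t \<in> {0..1}" using t by auto
  let ?\<mu> = "E \<theta>"
  note P = prob_measures_onD[OF E_prob[OF \<theta>] closed_\<Omega>]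
  interpret prob_space ?\<mu> by (rule P(1))
  note e1 = optimal_map_expansion[OF D1 t01 T1] and e2 = optimal_map_expansion[OF D2 t01 T2]
  let ?e1 = "\<lambda>x. T1 x - x - t *\<^sub>R b1 x" and ?e2 = "\<lambda>x. T2 x - x - t *\<^sub>R b2 x"
  define \<alpha> where "\<alpha> = sqrt t"
  have \<alpha>: "0 < \<alpha>" using t by (simp add: \<alpha>_def)
  define \<beta> where "\<beta> = 1 / \<alpha> + 1"
  have \<beta>: "0 \<le> \<beta>" using \<alpha> by (simp add: \<beta>_def)
  have bc: "continuous_on UNIV (\<lambda>z :: 'a \<times> 'a. B \<theta> \<eta> (fst z))" for \<eta>
    by (intro continuous_on_compose2[OF field_continuous[OF \<theta>]] continuous_intros) auto
  have c: "continuous_on UNIV (\<lambda>z :: 'a \<times> 'a. (norm (snd z - fst z - t *\<^sub>R B \<theta> \<eta> (fst z)))^2)" for \<eta>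
    by (intro continuous_intros bc)
  have i1: "integrable ?\<mu> (\<lambda>x. (norm (?e1 x))^2)" and i2: "integrable ?\<mu> (\<lambda>x. (norm (?e2 x))^2)"
    using integrable_continuous_pair[OF E_prob[OF \<theta>] \<Omega> e1(1,2) c, of \<eta>1]
      integrable_continuous_pair[OF E_prob[OF \<theta>] \<Omega> e2(1,2) c, of \<eta>2] by simp_all
  have ui: "integrable ?\<mu> (\<lambda>x. (norm (u x))^2)"
    by (intro integrable_continuous_prob_measure[OF E_prob[OF \<theta>] \<Omega>] continuous_intros u_continuous)
  have pw: "\<bar>(norm (T1 x - T2 x))^2 - t^2 * (norm (u x))^2\<bar>
      \<le> \<alpha> * t^2 * M^2 + 2 * \<beta> * ((norm (?e1 x))^2 + (norm (?e2 x))^2)" for x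
  proof -
    define e where "e = ?e1 x - ?e2 x"
    have d: "T1 x - T2 x = e - t *\<^sub>R u x" by (simp add: e_def u_eq algebra_simps)
    have "(norm (T1 x - T2 x))^2 - t^2 * (norm (u x))^2 = (norm e)^2 - 2 * t * (u x \<bullet> e)"
      unfolding d power2_norm_eq_inner
      by (simp add: inner_diff_left inner_diff_right inner_commute[of e "u x"] power2_eq_square algebra_simps)
    then have "\<bar>(norm (T1 x - T2 x))^2 - t^2 * (norm (u x))^2\<bar> \<le> (norm e)^2 + 2 * t * \<bar>u x \<bullet> e\<bar>"
      using abs_triangle_ineq4[of "(norm e)^2" "2 * t * (u x \<bullet> e)"] t by (simp add: abs_mult)
    also have "\<dots> \<le> (norm e)^2 + 2 * t * (M * norm e)"
    proof -
      have "\<bar>u x \<bullet> e\<bar> \<le> norm (u x) * norm e" by (rule Cauchy_Schwarz_ineq2)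
      also have "\<dots> \<le> M * norm e" using u_norm by (intro mult_right_mono) auto
      finally show ?thesis using t by (intro add_left_mono mult_left_mono) auto
    qed
    also have "2 * t * (M * norm e) \<le> \<alpha> * t^2 * M^2 + (norm e)^2 / \<alpha>"
    proof -
      have "0 \<le> (\<alpha> * (t * M) - norm e)^2 / \<alpha>" using \<alpha> by simp
      also have "\<dots> = \<alpha> * t^2 * M^2 + (norm e)^2 / \<alpha> - 2 * t * (M * norm e)"
        using \<alpha> by (simp add: field_simps power2_eq_square)
      finally show ?thesis by simp
    qed
    also have "(norm e)^2 + (\<alpha> * t^2 * M^2 + (norm e)^2 / \<alpha>) = \<alpha> * t^2 * M^2 + \<beta> * (norm e)^2"
      by (simp add: \<beta>_def algebra_simps)
    also have "\<beta> * (norm e)^2 \<le> \<beta> * (2 * ((norm (?e1 x))^2 + (norm (?e2 x))^2))"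
    proof (rule mult_left_mono[OF _ \<beta>])
      have "(norm e)^2 \<le> (norm (?e1 x) + norm (?e2 x))^2"
        unfolding e_def by (intro power_mono norm_triangle_ineq4) auto
      also have "\<dots> \<le> 2 * ((norm (?e1 x))^2 + (norm (?e2 x))^2)"
        using sum_squares_bound[of "norm (?e1 x)" "norm (?e2 x)"] by (simp add: power2_sum)
      finally show "(norm e)^2 \<le> 2 * ((norm (?e1 x))^2 + (norm (?e2 x))^2)" .
    qed
    finally show ?thesis by (simp add: algebra_simps)
  qed
  let ?R = "\<lambda>x. \<alpha> * t^2 * M^2 + 2 * \<beta> * ((norm (?e1 x))^2 + (norm (?e2 x))^2)"
  have Ri: "integrable ?\<mu> ?R" using i1 i2 by simp
  have Tm: "T1 \<in> borel_measurable ?\<mu>" "T2 \<in> borel_measurable ?\<mu>"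
    unfolding measurable_cong_sets[OF P(2) refl] by (rule e1(1), rule e2(1))
  have Di: "integrable ?\<mu> (\<lambda>x. (norm (T1 x - T2 x))^2 - t^2 * (norm (u x))^2)"
  proof (rule Bochner_Integration.integrable_bound[OF Ri])
    show "(\<lambda>x. (norm (T1 x - T2 x))^2 - t^2 * (norm (u x))^2) \<in> borel_measurable ?\<mu>"
      using Tm ui by measurable
    show "AE x in ?\<mu>. norm ((norm (T1 x - T2 x))^2 - t^2 * (norm (u x))^2) \<le> norm (?R x)"
    proof (rule AE_I2)
      fix x
      show "norm ((norm (T1 x - T2 x))^2 - t^2 * (norm (u x))^2) \<le> norm (?R x)"
        unfolding real_norm_def by (rule order_trans[OF pw abs_ge_self])
    qed
  qed
  have Xi: "integrable ?\<mu> (\<lambda>x. (norm (T1 x - T2 x))^2)"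
    using Bochner_Integration.integrable_add[OF Di integrable_mult_right[OF ui, of "t^2"]] by simp
  have "(LINT x|?\<mu>. (norm (T1 x - T2 x))^2) - t^2 * N
      = (LINT x|?\<mu>. (norm (T1 x - T2 x))^2 - t^2 * (norm (u x))^2)"
    using Xi ui by (simp add: N_def)
  also have "\<bar>\<dots>\<bar> \<le> (LINT x|?\<mu>. \<bar>(norm (T1 x - T2 x))^2 - t^2 * (norm (u x))^2\<bar>)"
    by (rule integral_abs_bound)
  also have "\<dots> \<le> (LINT x|?\<mu>. ?R x)"
    by (rule integral_mono[OF integrable_abs[OF Di] Ri pw])
  also have "\<dots> = \<alpha> * t^2 * M^2 + 2 * \<beta> * ((LINT x|?\<mu>. (norm (?e1 x))^2) + (LINT x|?\<mu>. (norm (?e2 x))^2))"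
    using i1 i2 by (simp add: prob_space)
  also have "\<dots> \<le> \<alpha> * t^2 * M^2 + 2 * \<beta> * (C \<eta>1 * t^3 + C \<eta>2 * t^3)"
    using e1(3) e2(3) \<beta> unfolding C_def by (intro add_left_mono mult_left_mono add_mono) auto
  finally show ?thesis by (simp add: \<alpha>_def \<beta>_def algebra_simps add_divide_distrib)
qed

lemma optimal_map_limit:
  assumes T: "\<And>t. t \<in> {0..1} \<Longrightarrow> optimal_transport_map (E \<theta>) (E (ray \<theta> \<eta>1 t)) (T1 t)"
    "\<And>t. t \<in> {0..1} \<Longrightarrow> optimal_transport_map (E \<theta>) (E (ray \<theta> \<eta>2 t)) (T2 t)"
  shows "((\<lambda>t. L2_norm (E \<theta>) (\<lambda>x. T1 t x - T2 t x) / t) \<longlongrightarrow> sqrt N) (at_right 0)"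
proof (rule tendsto_of_squares)
  define C where "C \<eta> = 4 * (C0 * speed \<theta> \<eta>) * (err (speed \<theta> \<eta>) + (drift (speed \<theta> \<eta>))^2) + (err (speed \<theta> \<eta>))^2" for \<eta>
  let ?X = "\<lambda>t. LINT x|E \<theta>. (norm (T1 t x - T2 t x))^2"
  let ?r = "\<lambda>t. sqrt t * M^2 + 2 * (sqrt t + t) * (C \<eta>1 + C \<eta>2)"
  have r0: "(?r \<longlongrightarrow> 0) (at_right 0)"
    by (rule tendsto_eq_intros | simp)+
  have "((\<lambda>t. (L2_norm (E \<theta>) (\<lambda>x. T1 t x - T2 t x) / t)^2 - N) \<longlongrightarrow> 0) (at_right 0)"
  proof (rule Lim_null_comparison[OF _ r0])
    have "\<forall>\<^sub>F t in at_right (0::real). t < 1" by (rule eventually_at_rightI[of 0 1]) auto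
    then show "\<forall>\<^sub>F t in at_right 0. norm ((L2_norm (E \<theta>) (\<lambda>x. T1 t x - T2 t x) / t)^2 - N) \<le> ?r t"
      using eventually_at_right_less[of 0]
    proof eventually_elim
      case (elim t)
      then have t: "0 < t" "t \<le> 1" "t \<in> {0..1}" by auto
      have st: "1 / sqrt t = sqrt t / t" using t by (simp add: field_simps)
      have "(L2_norm (E \<theta>) (\<lambda>x. T1 t x - T2 t x) / t)^2 - N = (?X t - t^2 * N) / t^2"
        using t by (simp add: L2_norm_def power_divide diff_divide_distrib)
      also have "norm \<dots> \<le> (sqrt t * t^2 * M^2 + 2 * (1 / sqrt t + 1) * (C \<eta>1 + C \<eta>2) * t^3) / t^2"
        using optimal_map_difference[OF t(1,2) T(1)[OF t(3)] T(2)[OF t(3)]] unfolding C_def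
        by (simp add: divide_right_mono)
      also have "\<dots> = ?r t" using t unfolding st by (simp add: field_simps power2_eq_square power3_eq_cube)
      finally show ?case .
    qed
  qed
  then show "((\<lambda>t. (L2_norm (E \<theta>) (\<lambda>x. T1 t x - T2 t x) / t)^2) \<longlongrightarrow> N) (at_right 0)"
    by (rule LIM_zero_cancel)
qed (simp add: L2_norm_def)

context
  fixes \<gamma>1 \<gamma>2 and \<epsilon> :: real
  assumes \<epsilon>: "0 < \<epsilon>" and \<gamma>S: "\<And>t. t \<in> {0..<\<epsilon>} \<Longrightarrow> \<gamma>1 t \<in> S" "\<And>t. t \<in> {0..<\<epsilon>} \<Longrightarrow> \<gamma>2 t \<in> S"
    and tangent: "((\<lambda>t. dS (\<gamma>1 t) (ray \<theta> \<eta>1 t) / t) \<longlongrightarrow> 0) (at_right 0)"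
      "((\<lambda>t. dS (\<gamma>2 t) (ray \<theta> \<eta>2 t) / t) \<longlongrightarrow> 0) (at_right 0)"
begin

abbreviation "\<delta>1 t \<equiv> dS (\<gamma>1 t) (ray \<theta> \<eta>1 t)"

abbreviation "\<delta>2 t \<equiv> dS (\<gamma>2 t) (ray \<theta> \<eta>2 t)"

abbreviation "w t \<equiv> W (E (\<gamma>1 t)) (E (\<gamma>2 t))"

abbreviation "wr t \<equiv> W_restr \<Omega> (E ` S) (E (\<gamma>1 t)) (E (\<gamma>2 t))"

lemma eventually_in_S: "\<forall>\<^sub>F t in at_right 0. 0 < t \<and> t < 1 \<and> \<gamma>1 t \<in> S \<and> \<gamma>2 t \<in> S"
proof (rule eventually_at_rightI[of 0 "min 1 \<epsilon>"])
  fix t assume "t \<in> {0<..<min 1 \<epsilon>}"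
  then have "t \<in> {0..<\<epsilon>}" "0 < t" "t < 1" by auto
  then show "0 < t \<and> t < 1 \<and> \<gamma>1 t \<in> S \<and> \<gamma>2 t \<in> S" using \<gamma>S by blast
qed (use \<epsilon> in simp)

text \<open>After division by t^2, each \<delta> occurs only as the quotient \<delta> / t times a
  nonnegative power of t, and tangency makes the quotient vanish.\<close>

lemma defect_limit: "((\<lambda>t. defect (\<delta>1 t) (\<delta>2 t) t / t^2) \<longlongrightarrow> 0) (at_right 0)"
proof (rule Lim_transform_eventually)
  let ?c = "M * (err (n1) + (drift (n1))^2 + (err (n2) + (drift (n2))^2))"
  let ?l = "\<lambda>t. 2 * (M * K * (\<delta>1 t / t + \<delta>2 t / t) + ?c * t) + 2 * M^2 * K * (\<delta>1 t / t * t + n1 * t)"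
  have "(?l \<longlongrightarrow> 2 * (M * K * (0 + 0) + ?c * 0) + 2 * M^2 * K * (0 * 0 + n1 * 0)) (at_right 0)"
    by (intro tendsto_intros tangent)
  then show "(?l \<longlongrightarrow> 0) (at_right 0)" by simp
  show "\<forall>\<^sub>F t in at_right 0. ?l t = defect (\<delta>1 t) (\<delta>2 t) t / t^2"
    using eventually_at_right_less[of 0]
    by eventually_elim (simp add: defect_def field_simps power2_eq_square)
qed

lemma spread_limit: "((\<lambda>t. spread (\<delta>1 t) (\<delta>2 t) t / t) \<longlongrightarrow> 0) (at_right 0)"
proof (rule Lim_transform_eventually)
  let ?c = "err (n1) + err (n2)"
  \<comment> \<open>\<open>drift (K / k * x) / t\<close> rewritten as a function of the quotient x /
    t, the quantity whose limit is known.\<close>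
  let ?d = "\<lambda>x t. C0 * (K / k) * x + C0 * (K / k)^2 * (x * x * t)"
  let ?l = "\<lambda>t. ?d (\<delta>1 t / t) t + ?d (\<delta>2 t / t) t + ?c * t"
  have "(?l \<longlongrightarrow> ?d 0 0 + ?d 0 0 + ?c * 0) (at_right 0)"
    by (intro tendsto_intros tangent)
  then show "(?l \<longlongrightarrow> 0) (at_right 0)" by simp
  have d: "?d (x / t) t = drift (K / k * x) / t" if "0 < t" for x t
    using that by (simp add: drift_def power_mult_distrib power2_eq_square add_divide_distrib mult_ac)
  show "\<forall>\<^sub>F t in at_right 0. ?l t = spread (\<delta>1 t) (\<delta>2 t) t / t"
    using eventually_at_right_less[of 0]
  proof eventually_elim
    case (elim t)
    then show ?case unfolding d[OF elim] by (simp add: spread_def add_divide_distrib power2_eq_square)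
  qed
qed

lemma W_sq_limit: "((\<lambda>t. (w t / t)^2) \<longlongrightarrow> N) (at_right 0)"
proof (rule tendsto_sandwich)
  let ?lo = "\<lambda>t. (N - defect (\<delta>1 t) (\<delta>2 t) t / t^2) / (1 + 2 * t * M)"
  let ?hi = "\<lambda>t. N + 2 * M * (spread (\<delta>1 t) (\<delta>2 t) t / t) + (spread (\<delta>1 t) (\<delta>2 t) t / t)^2"
  have "(?lo \<longlongrightarrow> (N - 0) / (1 + 2 * 0 * M)) (at_right 0)"
    by (intro tendsto_intros defect_limit) simp
  then show "(?lo \<longlongrightarrow> N) (at_right 0)" by simp
  have "(?hi \<longlongrightarrow> N + 2 * M * 0 + 0^2) (at_right 0)"
    by (intro tendsto_intros spread_limit)
  then show "(?hi \<longlongrightarrow> N) (at_right 0)" by simp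
  show "\<forall>\<^sub>F t in at_right 0. ?lo t \<le> (w t / t)^2"
    using eventually_in_S
  proof eventually_elim
    case (elim t)
    then have t: "0 < t" "t \<le> 1" by auto
    have k: "0 < 1 + 2 * t * M" using M t by (simp add: add_pos_nonneg)
    have "(t^2 * N - defect (\<delta>1 t) (\<delta>2 t) t) / t^2 \<le> ((1 + 2 * t * M) * (w t)^2) / t^2"
      using lower_bounds(1)[OF t, of "\<gamma>1 t" "\<gamma>2 t"] elim by (intro divide_right_mono) auto
    then have "N - defect (\<delta>1 t) (\<delta>2 t) t / t^2 \<le> (1 + 2 * t * M) * (w t / t)^2"
      using t by (simp add: diff_divide_distrib power_divide)
    then show ?case using k by (simp only: pos_divide_le_eq mult.commute)
  qed
  show "\<forall>\<^sub>F t in at_right 0. (w t / t)^2 \<le> ?hi t"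
    using eventually_in_S
  proof eventually_elim
    case (elim t)
    then have t: "0 < t" "t \<le> 1" by auto
    let ?s = "spread (\<delta>1 t) (\<delta>2 t) t"
    have "(w t)^2 / t^2 \<le> (t^2 * N + 2 * t * M * ?s + ?s^2) / t^2"
      using upper_bound[OF t, of "\<gamma>1 t" "\<gamma>2 t"] elim by (intro divide_right_mono) auto
    also have "\<dots> = ?hi t"
      using t by (simp add: add_divide_distrib power_divide power2_eq_square)
    finally show ?case by (simp add: power_divide)
  qed
qed

lemma W_limit: "((\<lambda>t. w t / t) \<longlongrightarrow> sqrt N) (at_right 0)"
  by (rule tendsto_of_squares[OF _ W_sq_limit]) simp

text \<open>The lower bound is the direct one. The upper bound goes through \<open>W\<close>: since
  the distance is at most \<open>w t / k\<close>, it is eventually at most 1, as the comparison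
  requires, and its cube contributes the order w^3, which is o(t^2).\<close>

lemma W_restr_limit: "((\<lambda>t. wr t / t) \<longlongrightarrow> sqrt N) (at_right 0)"
proof (rule tendsto_of_squares)
  show "\<forall>\<^sub>F t in at_right 0. 0 \<le> wr t"
    using eventually_in_S by eventually_elim (intro W_restr_nonneg, auto)
  obtain C where C: "0 \<le> C" "\<And>p q. p \<in> S \<Longrightarrow> q \<in> S \<Longrightarrow> dS p q \<le> 1 \<Longrightarrow>
    (W_restr \<Omega> (E ` S) (E p) (E q))^2 \<le> (W (E p) (E q))^2 + C * (dS p q)^3"
    by (rule W_restr_le_W) blast
  have w0: "((\<lambda>t. w t) \<longlongrightarrow> 0) (at_right 0)"
  proof (rule Lim_transform_eventually)
    show "((\<lambda>t. w t / t * t) \<longlongrightarrow> 0) (at_right 0)"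
      using tendsto_mult[OF W_limit tendsto_ident_at] by (simp only: mult_zero_right)
    show "\<forall>\<^sub>F t in at_right 0. w t / t * t = w t"
      using eventually_at_right_less[of 0] by eventually_elim simp
  qed
  let ?lo = "\<lambda>t. (N - defect (\<delta>1 t) (\<delta>2 t) t / t^2 - 2 * t * M^4) / (1 + t / 2)"
  let ?hi = "\<lambda>t. (w t / t)^2 + C / k^3 * ((w t / t)^2 * w t)"
  show "((\<lambda>t. (wr t / t)^2) \<longlongrightarrow> N) (at_right 0)"
  proof (rule tendsto_sandwich)
    have "(?lo \<longlongrightarrow> (N - 0 - 2 * 0 * M^4) / (1 + 0 / 2)) (at_right 0)"
      by (intro tendsto_intros defect_limit) simp_all
    then show "(?lo \<longlongrightarrow> N) (at_right 0)" by simp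
    have "(?hi \<longlongrightarrow> N + C / k^3 * (N * 0)) (at_right 0)"
      by (intro tendsto_intros W_sq_limit w0)
    then show "(?hi \<longlongrightarrow> N) (at_right 0)" by simp
    show "\<forall>\<^sub>F t in at_right 0. ?lo t \<le> (wr t / t)^2"
      using eventually_in_S
    proof eventually_elim
      case (elim t)
      then have t: "0 < t" "t \<le> 1" by auto
      have "(t^2 * N - defect (\<delta>1 t) (\<delta>2 t) t - 2 * t^3 * M^4) / t^2 \<le> ((1 + t / 2) * (wr t)^2) / t^2"
        using lower_bounds(2)[OF t, of "\<gamma>1 t" "\<gamma>2 t"] elim by (intro divide_right_mono) auto
      moreover have "(t^2 * N - defect (\<delta>1 t) (\<delta>2 t) t - 2 * t^3 * M^4) / t^2
          = N - defect (\<delta>1 t) (\<delta>2 t) t / t^2 - 2 * t * M^4"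
        using t by (simp add: diff_divide_distrib power2_eq_square power3_eq_cube)
      ultimately have "N - defect (\<delta>1 t) (\<delta>2 t) t / t^2 - 2 * t * M^4 \<le> (wr t / t)^2 * (1 + t / 2)"
        by (simp add: power_divide mult.commute)
      then show ?case using t by (simp only: pos_divide_le_eq[of "1 + t / 2"])
    qed
    have "\<forall>\<^sub>F t in at_right 0. w t < k" using w0 k by (rule order_tendstoD)
    with eventually_in_S show "\<forall>\<^sub>F t in at_right 0. (wr t / t)^2 \<le> ?hi t"
    proof eventually_elim
      case (elim t)
      let ?d = "dS (\<gamma>1 t) (\<gamma>2 t)"
      have S: "\<gamma>1 t \<in> S" "\<gamma>2 t \<in> S" using elim by auto
      have d: "?d \<le> w t / k" using dist_le_W[OF S] k by (simp add: pos_le_divide_eq mult.commute)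
      also have "\<dots> \<le> 1" using elim k by simp
      finally have "(wr t)^2 \<le> (w t)^2 + C * ?d^3" by (rule C(2)[OF S])
      also have "\<dots> \<le> (w t)^2 + C * (w t / k)^3"
        using d C(1) dS_nonneg by (intro add_left_mono mult_left_mono power_mono) auto
      finally have "(wr t)^2 / t^2 \<le> ((w t)^2 + C * (w t / k)^3) / t^2" by (rule divide_right_mono) simp
      also have "\<dots> = ?hi t"
        by (simp add: add_divide_distrib power_divide power2_eq_square power3_eq_cube)
      finally show ?case by (simp add: power_divide)
    qed
  qed
qed

end

end

theorem corollary2p18:
  fixes \<Omega> :: "'a::euclidean_space set"
    and A :: "('m::{t2_space,second_countable_topology}, 'e::real_normed_vector) chart set"
    and g :: "'m \<Rightarrow> 'e \<Rightarrow> 'e \<Rightarrow> real"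
    and S :: "'m set"
    and \<D> :: "('m \<times> 'e) set"
    and E :: "'m \<Rightarrow> 'a measure"
    and B :: "'m \<Rightarrow> 'e \<Rightarrow> 'a \<Rightarrow> 'a"
    and \<theta> :: 'm and \<eta>\<^sub>1 \<eta>\<^sub>2 :: 'e and \<epsilon> :: real
    and \<gamma>\<^sub>1 \<gamma>\<^sub>2 :: "real \<Rightarrow> 'm"
    and T\<^sub>1 T\<^sub>2 :: "real \<Rightarrow> 'a \<Rightarrow> 'a"
  assumes "compact \<Omega>" and "convex \<Omega>"
    and "parameter_manifold A g S" and "exp_domain A g S \<D>"
    and "bi_Lipschitz_embedding A g S \<Omega> E"
    and "velocity_fields A g S \<D> E B"
    and "transports_along_curves A g S \<Omega> E B"
    and "\<theta> \<in> S" and "(\<theta>, \<eta>\<^sub>1) \<in> \<D>" and "(\<theta>, \<eta>\<^sub>2) \<in> \<D>"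
    and "0 < \<epsilon>"
    and "differentiable_curve_from A S \<epsilon> \<theta> \<eta>\<^sub>1 \<gamma>\<^sub>1"
    and "differentiable_curve_from A S \<epsilon> \<theta> \<eta>\<^sub>2 \<gamma>\<^sub>2"
    and "(\<lambda>t. riem_dist A g S (\<gamma>\<^sub>1 t) (riem_exp A g \<theta> (t *\<^sub>R \<eta>\<^sub>1))) \<in> o[at_right 0](\<lambda>t. t)"
    and "(\<lambda>t. riem_dist A g S (\<gamma>\<^sub>2 t) (riem_exp A g \<theta> (t *\<^sub>R \<eta>\<^sub>2))) \<in> o[at_right 0](\<lambda>t. t)"
    and "\<And>t. t \<in> {0..1} \<Longrightarrow> optimal_transport_map (E \<theta>) (E (riem_exp A g \<theta> (t *\<^sub>R \<eta>\<^sub>1))) (T\<^sub>1 t)"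
    and "\<And>t. t \<in> {0..1} \<Longrightarrow> optimal_transport_map (E \<theta>) (E (riem_exp A g \<theta> (t *\<^sub>R \<eta>\<^sub>2))) (T\<^sub>2 t)"
  shows "(\<lambda>t. \<bar>W_restr \<Omega> (E ` S) (E (\<gamma>\<^sub>1 t)) (E (\<gamma>\<^sub>2 t)) - t * L2_norm (E \<theta>) (B \<theta> (\<eta>\<^sub>1 - \<eta>\<^sub>2))\<bar>)
           \<in> o[at_right 0](\<lambda>t. t) \<and>
         (\<lambda>t. \<bar>W (E (\<gamma>\<^sub>1 t)) (E (\<gamma>\<^sub>2 t)) - L2_norm (E \<theta>) (\<lambda>x. T\<^sub>1 t x - T\<^sub>2 t x)\<bar>)
           \<in> o[at_right 0](\<lambda>t. t) \<and>
         ((\<lambda>t. W_restr \<Omega> (E ` S) (E (\<gamma>\<^sub>1 t)) (E (\<gamma>\<^sub>2 t)))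
           has_real_derivative L2_norm (E \<theta>) (B \<theta> (\<eta>\<^sub>1 - \<eta>\<^sub>2))) (at_right 0) \<and>
         ((\<lambda>t. W (E (\<gamma>\<^sub>1 t)) (E (\<gamma>\<^sub>2 t)))
           has_real_derivative L2_norm (E \<theta>) (B \<theta> (\<eta>\<^sub>1 - \<eta>\<^sub>2))) (at_right 0)"
proof -
  obtain k K\<^sub>0 where k: "0 < k" and K\<^sub>0: "\<And>p q. p \<in> S \<Longrightarrow> q \<in> S \<Longrightarrow>
      k * riem_dist A g S p q \<le> W (E p) (E q) \<and> W (E p) (E q) \<le> K\<^sub>0 * riem_dist A g S p q"
    using assms(5) unfolding bi_Lipschitz_embedding_def by blast
  obtain C\<^sub>0 where C\<^sub>0: "0 < C\<^sub>0" and vel: "\<forall>(\<theta>, \<eta>)\<in>\<D>.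
       tangent_norm g \<theta> \<eta> / C\<^sub>0 \<le> L2_norm (E \<theta>) (B \<theta> \<eta>) \<and>
       L2_norm (E \<theta>) (B \<theta> \<eta>) \<le> C\<^sub>0 * tangent_norm g \<theta> \<eta> \<and>
       C1_norm (B \<theta> \<eta>) \<le> ennreal (C\<^sub>0 * tangent_norm g \<theta> \<eta>) \<and>
       (let \<gamma> = (\<lambda>t. riem_exp A g \<theta> (t *\<^sub>R \<eta>)) in
          \<forall>x. \<forall>t\<in>{0..1}. \<exists>w.
            ((\<lambda>s. B (\<gamma> s) (velocity A \<gamma> {0..1} s) x) has_vector_derivative w) (at t within {0..1}) \<and>
            norm w \<le> C\<^sub>0 * (tangent_norm g \<theta> \<eta>)\<^sup>2)"
    using assms(6) unfolding velocity_fields_def by blast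
  \<comment> \<open>Taking the maximum with 0 only enlarges the Lipschitz constant, since distances
    are nonnegative, and makes it usable in monotonicity arguments.\<close>
  interpret two_rays \<Omega> A g S \<D> E B k "max 0 K\<^sub>0" C\<^sub>0 \<theta> \<eta>\<^sub>1 \<eta>\<^sub>2
  proof (intro two_rays.intro two_rays_axioms.intro wasserstein_submanifold.intro)
    show "compact \<Omega>" "0 < k" "0 < C\<^sub>0" "exp_domain A g S \<D>" "transports_along_curves A g S \<Omega> E B"
      "(\<theta>, \<eta>\<^sub>1) \<in> \<D>" "(\<theta>, \<eta>\<^sub>2) \<in> \<D>" by fact+
    show "smooth_atlas A" "riemannian_metric A g" using assms(3) by (simp_all add: parameter_manifold_def)
    show "0 \<le> max 0 K\<^sub>0" by simp
    fix p assume p: "p \<in> S"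
    show "E p \<in> prob_measures_on \<Omega>" using assms(5) p by (simp add: bi_Lipschitz_embedding_def)
    fix \<eta> x
    show "linear (\<lambda>\<eta>. B p \<eta> x)" using assms(6) p by (simp add: velocity_fields_def)
    show "C1_field (B p \<eta>)" using assms(6) p by (simp add: velocity_fields_def)
    show "gradient_field (B p \<eta>)" using assms(6) p by (simp add: velocity_fields_def)
    fix q assume q: "q \<in> S"
    show "k * riem_dist A g S p q \<le> W (E p) (E q)" using K\<^sub>0[OF p q] by simp
    have "K\<^sub>0 * riem_dist A g S p q \<le> max 0 K\<^sub>0 * riem_dist A g S p q"
      by (rule mult_right_mono) (simp_all add: riem_dist_def)
    then show "W (E p) (E q) \<le> max 0 K\<^sub>0 * riem_dist A g S p q" using K\<^sub>0[OF p q] by linarith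
  next
    fix p \<eta> assume D: "(p, \<eta>) \<in> \<D>"
    note * = bspec[OF vel D, unfolded prod.case Let_def]
    show "C1_norm (B p \<eta>) \<le> ennreal (C\<^sub>0 * tangent_norm g p \<eta>)" using * by (elim conjE)
    show "\<exists>w. ((\<lambda>s. B (riem_exp A g p (s *\<^sub>R \<eta>)) (velocity A (\<lambda>s. riem_exp A g p (s *\<^sub>R \<eta>)) {0..1} s) x)
            has_vector_derivative w) (at t within {0..1}) \<and> norm w \<le> C\<^sub>0 * (tangent_norm g p \<eta>)\<^sup>2"
      if "t \<in> {0..1}" for x t
      using *[THEN conjunct2, THEN conjunct2, THEN conjunct2, THEN spec, THEN bspec, OF that] .
  qed
  have \<gamma>S: "\<gamma>\<^sub>1 t \<in> S" "\<gamma>\<^sub>2 t \<in> S" if "t \<in> {0..<\<epsilon>}" for t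
    using assms(12,13) that unfolding differentiable_curve_from_def by auto
  have \<gamma>0: "\<gamma>\<^sub>1 0 = \<theta>" "\<gamma>\<^sub>2 0 = \<theta>" using assms(12,13) by (simp_all add: differentiable_curve_from_def)
  note tangent = smalloD_tendsto[OF assms(14)] smalloD_tendsto[OF assms(15)]
  let ?L = "L2_norm (E \<theta>) (B \<theta> (\<eta>\<^sub>1 - \<eta>\<^sub>2))"
  let ?w = "\<lambda>t. W (E (\<gamma>\<^sub>1 t)) (E (\<gamma>\<^sub>2 t))" and ?wr = "\<lambda>t. W_restr \<Omega> (E ` S) (E (\<gamma>\<^sub>1 t)) (E (\<gamma>\<^sub>2 t))"
  let ?T = "\<lambda>t. L2_norm (E \<theta>) (\<lambda>x. T\<^sub>1 t x - T\<^sub>2 t x)"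
  \<comment> \<open>The locale orients \<open>u\<close> from the first direction to the second,
    opposite to the statement; the norm does not see the sign.\<close>
  have "B \<theta> (\<eta>\<^sub>1 - \<eta>\<^sub>2) x = B \<theta> \<eta>\<^sub>1 x - B \<theta> \<eta>\<^sub>2 x" for x
    by (rule linear_diff[OF B_linear[OF \<theta>]])
  then have "B \<theta> (\<eta>\<^sub>1 - \<eta>\<^sub>2) x = - u x" for x by (simp add: u_eq)
  then have L: "sqrt N = ?L" by (simp add: L2_norm_def N_def)
  have w: "((\<lambda>t. ?w t / t) \<longlongrightarrow> ?L) (at_right 0)" and wr: "((\<lambda>t. ?wr t / t) \<longlongrightarrow> ?L) (at_right 0)"
    using W_limit[OF \<open>0 < \<epsilon>\<close> \<gamma>S tangent] W_restr_limit[OF \<open>0 < \<epsilon>\<close> \<gamma>S tangent] unfolding L by auto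
  have T: "((\<lambda>t. ?T t / t) \<longlongrightarrow> ?L) (at_right 0)"
    using optimal_map_limit[OF assms(16,17)] unfolding L .
  have small: "(\<lambda>t. \<bar>f t - h t\<bar>) \<in> o[at_right 0](\<lambda>t. t)"
    if "((\<lambda>t. f t / t) \<longlongrightarrow> ?L) (at_right 0)" "((\<lambda>t. h t / t) \<longlongrightarrow> ?L) (at_right 0)" for f h :: "real \<Rightarrow> real"
  proof (rule smalloI_tendsto)
    have "((\<lambda>t. \<bar>f t / t - h t / t\<bar>) \<longlongrightarrow> \<bar>?L - ?L\<bar>) (at_right 0)" by (intro tendsto_intros that)
    then have "((\<lambda>t. \<bar>f t / t - h t / t\<bar>) \<longlongrightarrow> 0) (at_right 0)" by simp
    then show "((\<lambda>t. \<bar>f t - h t\<bar> / t) \<longlongrightarrow> 0) (at_right 0)"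
    proof (rule Lim_transform_eventually)
      show "\<forall>\<^sub>F t in at_right 0. \<bar>f t / t - h t / t\<bar> = \<bar>f t - h t\<bar> / t"
        using eventually_at_right_less[of 0]
        by eventually_elim (simp flip: diff_divide_distrib)
    qed
    show "\<forall>\<^sub>F t in at_right (0::real). t \<noteq> 0"
      using eventually_at_right_less[of "0::real"] by eventually_elim simp
  qed
  have id: "((\<lambda>t. t * ?L / t) \<longlongrightarrow> ?L) (at_right 0)"
  proof (rule Lim_transform_eventually[OF tendsto_const])
    show "\<forall>\<^sub>F t in at_right 0. ?L = t * ?L / t"
      using eventually_at_right_less[of 0] by eventually_elim simp
  qed
  show ?thesis
  proof (intro conjI)
    show "(\<lambda>t. \<bar>?wr t - t * ?L\<bar>) \<in> o[at_right 0](\<lambda>t. t)" by (rule small[OF wr id])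
    show "(\<lambda>t. \<bar>?w t - ?T t\<bar>) \<in> o[at_right 0](\<lambda>t. t)" by (rule small[OF w T])
    \<comment> \<open>Both curves start at \<theta>, so the value subtracted in the difference
      quotient is a self-distance, which is 0, and the quotient is the one whose limit is
      known.\<close>
    show "(?wr has_real_derivative ?L) (at_right 0)"
      using wr by (simp add: has_field_derivative_iff \<gamma>0 W_restr_self[OF \<theta>])
    show "(?w has_real_derivative ?L) (at_right 0)"
      using w by (simp add: has_field_derivative_iff \<gamma>0 W_self[OF \<theta>])
  qed
qed


end
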